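(* Let $(\mathbf{n}_\kappa)_{\kappa\ge 1}$ be a sequence of degree statistics such that, as $\kappa\to\infty$: $|\mathbf{n}_\kappa|\to\infty$; for every $i\ge 0$, $p_i(\mathbf{n}_\kappa)\to p_i$, where $\mathbf{p}=(p_i)_{i\ge 0}$ is a probability distribution on $\mathbb{N}_0$; and $\sum_{i\ge 0}i^2p_i(\mathbf{n}_\kappa)\to\sum_{i\ge 0}i^2p_i<\infty$. Assume that $\mathbf{p}$ is nonlattice. Let $m_\kappa$, $\kappa\ge 1$, be integers with $1\le m_\kappa\le|\mathbf{n}_\kappa|$ such that $m_\kappa\sim a|\mathbf{n}_\kappa|^{2/3}$ as $\kappa\to\infty$, for some constant $a>0$. Then, as $\kappa\to\infty$, $N_{m_\kappa}(\mathcal{T}_{\mathbf{n}_\kappa})$ converges in distribution to $$\mathrm{Po}\bigl((2\pi\sigma_{\mathbf{p}}^2a^3)^{-1/2}\bigr).$$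
   Context: $\mathbb{N}_0=\{0,1,2,\dots\}$. All trees are finite rooted plane (ordered) trees; $|T|$ is the number of vertices of $T$, and the (out)degree of a vertex is its number of children. A sequence $\mathbf{n}=(n(i))_{i\ge 0}$ of nonnegative integers is called a degree statistic if $\sum_{i\ge 0}n(i)=1+\sum_{i\ge 0}i\,n(i)<\infty$. Put $|\mathbf{n}|=\sum_i n(i)$ and $p_i(\mathbf{n})=n(i)/|\mathbf{n}|$. $\mathbb{T}_{\mathbf{n}}$ is the (finite, nonempty) set of plane rooted trees (up to isomorphism of plane rooted trees) having exactly $n(i)$ vertices with $i$ children for every $i\ge0$, and $\mathcal{T}_{\mathbf{n}}$ is a uniformly random element of $\mathbb{T}_{\mathbf{n}}$. For $v\in T$, the fringe tree $T_v$ is the subtree of $T$ consisting of $v$ and all its descendants. For an integer $m\ge 1$, $N_m(T)=\#\{v\in T:|T_v|=m\}$. A probability distribution $\mathbf{p}$ on $\mathbb{Z}$ (or $\mathbb{N}_0$) is nonlattice if its span, i.e. $\gcd\{i-j: p_i>0,\ p_j>0\}$ (taken to be $\infty$ if $\mathbf{p}$ is concentrated at a single point), equals $1$. $\sigma_{\mathbf{p}}^2$ denotes the variance of $\mathbf{p}$, which under these assumptions (where $\mathbf{p}$ has mean $1$) equals $\sum_{i\ge 0}(i-1)^2p_i$. $\mathrm{Po}(\lambda)$ is the Poisson distribution with mean $\lambda$. $a_\kappa\sim b_\kappa$ means $a_\kappa/b_\kappa\to1$. *)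

theory Defs
  imports "HOL-Probability.Probability" "HOL-Library.Landau_Symbols" "HOL-Library.Extended_Nat"
begin

text \<open>
  Values of this datatype are in bijection with the isomorphism classes of finite plane rooted
  trees. A vertex is addressed by the list of (0-based) child indices on the path leading to it
  from the root.
\<close>

datatype plane_tree = PNode (children: "plane_tree list")

primrec is_vertex :: "nat list \<Rightarrow> plane_tree \<Rightarrow> bool" where
  "is_vertex [] T = True"
| "is_vertex (i # v) T = (i < length (children T) \<and> is_vertex v (children T ! i))"

definition vertices :: "plane_tree \<Rightarrow> nat list set" where
  "vertices T = {v. is_vertex v T}"

text \<open>\<open>fringe_tree v T\<close> is meaningful only if \<open>v\<close> is a vertex of \<open>T\<close>.\<close>

primrec fringe_tree :: "nat list \<Rightarrow> plane_tree \<Rightarrow> plane_tree" where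
  "fringe_tree [] T = T"
| "fringe_tree (i # v) T = fringe_tree v (children T ! i)"

definition outdegree :: "nat list \<Rightarrow> plane_tree \<Rightarrow> nat" where
  "outdegree v T = length (children (fringe_tree v T))"

definition num_vertices :: "plane_tree \<Rightarrow> nat" where
  "num_vertices T = card (vertices T)"

definition num_fringe :: "nat \<Rightarrow> plane_tree \<Rightarrow> nat" where
  "num_fringe m T = card {v \<in> vertices T. num_vertices (fringe_tree v T) = m}"

lemma vertices_PNode:
  "vertices (PNode ts) = insert [] (\<Union>i<length ts. (#) i ` vertices (ts ! i))"
proof -
  have "v \<in> vertices (PNode ts) \<longleftrightarrow> v \<in> insert [] (\<Union>i<length ts. (#) i ` vertices (ts ! i))" for v
    by (cases v) (auto simp: vertices_def)
  then show ?thesis by blast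
qed

lemma finite_vertices: "finite (vertices T)"
  by (induction T) (simp add: vertices_PNode)

definition stat_size :: "(nat \<Rightarrow> nat) \<Rightarrow> nat" where
  "stat_size n = (\<Sum>i | n i > 0. n i)"

text \<open>
  A series of nonnegative integers converges iff it has finitely many nonzero terms, so the
  finiteness requirement in the definition of a degree statistic is finiteness of the support.
\<close>

definition degree_statistic :: "(nat \<Rightarrow> nat) \<Rightarrow> bool" where
  "degree_statistic n \<longleftrightarrow>
     finite {i. n i > 0} \<and> (\<Sum>i | n i > 0. n i) = 1 + (\<Sum>i | n i > 0. i * n i)"

definition stat_prob :: "(nat \<Rightarrow> nat) \<Rightarrow> nat \<Rightarrow> real" where
  "stat_prob n i = real (n i) / real (stat_size n)"

definition trees_with :: "(nat \<Rightarrow> nat) \<Rightarrow> plane_tree set" where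
  "trees_with n = {T. \<forall>i. card {v \<in> vertices T. outdegree v T = i} = n i}"

text \<open>Meaningful for degree statistics, for which \<open>trees_with n\<close> is finite and nonempty.\<close>

definition random_tree :: "(nat \<Rightarrow> nat) \<Rightarrow> plane_tree pmf" where
  "random_tree n = pmf_of_set (trees_with n)"

definition lattice_span :: "nat pmf \<Rightarrow> enat" where
  "lattice_span p =
     (if \<exists>k. set_pmf p = {k} then \<infinity>
      else enat (nat (Gcd {int i - int j | i j. pmf p i > 0 \<and> pmf p j > 0})))"

definition nonlattice :: "nat pmf \<Rightarrow> bool" where
  "nonlattice p \<longleftrightarrow> lattice_span p = 1"

end

theory Submission
  imports Defs "HOL-Combinatorics.Multiset_Permutations" "HOL-Number_Theory.Cong"
begin

text \<open>
  A plane tree is encoded by the preorder word of its outdegrees, and fringe trees of size \<open>m\<close> are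
  exactly the length-\<open>m\<close> factors of this word that are themselves preorder words of trees. Read
  cyclically the word acquires no further such factor, so the number of fringe trees of size \<open>m\<close> is
  a rotation-invariant function of the word. By the cycle lemma every word with the prescribed
  degree multiset and sum one less than its length has exactly one rotation that encodes a tree, so
  the uniform random tree may be replaced by a uniformly random arrangement of the degree multiset
  (\<open>sum_rotation_invariant\<close>).

  Factors encoding trees of the same size never overlap. Hence the \<open>k\<close>-th factorial moment is the
  number of ways to place \<open>k\<close> labelled disjoint arcs of length \<open>m\<close> on a cycle of length \<open>N\<close>, asymptotically
  \<open>N\<^sup>k\<close>, times the probability that \<open>k\<close> given disjoint blocks all encode trees. By exchangeability
  the blocks may be taken to be the first \<open>k\<close> ones, and by the cycle lemma inside each block this
  probability is \<open>m\<close> to the power \<open>- k\<close> times the probability that each of these blocks has degree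
  sum \<open>m - 1\<close> (\<open>sum_binomial_cyclic_fringe\<close>, \<open>num_initial_tree_word\<close>).

  What remains is a local limit theorem for sampling without replacement: if \<open>m\<close> tends to infinity
  and \<open>m / N\<close> tends to 0, a random block of length \<open>m\<close> has degree sum \<open>m - 1\<close> with probability
  asymptotic to \<open>(2 \<pi> \<sigma>\<^sup>2 m)\<close> to the power \<open>- 1 / 2\<close> (\<open>local_limit_subsets\<close>). It is proved by realizing a
  uniform \<open>m\<close>-subset as Bernoulli sampling with probability \<open>m / N\<close> conditioned on the sample size,
  by two-dimensional Fourier inversion and by dominated convergence; the dominating function comes
  from the nonlattice condition. Removing \<open>m\<close> entries changes neither the limiting degree
  distribution nor the uniform integrability of the squared degrees, so the theorem applies to one
  block after another (\<open>block_prob_tendsto\<close>). With \<open>m\<close> asymptotic to \<open>a\<close> times \<open>N\<close> to the power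
  \<open>2 / 3\<close>, the factorial moments converge to those of the Poisson distribution, and the Bonferroni
  inequalities turn this into convergence in distribution.
\<close>

section \<open>Preorder words of plane trees\<close>

primrec preorder_word :: "plane_tree \<Rightarrow> nat list" where
  "preorder_word (PNode ts) = length ts # concat (map preorder_word ts)"

abbreviation forest_word :: "plane_tree list \<Rightarrow> nat list" where
  "forest_word ts \<equiv> concat (map preorder_word ts)"

text \<open>
  Listed in preorder, so that position \<open>i\<close> of the preorder word belongs to the root of the \<open>i\<close>-th tree.
\<close>

primrec fringe_trees :: "plane_tree \<Rightarrow> plane_tree list" where
  "fringe_trees (PNode ts) = PNode ts # concat (map fringe_trees ts)"

text \<open>
  The final height of the Lukasiewicz path of the word.
\<close>

definition excess :: "nat list \<Rightarrow> int" where
  "excess w = (\<Sum>d\<leftarrow>w. int d - 1)"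

definition tree_word :: "nat list \<Rightarrow> bool" where
  "tree_word w \<longleftrightarrow> (\<exists>T. w = preorder_word T)"

lemma excess_simps [simp]:
  "excess [] = 0"
  "excess (d # w) = int d - 1 + excess w"
  "excess (u @ w) = excess u + excess w"
  by (simp_all add: excess_def)

lemma excess_eq_sum_list: "excess w = int (sum_list w) - int (length w)"
  by (induction w) auto

lemma excess_forest_word: "excess (forest_word ts) = - int (length ts)"
proof -
  have "excess (preorder_word T) = -1" for T
  proof (induction T)
    case (PNode ts)
    have "excess (forest_word us) = - int (length us)" if "set us \<subseteq> set ts" for us
      using that PNode by (induction us) auto
    from this[of ts] show ?case by simp
  qed
  then show ?thesis by (induction ts) auto
qed

lemma excess_preorder_word [simp]: "excess (preorder_word T) = -1"
  using excess_forest_word[of "[T]"] by simp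

lemma preorder_word_nonempty [simp]: "preorder_word T \<noteq> []"
  by (cases T) simp

text \<open>
  A forest with \<open>k\<close> trees is not completely read before its excess has dropped to \<open>- k\<close>: reading a
  degree \<open>d\<close> replaces the first tree by its \<open>d\<close> subtrees, which is the step of the induction.
\<close>

lemma forest_word_prefix_excess:
  "forest_word ts = u @ v \<Longrightarrow> v \<noteq> [] \<Longrightarrow> excess u > - int (length ts)"
proof (induction u arbitrary: ts)
  case Nil
  then show ?case by (cases ts) auto
next
  case (Cons d u)
  obtain T rs where "ts = T # rs"
    using Cons.prems(1) by (cases ts) simp_all
  moreover obtain us where "T = PNode us" by (cases T)
  ultimately have ts: "ts = PNode us # rs" by simp
  have d: "d = length us" and "forest_word (us @ rs) = u @ v"
    using Cons.prems ts by auto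
  from Cons.IH[OF this(2) Cons.prems(2)] show ?case using d ts by simp
qed

text \<open>
  Conversely, a word that reaches excess \<open>- k\<close> only at its end can be parsed. The induction runs from
  the right: the letter \<open>d\<close> collects the first \<open>d\<close> trees of the forest parsed so far as its children.
\<close>

lemma forest_wordI:
  assumes "excess w = - int k"
    and "\<And>u v. w = u @ v \<Longrightarrow> v \<noteq> [] \<Longrightarrow> excess u > - int k"
  shows "\<exists>ts. length ts = k \<and> w = forest_word ts"
  using assms
proof (induction w arbitrary: k)
  case Nil
  then show ?case by auto
next
  case (Cons d w)
  have k: "k \<ge> 1" using Cons.prems(2)[of "[]"] by auto
  \<comment> \<open>After the letter \<open>d\<close> the number of trees still to be read is \<open>k - 1 + d\<close>.\<close>
  have "\<exists>ts. length ts = k + d - 1 \<and> w = forest_word ts"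
  proof (rule Cons.IH)
    show "excess w = - int (k + d - 1)" using Cons.prems(1) k by auto
    fix u v assume "w = u @ v" "v \<noteq> []"
    then show "excess u > - int (k + d - 1)" using Cons.prems(2)[of "d # u" v] k by auto
  qed
  then obtain ts where ts: "length ts = k + d - 1" "w = forest_word ts" by auto
  have "d # w = forest_word (PNode (take d ts) # drop d ts)"
    using ts k by (simp flip: concat_append map_append)
  moreover have "length (PNode (take d ts) # drop d ts) = k"
    using ts k by simp
  ultimately show ?case by blast
qed

lemma tree_word_iff:
  "tree_word w \<longleftrightarrow> excess w = -1 \<and> (\<forall>u v. w = u @ v \<longrightarrow> v \<noteq> [] \<longrightarrow> excess u \<ge> 0)"
  (is "_ \<longleftrightarrow> ?R")
proof
  assume "tree_word w"
  then obtain T where "w = forest_word [T]" by (auto simp: tree_word_def)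
  then show ?R
    using forest_word_prefix_excess[of "[T]"] excess_forest_word[of "[T]"] by fastforce
next
  assume ?R
  then have "\<exists>ts. length ts = 1 \<and> w = forest_word ts"
    by (intro forest_wordI) fastforce+
  then show "tree_word w"
    by (auto simp: tree_word_def length_Suc_conv)
qed

text \<open>
  Comparing first letters and merging the children of the first root with the remaining trees gives
  forests of equal length with a shorter word.
\<close>

lemma forest_word_inj:
  "forest_word ts = forest_word us \<Longrightarrow> length ts = length us \<Longrightarrow> ts = us"
proof (induction "length (forest_word ts)" arbitrary: ts us rule: less_induct)
  case less
  show ?case
  proof (cases ts)
    case Nil
    then show ?thesis using less.prems by simp
  next
    case (Cons T rs)
    then obtain U ss where us: "us = U # ss" using less.prems by (cases us) auto
    obtain as where T: "T = PNode as" by (cases T)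
    obtain bs where U: "U = PNode bs" by (cases U)
    have 1: "length as = length bs" "forest_word (as @ rs) = forest_word (bs @ ss)"
      using less.prems Cons us T U by auto
    moreover have "length (forest_word (as @ rs)) < length (forest_word ts)"
      using Cons T by simp
    moreover have "length (as @ rs) = length (bs @ ss)"
      using 1 less.prems Cons us by simp
    ultimately have "as @ rs = bs @ ss" using less.hyps by blast
    then show ?thesis using 1 Cons us T U by simp
  qed
qed

lemma inj_preorder_word: "inj preorder_word"
proof (rule injI)
  fix T U assume "preorder_word T = preorder_word U"
  then show "T = U" using forest_word_inj[of "[T]" "[U]"] by simp
qed

lemma tree_word_prefix_unique:
  assumes "tree_word u" "tree_word v" "u @ x = v @ y"
  shows "u = v"
proof -
  from assms(3) obtain z where "u = v @ z \<or> v = u @ z"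
    by (auto simp: append_eq_append_conv2)
  moreover have "z = []" if "s @ z = t" "tree_word s" "tree_word t" for s t
  proof (rule ccontr)
    assume "z \<noteq> []"
    then have "excess s \<ge> 0" using that(1,3) unfolding tree_word_iff by blast
    then show False using that(2) by (simp add: tree_word_iff)
  qed
  ultimately show ?thesis
    using assms(1,2) by (metis append_Nil2)
qed

text \<open>
  In an overlap \<open>y\<close> the first word forces \<open>y\<close> to have negative excess, being what is left after a proper
  prefix, while the second word forces it to have nonnegative excess, being a proper prefix.
\<close>

lemma tree_word_overlap:
  assumes "tree_word (x @ y)" "tree_word (y @ z)" "y \<noteq> []" "z \<noteq> []"
  shows False
proof -
  have "excess (x @ y) = -1" "excess x \<ge> 0" "excess y \<ge> 0"
    using assms by (auto simp: tree_word_iff)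
  then show False by simp
qed

lemma card_vertices_PNode:
  "card {v \<in> vertices (PNode ts). P v} =
     (if P [] then 1 else 0) + (\<Sum>i<length ts. card {v \<in> vertices (ts ! i). P (i # v)})"
proof -
  have eq: "{v \<in> vertices (PNode ts). P v} =
     {v. v = [] \<and> P []} \<union> (\<Union>i<length ts. (#) i ` {v \<in> vertices (ts ! i). P (i # v)})"
    by (auto simp: vertices_PNode)
  have "card {v \<in> vertices (PNode ts). P v} = card {v::nat list. v = [] \<and> P []}
      + card (\<Union>i<length ts. (#) i ` {v \<in> vertices (ts ! i). P (i # v)})"
    unfolding eq by (rule card_Un_disjoint) (auto simp: finite_vertices)
  also have "card (\<Union>i<length ts. (#) i ` {v \<in> vertices (ts ! i). P (i # v)})
     = (\<Sum>i<length ts. card ((#) i ` {v \<in> vertices (ts ! i). P (i # v)}))"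
    by (rule card_UN_disjoint) (auto simp: finite_vertices)
  also have "\<dots> = (\<Sum>i<length ts. card {v \<in> vertices (ts ! i). P (i # v)})"
    by (simp add: card_image)
  also have "card {v::nat list. v = [] \<and> P []} = (if P [] then 1 else 0)"
    by auto
  finally show ?thesis .
qed

lemma length_filter_concat_map:
  "length (filter Q (concat (map f ts))) = (\<Sum>i<length ts. length (filter Q (f (ts ! i))))"
  by (simp add: filter_concat length_concat comp_def sum_list_sum_nth atLeast0LessThan)

lemma card_vertices_fringe:
  "card {v \<in> vertices T. P (fringe_tree v T)} = length (filter P (fringe_trees T))"
proof (induction T)
  case (PNode ts)
  then show ?case
    by (simp add: card_vertices_PNode length_filter_concat_map)
qed

lemma preorder_word_eq_map:
  "preorder_word T = map (\<lambda>U. length (children U)) (fringe_trees T)"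
  by (induction T) (simp add: map_concat comp_def cong: map_cong)

lemma length_fringe_trees: "length (fringe_trees T) = length (preorder_word T)"
  by (simp add: preorder_word_eq_map)

lemma num_vertices_eq: "num_vertices T = length (preorder_word T)"
  using card_vertices_fringe[of T "\<lambda>_. True"] by (simp add: num_vertices_def length_fringe_trees)

lemma count_mset_preorder_word:
  "count (mset (preorder_word T)) i = card {v \<in> vertices T. outdegree v T = i}"
proof -
  have "card {v \<in> vertices T. outdegree v T = i} = length (filter (\<lambda>U. length (children U) = i) (fringe_trees T))"
    unfolding outdegree_def by (rule card_vertices_fringe)
  also have "\<dots> = length (filter ((=) i) (preorder_word T))"
    by (simp add: preorder_word_eq_map filter_map comp_def) (metis (mono_tags, lifting))
  also have "\<dots> = count (mset (preorder_word T)) i"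
    by (simp add: count_mset count_list_eq_length_filter)
  finally show ?thesis ..
qed

text \<open>
  Preorder visits the vertices of each fringe tree consecutively, beginning with its root.
\<close>

lemma drop_preorder_word:
  "i < length (preorder_word T) \<Longrightarrow>
     \<exists>u. drop i (preorder_word T) = preorder_word (fringe_trees T ! i) @ u"
proof -
  have *: "\<exists>u. drop i (forest_word ts) = preorder_word (concat (map fringe_trees ts) ! i) @ u"
    if "\<And>T i. T \<in> set ts \<Longrightarrow> i < length (preorder_word T) \<Longrightarrow>
          \<exists>u. drop i (preorder_word T) = preorder_word (fringe_trees T ! i) @ u"
      "i < length (forest_word ts)" for ts i
    using that
  proof (induction ts arbitrary: i)
    case (Cons T ts)
    show ?case
    proof (cases "i < length (preorder_word T)")
      case True
      with Cons.prems(1)[of T i] show ?thesis by (auto simp: nth_append length_fringe_trees)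
    next
      case False
      with Cons.IH[of "i - length (preorder_word T)"] Cons.prems show ?thesis
        by (auto simp: nth_append length_fringe_trees)
    qed
  qed simp
  show "i < length (preorder_word T) \<Longrightarrow>
     \<exists>u. drop i (preorder_word T) = preorder_word (fringe_trees T ! i) @ u"
  proof (induction T arbitrary: i)
    case (PNode ts)
    show ?case
    proof (cases i)
      case (Suc j)
      with * [of ts j] PNode show ?thesis by auto
    qed simp
  qed
qed

definition cyclic_fringe :: "nat \<Rightarrow> nat list \<Rightarrow> nat" where
  "cyclic_fringe m w = card {i. i < length w \<and> tree_word (take m (rotate i w))}"

text \<open>
  At each position of the preorder word starts the word of a fringe tree, and no tree word is a proper
  prefix of another one. So the only tree word starting there has the length of that fringe tree, and
  factors that wrap around the end of the word contribute nothing.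
\<close>

lemma num_fringe_eq_cyclic_fringe:
  assumes "m \<le> length (preorder_word T)"
  shows "num_fringe m T = cyclic_fringe m (preorder_word T)"
proof -
  let ?w = "preorder_word T"
  have "tree_word (take m (rotate i ?w)) \<longleftrightarrow> num_vertices (fringe_trees T ! i) = m"
    if i: "i < length ?w" for i
  proof -
    obtain u where u: "drop i ?w = preorder_word (fringe_trees T ! i) @ u"
      using drop_preorder_word[OF i] by blast
    let ?v = "preorder_word (fringe_trees T ! i)"
    have rot: "rotate i ?w = ?v @ u @ take i ?w"
      using u i by (simp add: rotate_drop_take)
    have v: "tree_word ?v" by (auto simp: tree_word_def)
    have len: "length (take m (rotate i ?w)) = m" using assms by simp
    have cat: "take m (rotate i ?w) @ drop m (rotate i ?w) = ?v @ u @ take i ?w"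
      unfolding append_take_drop_id by (rule rot)
    show ?thesis
    proof
      assume "tree_word (take m (rotate i ?w))"
      then show "num_vertices (fringe_trees T ! i) = m"
        using tree_word_prefix_unique[OF _ v cat] len by (simp add: num_vertices_eq)
    next
      assume "num_vertices (fringe_trees T ! i) = m"
      then have "take m (rotate i ?w) = ?v" by (simp add: rot num_vertices_eq)
      with v show "tree_word (take m (rotate i ?w))" by simp
    qed
  qed
  then have "cyclic_fringe m ?w = card {i. i < length ?w \<and> num_vertices (fringe_trees T ! i) = m}"
    unfolding cyclic_fringe_def by (metis (no_types, lifting))
  also have "\<dots> = num_fringe m T"
    unfolding num_fringe_def card_vertices_fringe[of T "\<lambda>U. num_vertices U = m"]
    by (simp add: length_filter_conv_card length_fringe_trees)
  finally show ?thesis ..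
qed

section \<open>The cycle lemma\<close>

lemma excess_take_drop: "excess (take i w) + excess (drop i w) = excess w"
  by (metis append_take_drop_id excess_simps(3))

lemma rotate_eq_drop_take: "i \<le> length w \<Longrightarrow> rotate i w = drop i w @ take i w"
  by (cases "i = length w") (auto simp: rotate_drop_take)

lemma mset_rotate [simp]: "mset (rotate i w) = mset w"
proof (induction i)
  case (Suc i)
  then show ?case by (cases "rotate i w") auto
qed simp

lemma excess_rotate [simp]: "excess (rotate i w) = excess w"
  unfolding excess_eq_sum_list by (metis mset_rotate size_mset sum_mset_sum_list)

text \<open>
  Two good rotations would cut the cyclic word into two nonempty pieces, each of which is a proper prefix
  of one of them and so has nonnegative excess; but the excesses add up to \<open>- 1\<close>.
\<close>

lemma cycle_lemma_unique:
  assumes "i < length w" "j < length w" "tree_word (rotate i w)" "tree_word (rotate j w)"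
  shows "i = j"
proof -
  have *: False if "i < j" "j < length w" "tree_word (rotate i w)" "tree_word (rotate j w)" for i j
  proof -
    have "excess w = -1" using that(3) by (metis excess_rotate tree_word_iff)
    define x where "x = take (j - i) (drop i w)"
    have w: "w = take i w @ x @ drop j w" unfolding x_def
      using that by (metis append_take_drop_id drop_drop le_add_diff_inverse2 less_imp_le_nat)
    have 1: "rotate i w = x @ drop j w @ take i w"
      using that rotate_append[of "take i w" "x @ drop j w"] w[symmetric] by simp
    have 2: "rotate j w = (drop j w @ take i w) @ x"
    proof -
      have "length (take i w @ x) = j" using that by (simp add: x_def)
      then show ?thesis
        using rotate_append[of "take i w @ x" "drop j w"] w[symmetric] by simp
    qed
    have "drop j w \<noteq> []" "x \<noteq> []" using that by (auto simp: x_def)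
    then have "excess x \<ge> 0" "excess (drop j w @ take i w) \<ge> 0"
      using that(3,4) 1 2 unfolding tree_word_iff by blast+
    moreover have "excess x + excess (drop j w @ take i w) = -1"
      using \<open>excess w = -1\<close> arg_cong[OF 1, of excess] by simp
    ultimately show False by simp
  qed
  show ?thesis using *[of i j] *[of j i] assms by (cases i j rule: linorder_cases) auto
qed

text \<open>
  The rotation starts where the path of partial excesses attains its minimum for the first time.
\<close>

lemma cycle_lemma_exists:
  assumes "excess w = -1"
  shows "\<exists>i<length w. tree_word (rotate i w)"
proof -
  define P where "P j = excess (take j w)" for j
  obtain i0 where i0: "i0 \<le> length w" "\<And>j. j \<le> length w \<Longrightarrow> P i0 \<le> P j"
    using ex_min_if_finite[of "P ` {..length w}"] by (fastforce simp: not_less)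
  define i where "i = (LEAST i. i \<le> length w \<and> (\<forall>j\<le>length w. P i \<le> P j))"
  have i: "i \<le> length w" "\<And>j. j \<le> length w \<Longrightarrow> P i \<le> P j"
    using LeastI[of "\<lambda>i. i \<le> length w \<and> (\<forall>j\<le>length w. P i \<le> P j)" i0] i0
    unfolding i_def by blast+
  have less: "P i < P j" if "j < i" for j
  proof (rule ccontr)
    assume "\<not> P i < P j"
    then have "j \<le> length w \<and> (\<forall>k\<le>length w. P j \<le> P k)"
      using i that by fastforce
    then have "i \<le> j" unfolding i_def by (rule Least_le)
    with that show False by simp
  qed
  have "tree_word (rotate i w)"
    unfolding tree_word_iff
  proof (intro conjI allI impI)
    show "excess (rotate i w) = -1" using assms by simp
    fix u v assume uv: "rotate i w = u @ v" "v \<noteq> []"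
    have rot: "rotate i w = drop i w @ take i w" using i by (rule_tac rotate_eq_drop_take)
    define r where "r = length u"
    have r: "r < length w" using uv r_def by (metis length_append length_greater_0_conv length_rotate less_add_same_cancel1)
    have u: "u = take r (drop i w @ take i w)" using uv rot r_def by auto
    show "0 \<le> excess u"
    proof (cases "r \<le> length w - i")
      case True
      then have "take (i + r) w = take i w @ u"
        using u by (simp add: take_add)
      then have "P (i + r) = P i + excess u" by (simp add: P_def)
      with i(2)[of "i + r"] True i(1) show ?thesis by simp
    next
      case False
      then have "u = drop i w @ take (r - (length w - i)) w"
        using u i r by (simp add: min_def)
      then have "excess u = excess (drop i w) + P (r - (length w - i))" by (simp add: P_def)
      moreover have "excess (drop i w) = -1 - P i"
        using assms excess_take_drop[of i w] by (simp add: P_def)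
      \<comment> \<open>The prefix has wrapped around; minimality at the first minimum is strict to its left,
        which compensates for the excess \<open>- 1\<close> of the whole word.\<close>
      moreover have "P i < P (r - (length w - i))" using r False i by (intro less) simp
      ultimately show ?thesis by simp
    qed
  qed
  moreover have "w \<noteq> []" using assms by auto
  ultimately show ?thesis
    by (metis length_greater_0_conv mod_less_divisor rotate_conv_mod)
qed

lemma cycle_lemma:
  assumes "excess w = -1"
  shows "card {i. i < length w \<and> tree_word (rotate i w)} = 1"
proof -
  obtain i where "i < length w" "tree_word (rotate i w)" using cycle_lemma_exists[OF assms] by auto
  then have "{i. i < length w \<and> tree_word (rotate i w)} = {i}"
    using cycle_lemma_unique by blast
  then show ?thesis by simp
qed

lemma length_permutations: "w \<in> permutations_of_multiset M \<Longrightarrow> length w = size M"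
  by (auto simp: permutations_of_multiset_def)

lemma rotate_bij_permutations:
  "bij_betw (rotate i) (permutations_of_multiset M) (permutations_of_multiset M)"
proof -
  have "inj_on (rotate i) (permutations_of_multiset M)"
    using inj_rotate1 by (auto simp: rotate_def intro: inj_on_subset inj_fn)
  moreover have "rotate i ` permutations_of_multiset M \<subseteq> permutations_of_multiset M"
    by (auto simp: permutations_of_multiset_def)
  ultimately show ?thesis
    by (simp add: bij_betw_def endo_inj_surj)
qed

text \<open>
  Double counting of pairs of an arrangement and a rotation of it that encodes a tree: by the cycle lemma
  every arrangement lies in exactly one such pair. With \<open>g\<close> constant this counts trees.
\<close>

lemma sum_rotation_invariant:
  fixes g :: "nat list \<Rightarrow> nat"
  assumes M: "sum_mset M + 1 = size M"
    and g: "\<And>i w. g (rotate i w) = g w"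
  shows "(\<Sum>w\<in>permutations_of_multiset M. g w) =
    size M * (\<Sum>w\<in>{w \<in> permutations_of_multiset M. tree_word w}. g w)"
proof -
  let ?S = "permutations_of_multiset M"
  have exc: "excess w = -1" if "w \<in> ?S" for w
  proof -
    have "sum_list w + 1 = length w"
      using that M unfolding permutations_of_multiset_def
      by (metis (mono_tags) mem_Collect_eq size_mset sum_mset_sum_list)
    then show ?thesis by (simp add: excess_eq_sum_list)
  qed
  have "(\<Sum>w\<in>?S. g w) = (\<Sum>w\<in>?S. \<Sum>i<size M. if tree_word (rotate i w) then g w else 0)"
  proof (rule sum.cong[OF refl])
    fix w assume w: "w \<in> ?S"
    have "(\<Sum>i<size M. if tree_word (rotate i w) then g w else 0) =
       card {i. i < length w \<and> tree_word (rotate i w)} * g w"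
      using length_permutations[OF w] by (simp add: sum.If_cases Int_def)
    then show "g w = (\<Sum>i<size M. if tree_word (rotate i w) then g w else 0)"
      using cycle_lemma[OF exc[OF w]] by simp
  qed
  also have "\<dots> = (\<Sum>i<size M. \<Sum>w\<in>?S. if tree_word (rotate i w) then g (rotate i w) else 0)"
    by (subst sum.swap) (simp add: g cong: if_cong)
  also have "\<dots> = (\<Sum>i<size M. \<Sum>w\<in>?S. if tree_word w then g w else 0)"
    by (intro sum.cong refl sum.reindex_bij_betw[OF rotate_bij_permutations])
  also have "\<dots> = size M * (\<Sum>w\<in>{w \<in> ?S. tree_word w}. g w)"
    by (simp add: sum.inter_filter)
  finally show ?thesis .
qed

lemma cyclic_fringe_rotate: "cyclic_fringe m (rotate j w) = cyclic_fringe m w"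
proof (cases "w = []")
  case False
  let ?N = "length w"
  have "bij_betw (\<lambda>i. (i + j) mod ?N) {i. i < ?N \<and> tree_word (take m (rotate (i + j) w))}
     {i. i < ?N \<and> tree_word (take m (rotate i w))}"
  proof (rule bij_betwI[where g = "\<lambda>i. (i + (?N - j mod ?N)) mod ?N"])
    have N: "?N > 0" using False by simp
    have 1: "((i + j) mod ?N + (?N - j mod ?N)) mod ?N = i" if "i < ?N" for i
    proof -
      have "((i + j) mod ?N + (?N - j mod ?N)) mod ?N = (i + (j mod ?N) + (?N - j mod ?N)) mod ?N"
        by (metis mod_add_left_eq mod_add_right_eq)
      also have "i + (j mod ?N) + (?N - j mod ?N) = i + ?N" using mod_less_divisor[OF N, of j] by linarith
      finally show ?thesis using that by simp
    qed
    have 2: "((i + (?N - j mod ?N)) mod ?N + j) mod ?N = i" if "i < ?N" for i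
    proof -
      have "((i + (?N - j mod ?N)) mod ?N + j) mod ?N = (i + (?N - j mod ?N) + j mod ?N) mod ?N"
        by (metis mod_add_left_eq mod_add_right_eq)
      also have "i + (?N - j mod ?N) + j mod ?N = i + ?N" using mod_less_divisor[OF N, of j] by linarith
      finally show ?thesis using that by simp
    qed
    show "(\<lambda>i. (i + j) mod ?N) \<in> {i. i < ?N \<and> tree_word (take m (rotate (i + j) w))} \<rightarrow>
       {i. i < ?N \<and> tree_word (take m (rotate i w))}"
      using N by (auto simp flip: rotate_conv_mod)
    show "(\<lambda>i. (i + (?N - j mod ?N)) mod ?N) \<in> {i. i < ?N \<and> tree_word (take m (rotate i w))} \<rightarrow>
       {i. i < ?N \<and> tree_word (take m (rotate (i + j) w))}"
    proof (rule funcsetI)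
      fix i assume i: "i \<in> {i. i < ?N \<and> tree_word (take m (rotate i w))}"
      then have "rotate ((i + (?N - j mod ?N)) mod ?N + j) w = rotate i w"
        using 2[of i] rotate_conv_mod[of "(i + (?N - j mod ?N)) mod ?N + j" w] by simp
      then show "(i + (?N - j mod ?N)) mod ?N \<in> {i. i < ?N \<and> tree_word (take m (rotate (i + j) w))}"
        using i N by simp
    qed
    show "\<And>i. i \<in> {i. i < ?N \<and> tree_word (take m (rotate (i + j) w))} \<Longrightarrow>
       ((i + j) mod ?N + (?N - j mod ?N)) mod ?N = i" using 1 by blast
    show "\<And>i. i \<in> {i. i < ?N \<and> tree_word (take m (rotate i w))} \<Longrightarrow>
       ((i + (?N - j mod ?N)) mod ?N + j) mod ?N = i" using 2 by blast
  qed
  then show ?thesis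
    by (simp add: cyclic_fringe_def rotate_rotate bij_betw_same_card)
qed (simp add: cyclic_fringe_def)

section \<open>Exchangeability and blocks\<close>

lemma inj_on_extend_bij_betw:
  assumes "finite S" "A \<subseteq> S" "inj_on f A" "f ` A \<subseteq> S"
  obtains g where "bij_betw g S S" "\<And>x. x \<in> A \<Longrightarrow> g x = f x"
proof -
  have "card (S - A) = card (S - f ` A)"
    using assms by (simp add: card_Diff_subset finite_subset card_image)
  then obtain h where h: "bij_betw h (S - A) (S - f ` A)"
    using assms(1) finite_same_card_bij[of "S - A" "S - f ` A"] by blast
  let ?g = "\<lambda>x. if x \<in> A then f x else h x"
  have "bij_betw ?g (A \<union> (S - A)) (f ` A \<union> (S - f ` A))"
    using assms(3) h by (intro bij_betw_disjoint_Un) (auto simp: bij_betw_def)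
  moreover have "A \<union> (S - A) = S" "f ` A \<union> (S - f ` A) = S" using assms by auto
  ultimately show thesis using that[of ?g] by simp
qed

text \<open>
  Exchangeability of a uniformly random arrangement: an injective choice of positions extends to a
  permutation of all positions, which acts bijectively on the arrangements.
\<close>

lemma card_permutations_at_positions:
  fixes M :: "'a multiset"
  assumes "distinct pos" "set pos \<subseteq> {..<size M}"
  shows "card {w \<in> permutations_of_multiset M. Q (map ((!) w) pos)} =
    card {w \<in> permutations_of_multiset M. Q (take (length pos) w)}"
proof -
  let ?S = "permutations_of_multiset M"
  have "length pos \<le> size M"
    using assms card_mono[of "{..<size M}" "set pos"] by (simp add: distinct_card)
  then have "{..<length pos} \<subseteq> {..<size M}" by auto
  moreover have "inj_on ((!) pos) {..<length pos}" "(!) pos ` {..<length pos} \<subseteq> {..<size M}"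
    using assms by (auto simp: inj_on_nth) (use nth_mem in blast)
  ultimately obtain g where g: "bij_betw g {..<size M} {..<size M}" "\<And>x. x < length pos \<Longrightarrow> g x = pos ! x"
    by (metis inj_on_extend_bij_betw finite_lessThan lessThan_iff)
  \<comment> \<open>The rearrangement that moves the chosen positions to the front.\<close>
  define f where "f = (\<lambda>w::'a list. map (\<lambda>i. w ! g i) [0..<size M])"
  have f_mset: "mset (f w) = mset w" if "length w = size M" for w
  proof -
    have "mset (f w) = image_mset ((!) w) (image_mset g (mset_set {..<size M}))"
      by (simp add: f_def multiset.map_comp comp_def atLeast0LessThan)
    also have "image_mset g (mset_set {..<size M}) = mset_set {..<size M}"
      using g(1) image_mset_mset_set[of g "{..<size M}"] by (simp add: bij_betw_def)
    also have "image_mset ((!) w) (mset_set {..<size M}) = mset w"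
      using that by (metis map_nth mset_map mset_upt atLeast0LessThan)
    finally show ?thesis .
  qed
  have "inj_on f ?S"
  proof (rule inj_onI)
    fix v w assume vw: "v \<in> ?S" "w \<in> ?S" "f v = f w"
    show "v = w"
    proof (rule nth_equalityI)
      show "length v = length w" using vw by (simp add: length_permutations)
      fix i assume "i < length v"
      then have "i \<in> g ` {..<size M}" using g(1) vw by (simp add: bij_betw_def length_permutations)
      then obtain j where "j < size M" "g j = i" by auto
      then show "v ! i = w ! i" using vw(3) by (auto simp: f_def)
    qed
  qed
  moreover have "f ` ?S \<subseteq> ?S"
    using f_mset length_permutations by (fastforce simp: permutations_of_multiset_def)
  ultimately have bij: "bij_betw f ?S ?S" by (simp add: bij_betw_def endo_inj_surj)
  have "take (length pos) (f w) = map ((!) w) pos" for w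
    using g(2) \<open>length pos \<le> size M\<close> by (auto simp: f_def list_eq_iff_nth_eq)
  then have "bij_betw f {w \<in> ?S. Q (map ((!) w) pos)} {w \<in> ?S. Q (take (length pos) w)}"
    using bij by (auto simp: bij_betw_def inj_on_def image_iff) (metis (no_types, lifting) image_iff)+
  then show ?thesis by (rule bij_betw_same_card)
qed

lemma finite_submultisets: "finite {A. A \<subseteq># M}"
proof (rule finite_subset)
  show "{A. A \<subseteq># M} \<subseteq> mset ` {u. set u \<subseteq> set_mset M \<and> length u \<le> size M}"
  proof
    fix A assume A: "A \<in> {A. A \<subseteq># M}"
    obtain u where "mset u = A" using ex_mset by blast
    then show "A \<in> mset ` {u. set u \<subseteq> set_mset M \<and> length u \<le> size M}"
      using A set_mset_mono[of A M] size_mset_mono[of A M] by (intro image_eqI[of _ _ u]) auto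
  qed
qed (simp add: finite_lists_length_le)

text \<open>
  An arrangement of \<open>M\<close> is an arrangement of some sub-multiset followed by one of the rest.
\<close>

lemma card_permutations_split:
  assumes "m \<le> size M"
  shows "card {w \<in> permutations_of_multiset M. P (take m w) \<and> Q (drop m w)} =
    (\<Sum>A | A \<subseteq># M \<and> size A = m. card {u \<in> permutations_of_multiset A. P u} *
        card {v \<in> permutations_of_multiset (M - A). Q v})"
proof -
  let ?S = "permutations_of_multiset"
  let ?F = "\<lambda>A. {w \<in> ?S M. mset (take m w) = A \<and> P (take m w) \<and> Q (drop m w)}"
  have fin: "finite {A. A \<subseteq># M \<and> size A = m}"
    by (rule finite_subset[OF _ finite_submultisets[of M]]) auto
  have "{w \<in> ?S M. P (take m w) \<and> Q (drop m w)} = (\<Union>A\<in>{A. A \<subseteq># M \<and> size A = m}. ?F A)"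
  proof (intro equalityI subsetI)
    fix w assume w: "w \<in> {w \<in> ?S M. P (take m w) \<and> Q (drop m w)}"
    then have "mset (take m w) \<subseteq># M"
      by (metis (mono_tags, lifting) CollectD append_take_drop_id mset_append
          mset_subset_eq_add_left permutations_of_multisetD)
    moreover have "size (mset (take m w)) = m"
      using w assms length_permutations[of w M] by simp
    ultimately show "w \<in> (\<Union>A\<in>{A. A \<subseteq># M \<and> size A = m}. ?F A)" using w by auto
  qed auto
  then have "card {w \<in> ?S M. P (take m w) \<and> Q (drop m w)} = (\<Sum>A | A \<subseteq># M \<and> size A = m. card (?F A))"
    using fin by (simp, subst card_UN_disjoint) auto
  also have "\<dots> = (\<Sum>A | A \<subseteq># M \<and> size A = m. card {u \<in> ?S A. P u} * card {v \<in> ?S (M - A). Q v})"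
  proof (rule sum.cong[OF refl])
    fix A assume "A \<in> {A. A \<subseteq># M \<and> size A = m}"
    then have A: "A \<subseteq># M" "size A = m" by auto
    have "bij_betw (\<lambda>(u, v). u @ v) ({u \<in> ?S A. P u} \<times> {v \<in> ?S (M - A). Q v}) (?F A)"
    proof (rule bij_betwI[where g = "\<lambda>w. (take m w, drop m w)"])
      show "(\<lambda>(u, v). u @ v) \<in> {u \<in> ?S A. P u} \<times> {v \<in> ?S (M - A). Q v} \<rightarrow> ?F A"
        using A by (auto simp: permutations_of_multiset_def)
      show "(\<lambda>w. (take m w, drop m w)) \<in> ?F A \<rightarrow> {u \<in> ?S A. P u} \<times> {v \<in> ?S (M - A). Q v}"
      proof (clarsimp simp: permutations_of_multiset_def)
        fix w :: "'a list"
        have "mset w = mset (take m w) + mset (drop m w)"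
          by (metis append_take_drop_id mset_append)
        then show "mset (drop m w) = mset w - mset (take m w)" by simp
      qed
    next
      fix x assume "x \<in> {u \<in> ?S A. P u} \<times> {v \<in> ?S (M - A). Q v}"
      then show "(take m (case x of (u, v) \<Rightarrow> u @ v), drop m (case x of (u, v) \<Rightarrow> u @ v)) = x"
        using A length_permutations[of "fst x" A] by (cases x) simp
    qed simp
    then show "card (?F A) = card {u \<in> ?S A. P u} * card {v \<in> ?S (M - A). Q v}"
      using bij_betw_same_card by (fastforce simp: card_cartesian_product)
  qed
  finally show ?thesis .
qed

primrec initial_blocks :: "nat \<Rightarrow> ('a list \<Rightarrow> bool) \<Rightarrow> nat \<Rightarrow> 'a list \<Rightarrow> bool" where
  "initial_blocks m B 0 w = True"
| "initial_blocks m B (Suc k) w = (B (take m w) \<and> initial_blocks m B k (drop m w))"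

definition num_initial :: "nat \<Rightarrow> ('a list \<Rightarrow> bool) \<Rightarrow> nat \<Rightarrow> 'a multiset \<Rightarrow> nat" where
  "num_initial m B k M = card {w \<in> permutations_of_multiset M. initial_blocks m B k w}"

lemma num_initial_Suc:
  assumes "m \<le> size M"
  shows "num_initial m B (Suc k) M =
    (\<Sum>A | A \<subseteq># M \<and> size A = m. card {u \<in> permutations_of_multiset A. B u} * num_initial m B k (M - A))"
  unfolding num_initial_def initial_blocks.simps by (rule card_permutations_split[OF assms])

text \<open>
  If the sum does not fit the length then both sides vanish; otherwise this is the cycle lemma.
\<close>

lemma card_tree_words:
  fixes A :: "nat multiset"
  assumes "size A \<ge> 1"
  shows "size A * card {u \<in> permutations_of_multiset A. tree_word u} =
    card {u \<in> permutations_of_multiset A. sum_list u + 1 = length u}"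
proof -
  have perm: "sum_list u = sum_mset A \<and> length u = size A" if "u \<in> permutations_of_multiset A" for u
    using that by (auto simp: permutations_of_multiset_def sum_mset_sum_list)
  show ?thesis
  proof (cases "sum_mset A + 1 = size A")
    case True
    have "{u \<in> permutations_of_multiset A. sum_list u + 1 = length u} = permutations_of_multiset A"
      using True perm by auto
    then show ?thesis
      using sum_rotation_invariant[OF True, of "\<lambda>_. 1"] by simp
  next
    case False
    then have "sum_list u + 1 \<noteq> length u" if "u \<in> permutations_of_multiset A" for u
      using perm[OF that] by simp
    moreover have "sum_list u + 1 = length u" if "tree_word u" for u
    proof -
      have "excess u = -1" using that by (simp add: tree_word_iff)
      then show ?thesis by (simp add: excess_eq_sum_list)
    qed
    ultimately have "{u \<in> permutations_of_multiset A. sum_list u + 1 = length u} = {}"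
      and "{u \<in> permutations_of_multiset A. tree_word u} = {}"
      by blast+
    then show ?thesis by (simp only: card.empty)
  qed
qed

text \<open>
  The cycle lemma is applied to one block after another; the arrangements are split after the first
  block to isolate it.
\<close>

lemma num_initial_tree_word:
  assumes "m \<ge> 1" "k * m \<le> size M"
  shows "m ^ k * num_initial m tree_word k M = num_initial m (\<lambda>u. sum_list u + 1 = m) k M"
  using assms(2)
proof (induction k arbitrary: M)
  case 0
  then show ?case by (simp add: num_initial_def)
next
  case (Suc k)
  have "m ^ Suc k * num_initial m tree_word (Suc k) M =
    (\<Sum>A | A \<subseteq># M \<and> size A = m. (m * card {u \<in> permutations_of_multiset A. tree_word u})
        * (m ^ k * num_initial m tree_word k (M - A)))"
    using Suc.prems by (simp add: num_initial_Suc sum_distrib_left mult_ac)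
  also have "\<dots> = (\<Sum>A | A \<subseteq># M \<and> size A = m. card {u \<in> permutations_of_multiset A. sum_list u + 1 = m}
        * num_initial m (\<lambda>u. sum_list u + 1 = m) k (M - A))"
  proof (rule sum.cong[OF refl], rule arg_cong2[of _ _ _ _ "(*)"])
    fix A assume A: "A \<in> {A. A \<subseteq># M \<and> size A = m}"
    then have "{u \<in> permutations_of_multiset A. sum_list u + 1 = m} =
        {u \<in> permutations_of_multiset A. sum_list u + 1 = length u}"
      by (auto simp: length_permutations)
    then show "m * card {u \<in> permutations_of_multiset A. tree_word u} =
        card {u \<in> permutations_of_multiset A. sum_list u + 1 = m}"
      using A assms(1) card_tree_words[of A] by simp
    show "m ^ k * num_initial m tree_word k (M - A) = num_initial m (\<lambda>u. sum_list u + 1 = m) k (M - A)"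
      using A Suc.prems by (intro Suc.IH) (auto simp: size_Diff_submset)
  qed
  also have "\<dots> = num_initial m (\<lambda>u. sum_list u + 1 = m) (Suc k) M"
    using Suc.prems by (simp add: num_initial_Suc)
  finally show ?case .
qed

section \<open>Binomial moments of the number of tree words\<close>

definition arc :: "nat \<Rightarrow> nat \<Rightarrow> nat \<Rightarrow> nat list" where
  "arc N m i = map (\<lambda>r. (i + r) mod N) [0..<m]"

definition separated :: "nat \<Rightarrow> nat \<Rightarrow> nat \<Rightarrow> nat list set" where
  "separated N m k = {l. length l = k \<and> set l \<subseteq> {..<N} \<and> distinct (concat (map (arc N m) l))}"

lemma take_rotate_eq_arc:
  assumes "m \<le> length w"
  shows "take m (rotate i w) = map ((!) w) (arc (length w) m i)"
  using assms by (auto simp: arc_def list_eq_iff_nth_eq nth_rotate add.commute)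

lemma distinct_arc: "m \<le> N \<Longrightarrow> distinct (arc N m i)"
proof -
  assume m: "m \<le> N"
  have False if "r < s" "s < m" "(i + r) mod N = (i + s) mod N" for r s
  proof -
    have "N dvd (i + s) - (i + r)" using that by (metis mod_eq_dvd_iff_nat add_le_cancel_left less_imp_le)
    then show False using that m by (auto dest: dvd_imp_le)
  qed
  then have "inj_on (\<lambda>r. (i + r) mod N) {0..<m}"
    by (intro linorder_inj_onI) auto
  then show ?thesis by (simp add: arc_def distinct_map)
qed

lemma set_arc_subset: "N > 0 \<Longrightarrow> set (arc N m i) \<subseteq> {..<N}"
  by (auto simp: arc_def)

lemma length_arc [simp]: "length (arc N m i) = m"
  by (simp add: arc_def)

lemma arc_add: "arc N m i = arc N d i @ arc N (m - d) (i + d)" if "d \<le> m"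
proof -
  have "[0..<m] = [0..<d] @ map (\<lambda>r. r + d) [0..<m - d]"
    using that upt_add_eq_append[of 0 d "m - d"] by (simp add: map_add_upt)
  then show ?thesis by (simp add: arc_def add_ac)
qed

lemma arc_mod: "arc N m (i mod N) = arc N m i"
  by (simp add: arc_def mod_add_left_eq)

lemma arcs_meet:
  assumes "i < N" "j < N" "m \<le> N" "set (arc N m i) \<inter> set (arc N m j) \<noteq> {}"
  shows "\<exists>d<m. j = (i + d) mod N \<or> i = (j + d) mod N"
proof -
  obtain r s where rs: "r < m" "s < m" "(i + r) mod N = (j + s) mod N"
    using assms(4) by (auto simp: arc_def)
  have *: "\<exists>d<m. j = (i + d) mod N"
    if "s \<le> r" "r < m" "(i + r) mod N = (j + s) mod N" "j < N" for i j r s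
  proof -
    have "[(i + (r - s)) + s = j + s] (mod N)" using that by (simp add: unique_euclidean_semiring_class.cong_def)
    then have "[i + (r - s) = j] (mod N)" by (simp only: cong_add_rcancel_nat)
    then have "(i + (r - s)) mod N = j"
      using that(4) by (simp add: unique_euclidean_semiring_class.cong_def)
    then show ?thesis using that by (intro exI[of _ "r - s"]) auto
  qed
  show ?thesis
    using *[of s r i j] *[of r s j i] rs assms(1,2) by (cases "s \<le> r") auto
qed

text \<open>
  Intersecting arcs would give two tree words of which one starts inside the other, so that a proper
  suffix of the first is a proper prefix of the second.
\<close>

lemma tree_word_arcs_disjoint:
  assumes "m \<le> length w" "i < length w" "j < length w" "i \<noteq> j"
    and "tree_word (take m (rotate i w))" "tree_word (take m (rotate j w))"
  shows "set (arc (length w) m i) \<inter> set (arc (length w) m j) = {}"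
proof (rule ccontr)
  let ?N = "length w"
  assume "\<not> ?thesis"
  then obtain d where d: "d < m" "j = (i + d) mod ?N \<or> i = (j + d) mod ?N"
    using arcs_meet[of i ?N j m] assms by blast
  have False if "j = (i + d) mod ?N" "i \<noteq> j" "i < ?N"
    "tree_word (take m (rotate i w))" "tree_word (take m (rotate j w))" for i j
  proof -
    have d0: "d > 0" using that by (cases d) auto
    let ?f = "map ((!) w)"
    have "take m (rotate i w) = ?f (arc ?N d i) @ ?f (arc ?N (m - d) j)"
      using arc_add[of d m ?N i] that d assms(1) by (simp add: take_rotate_eq_arc arc_mod)
    moreover have "take m (rotate j w) = ?f (arc ?N (m - d) j) @ ?f (arc ?N d (j + (m - d)))"
      using arc_add[of "m - d" m ?N j] d assms(1) by (simp add: take_rotate_eq_arc)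
    ultimately show False
      using tree_word_overlap[of "?f (arc ?N d i)" "?f (arc ?N (m - d) j)" "?f (arc ?N d (j + (m - d)))"]
        that(4,5) d0 d(1) by (simp add: arc_def)
  qed
  then show False using d assms by metis
qed

lemma distinct_concat_arcs:
  assumes "m \<ge> 1" "m \<le> N"
  shows "distinct (concat (map (arc N m) l)) \<longleftrightarrow>
     distinct l \<and> pairwise (\<lambda>i j. disjnt (set (arc N m i)) (set (arc N m j))) (set l)"
proof (induction l)
  case (Cons i l)
  let ?D = "\<lambda>i. set (arc N m i)"
  have *: "distinct (concat (map (arc N m) (i # l))) \<longleftrightarrow>
      (\<forall>j\<in>set l. disjnt (?D i) (?D j)) \<and> distinct (concat (map (arc N m) l))"
    using distinct_arc[OF assms(2), of i] by (auto simp: disjnt_def)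
  show ?case
  proof (cases "i \<in> set l")
    case True
    moreover have "\<not> disjnt (?D i) (?D i)" using assms by (simp add: arc_def)
    ultimately have "\<not> (\<forall>j\<in>set l. disjnt (?D i) (?D j))" by blast
    then show ?thesis using True unfolding * by simp
  next
    case False
    then show ?thesis
      unfolding * Cons.IH by (auto simp: pairwise_insert disjnt_sym)
  qed
qed simp

lemma initial_blocks_concat:
  "(\<And>u. u \<in> set us \<Longrightarrow> length u = m) \<Longrightarrow>
    initial_blocks m B (length us) (concat us) \<longleftrightarrow> (\<forall>u\<in>set us. B u)"
  by (induction us) auto

lemma initial_blocks_take:
  "initial_blocks m B k (take (k * m) w) \<longleftrightarrow> initial_blocks m B k w"
proof (induction k arbitrary: w)
  case (Suc k)
  have "drop m (take (Suc k * m) w) = take (k * m) (drop m w)"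
    by (simp add: drop_take)
  then show ?case using Suc by (simp add: min_def)
qed simp

lemma card_distinct_lists_eq_binomial:
  assumes "finite A"
  shows "card {l. length l = k \<and> distinct l \<and> set l \<subseteq> A} = fact k * (card A choose k)"
proof (cases "k \<le> card A")
  case True
  have "fact (card A) = fact (card A - k) * \<Prod>{card A - k + 1..card A}"
    using fact_eq_fact_times[of "card A - k" "card A"] by simp
  also have "fact (card A) = fact (card A - k) * (fact k * (card A choose k))"
    using binomial_fact_lemma[OF True] by (simp add: mult_ac)
  finally show ?thesis
    using card_lists_distinct_length_eq[OF assms True] by simp
next
  case False
  have "k \<le> card A" if "length l = k" "distinct l" "set l \<subseteq> A" for l
    using that card_mono[OF assms that(3)] by (simp add: distinct_card)
  then have "{l. length l = k \<and> distinct l \<and> set l \<subseteq> A} = {}" using False by auto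
  then have "card {l. length l = k \<and> distinct l \<and> set l \<subseteq> A} = 0" by (simp only: card.empty)
  then show ?thesis using False by (simp add: binomial_eq_0)
qed

lemma finite_separated: "finite (separated N m k)"
  by (rule finite_subset[OF _ finite_lists_length_eq[of "{..<N}" k]]) (auto simp: separated_def)

text \<open>
  The left-hand side counts pairs of an arrangement and a list of \<open>k\<close> distinct starting points of tree
  words. Such a list is automatically separated, and for a fixed separated list exchangeability moves its
  \<open>k\<close> arcs to the first \<open>k\<close> blocks.
\<close>

lemma sum_binomial_cyclic_fringe:
  assumes m: "m \<ge> 1" "m \<le> size M"
  shows "fact k * (\<Sum>w\<in>permutations_of_multiset M. cyclic_fringe m w choose k) =
    card (separated (size M) m k) * num_initial m tree_word k M"
proof -
  let ?S = "permutations_of_multiset M"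
  let ?N = "size M"
  let ?good = "\<lambda>w i. tree_word (map ((!) w) (arc ?N m i))"
  have "fact k * (cyclic_fringe m w choose k) = card {l \<in> separated ?N m k. \<forall>i\<in>set l. ?good w i}"
    if w: "w \<in> ?S" for w
  proof -
    have len: "length w = ?N" using w by (rule length_permutations)
    define A where "A = {i. i < ?N \<and> ?good w i}"
    have cyc: "cyclic_fringe m w = card A"
      using len m by (simp add: cyclic_fringe_def A_def take_rotate_eq_arc)
    have "pairwise (\<lambda>i j. disjnt (set (arc ?N m i)) (set (arc ?N m j))) A"
      unfolding pairwise_def disjnt_def using tree_word_arcs_disjoint[of m w] len m by (simp add: A_def take_rotate_eq_arc)
    then have "{l. length l = k \<and> distinct l \<and> set l \<subseteq> A} = {l \<in> separated ?N m k. \<forall>i\<in>set l. ?good w i}"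
      unfolding separated_def distinct_concat_arcs[OF m] by (auto simp: A_def pairwise_subset dest: pairwise_mono)
    moreover have "finite A" by (simp add: A_def)
    ultimately show ?thesis using card_distinct_lists_eq_binomial[of A k] cyc by simp
  qed
  then have "fact k * (\<Sum>w\<in>?S. cyclic_fringe m w choose k) =
     (\<Sum>w\<in>?S. card {l \<in> separated ?N m k. \<forall>i\<in>set l. ?good w i})"
    by (simp add: sum_distrib_left)
  also have "\<dots> = (\<Sum>l\<in>separated ?N m k. card {w \<in> ?S. \<forall>i\<in>set l. ?good w i})"
    unfolding card_eq_sum by (rule sum.swap_restrict) (simp_all add: finite_separated)
  also have "\<dots> = (\<Sum>l\<in>separated ?N m k. num_initial m tree_word k M)"
  proof (rule sum.cong[OF refl])
    fix l assume l: "l \<in> separated ?N m k"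
    define pos where "pos = concat (map (arc ?N m) l)"
    have "distinct pos" "set pos \<subseteq> {..<?N}"
      using l set_arc_subset[of ?N m] m by (auto simp: pos_def separated_def)
    have "{w \<in> ?S. \<forall>i\<in>set l. ?good w i} = {w \<in> ?S. initial_blocks m tree_word k (map ((!) w) pos)}"
    proof -
      have "initial_blocks m tree_word k (map ((!) w) pos) \<longleftrightarrow> (\<forall>i\<in>set l. ?good w i)" for w
      proof -
        have "length u = m" if "u \<in> set (map (map ((!) w) \<circ> arc ?N m) l)" for u
          using that by auto
        from initial_blocks_concat[of "map (map ((!) w) \<circ> arc ?N m) l" m tree_word, OF this] show ?thesis
          using l by (simp add: pos_def map_concat separated_def)
      qed
      then show ?thesis by simp
    qed
    also have "card \<dots> = card {w \<in> ?S. initial_blocks m tree_word k (take (length pos) w)}"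
      by (rule card_permutations_at_positions) fact+
    also have "length pos = k * m"
      using l by (simp add: pos_def length_concat comp_def sum_list_triv separated_def)
    finally show "card {w \<in> ?S. \<forall>i\<in>set l. ?good w i} = num_initial m tree_word k M"
      by (simp add: initial_blocks_take num_initial_def)
  qed
  finally show ?thesis by simp
qed

lemma card_separated_le: "card (separated N m k) \<le> N ^ k"
proof -
  have "separated N m k \<subseteq> {l. set l \<subseteq> {..<N} \<and> length l = k}" by (auto simp: separated_def)
  then have "card (separated N m k) \<le> card {l. set l \<subseteq> {..<N} \<and> length l = k}"
    by (intro card_mono finite_lists_length_eq) auto
  then show ?thesis by (simp add: card_lists_length_eq)
qed

text \<open>
  An arc meets a given arc for at most \<open>2 m\<close> choices of its starting point.
\<close>

lemma card_separated_ge: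
  assumes "1 \<le> m" "m \<le> N"
  shows "real (card (separated N m (Suc k))) \<ge> real (card (separated N m k)) * (real N - 2 * real m * real k)"
proof -
  define bad where "bad l = (\<Union>j\<in>set l. (\<lambda>d. (j + (N - m) + d) mod N) ` {..<2 * m})" for l
  have "(\<lambda>(l, i). i # l) ` (SIGMA l:separated N m k. {..<N} - bad l) \<subseteq> separated N m (Suc k)"
  proof safe
    fix l i assume l: "l \<in> separated N m k" and i: "i < N" "i \<notin> bad l"
    have "set (arc N m i) \<inter> set (arc N m j) = {}" if "j \<in> set l" for j
    proof (rule ccontr)
      assume "\<not> ?thesis"
      then obtain r s where rs: "r < m" "s < m" "(i + r) mod N = (j + s) mod N"
        by (auto simp: arc_def)
      \<comment> \<open>The index \<open>s + m - r\<close> lies between 1 and \<open>2 m - 1\<close>; the shift by \<open>N - m\<close> keeps everything in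
        the natural numbers.\<close>
      have "[(j + (N - m) + (s + m - r)) + r = i + r] (mod N)"
      proof -
        have "(j + (N - m) + (s + m - r)) + r = (j + s) + N" using rs assms by simp
        then show ?thesis
          unfolding unique_euclidean_semiring_class.cong_def using rs(3) by (metis mod_add_self2)
      qed
      then have "[j + (N - m) + (s + m - r) = i] (mod N)" by (simp only: cong_add_rcancel_nat)
      then have "(j + (N - m) + (s + m - r)) mod N = i"
        using i by (simp add: unique_euclidean_semiring_class.cong_def)
      moreover have "s + m - r < 2 * m" using rs by simp
      ultimately show False using i(2) that unfolding bad_def by blast
    qed
    then show "i # l \<in> separated N m (Suc k)"
      using l i distinct_arc[OF assms(2), of i] by (auto simp: separated_def)
  qed
  moreover have "inj_on (\<lambda>(l, i). i # l) (SIGMA l:separated N m k. {..<N} - bad l)"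
    by (auto simp: inj_on_def)
  ultimately have "card (SIGMA l:separated N m k. {..<N} - bad l) \<le> card (separated N m (Suc k))"
    using card_inj_on_le finite_separated by blast
  then have "(\<Sum>l\<in>separated N m k. card ({..<N} - bad l)) \<le> card (separated N m (Suc k))"
    using finite_separated by (subst (asm) card_SigmaI) auto
  then have 1: "(\<Sum>l\<in>separated N m k. real (card ({..<N} - bad l))) \<le> real (card (separated N m (Suc k)))"
    unfolding of_nat_sum[symmetric] of_nat_le_iff .
  have "real N - 2 * real m * real k \<le> real (card ({..<N} - bad l))"
    if "l \<in> separated N m k" for l
  proof -
    have "card (bad l) \<le> (\<Sum>j\<in>set l. card ((\<lambda>d. (j + (N - m) + d) mod N) ` {..<2 * m}))"
      unfolding bad_def by (rule card_UN_le) simp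
    also have "\<dots> \<le> (\<Sum>j\<in>set l. 2 * m)"
      by (intro sum_mono order_trans[OF card_image_le]) auto
    also have "\<dots> \<le> k * (2 * m)"
      using that card_length[of l] by (simp add: separated_def)
    finally have "card (bad l) \<le> k * (2 * m)" .
    moreover have "N - card (bad l) \<le> card ({..<N} - bad l)"
      using diff_card_le_card_Diff[of "bad l" "{..<N}"] by (simp add: bad_def)
    ultimately have "N \<le> card ({..<N} - bad l) + k * (2 * m)" by linarith
    then have "real N \<le> real (card ({..<N} - bad l) + k * (2 * m))" by (simp only: of_nat_le_iff)
    then show ?thesis by (simp add: mult_ac)
  qed
  then have "(\<Sum>l\<in>separated N m k. real N - 2 * real m * real k) \<le>
      (\<Sum>l\<in>separated N m k. real (card ({..<N} - bad l)))"
    by (rule sum_mono)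
  from order_trans[OF this 1] show ?thesis by simp
qed

section \<open>Convergence to the Poisson distribution from binomial moments\<close>

lemma alternating_binomial_partial_sum:
  "(\<Sum>r\<le>R. (-1) ^ r * real (Suc y choose r)) = (-1) ^ R * real (y choose R)"
  by (induction R) (simp_all add: algebra_simps)

lemma binomial_absorb_shift:
  "((j + r) choose j) * (x choose (j + r)) = (x choose j) * ((x - j) choose r)"
proof (cases "j + r \<le> x")
  case True
  then show ?thesis
    using choose_mult[of j "j + r" x] by (simp add: mult.commute)
next
  case False
  then have "x choose (j + r) = 0" "(x choose j) * ((x - j) choose r) = 0"
    by (auto simp: binomial_eq_0_iff)
  then show ?thesis by (simp only: mult_0_right)
qed

text \<open>
  For \<open>x > j\<close> the truncated alternating sum is, up to sign, \<open>x choose j\<close> times \<open>(x - j - 1) choose R\<close>, and by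
  Pascal's rule this is at most the first omitted term.
\<close>

lemma bonferroni:
  "\<bar>(if x = j then 1 else 0) - (\<Sum>r\<le>R. (-1) ^ r * real ((j + r) choose j) * real (x choose (j + r)))\<bar>
    \<le> real ((j + Suc R) choose j) * real (x choose (j + Suc R))"
proof -
  have "real ((j + r) choose j) * real (x choose (j + r)) = real (x choose j) * real ((x - j) choose r)" for r
    using binomial_absorb_shift[of j r x] by (metis of_nat_mult)
  then have S: "(\<Sum>r\<le>R. (-1) ^ r * real ((j + r) choose j) * real (x choose (j + r))) =
     real (x choose j) * (\<Sum>r\<le>R. (-1) ^ r * real ((x - j) choose r))"
    by (simp add: sum_distrib_left mult_ac)
  have T: "real ((j + Suc R) choose j) * real (x choose (j + Suc R)) = real (x choose j) * real ((x - j) choose Suc R)"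
    using binomial_absorb_shift[of j "Suc R" x] by (metis of_nat_mult)
  consider "x < j" | "x = j" | y where "x - j = Suc y" "x \<noteq> j"
    by (metis Suc_diff_Suc linorder_neqE_nat)
  then show ?thesis
  proof cases
    case 1
    then show ?thesis unfolding S T by (simp add: binomial_eq_0)
  next
    case 2
    have "(\<Sum>r\<le>R. (-1) ^ r * real (0 choose r)) = 1"
      by (induction R) auto
    then show ?thesis unfolding S T using 2 by simp
  next
    case 3
    then show ?thesis unfolding S T 3(1) alternating_binomial_partial_sum
      by (auto simp: abs_mult intro!: mult_left_mono)
  qed
qed

text \<open>
  By the Bonferroni inequalities finitely many binomial moments determine the point probabilities up to an
  error bounded by one further moment, whose limit is small. The partial sums built from the limiting moments
  are those of the exponential series in the Poisson weight.
\<close>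

lemma tendsto_poisson_of_factorial_moments:
  fixes X :: "nat \<Rightarrow> nat pmf"
  assumes rate: "rate > 0"
    and fin: "eventually (\<lambda>n. finite (set_pmf (X n))) sequentially"
    and mom: "\<And>k. (\<lambda>n. measure_pmf.expectation (X n) (\<lambda>x. real (x choose k))) \<longlonglongrightarrow> rate ^ k / fact k"
  shows "(\<lambda>n. pmf (X n) j) \<longlonglongrightarrow> pmf (poisson_pmf rate) j"
proof (rule LIMSEQ_I)
  fix e :: real assume e: "e > 0"
  define b where "b k n = measure_pmf.expectation (X n) (\<lambda>x. real (x choose k))" for k n
  define c where "c = rate ^ j / fact j"
  define s where "s R n = (\<Sum>r\<le>R. (-1) ^ r * real ((j + r) choose j) * b (j + r) n)" for R n
  have cj: "real ((j + r) choose j) * (rate ^ (j + r) / fact (j + r)) = c * (rate ^ r / fact r)" for r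
    by (simp add: c_def binomial_fact power_add)
  have bound: "\<bar>pmf (X n) j - s R n\<bar> \<le> real ((j + Suc R) choose j) * b (j + Suc R) n"
    if "finite (set_pmf (X n))" for R n
  proof -
    have int: "integrable (measure_pmf (X n)) f" for f :: "nat \<Rightarrow> real"
      using that by (rule integrable_measure_pmf_finite)
    have "pmf (X n) j = measure_pmf.expectation (X n) (\<lambda>x. if x = j then 1 else 0)"
    proof -
      have "(\<lambda>x. if x = j then 1 else 0 :: real) = indicator {j}" by (auto simp: indicator_def)
      then show ?thesis by (simp add: measure_pmf_single)
    qed
    then have eq: "pmf (X n) j - s R n = measure_pmf.expectation (X n)
        (\<lambda>x. (if x = j then 1 else 0) - (\<Sum>r\<le>R. (-1) ^ r * real ((j + r) choose j) * real (x choose (j + r))))"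
      by (simp add: Bochner_Integration.integral_diff int Bochner_Integration.integral_sum s_def b_def)
    have "\<bar>pmf (X n) j - s R n\<bar> \<le> measure_pmf.expectation (X n)
        (\<lambda>x. \<bar>(if x = j then 1 else 0) - (\<Sum>r\<le>R. (-1) ^ r * real ((j + r) choose j) * real (x choose (j + r)))\<bar>)"
      unfolding eq by (rule integral_abs_bound)
    also have "\<dots> \<le> measure_pmf.expectation (X n)
        (\<lambda>x. real ((j + Suc R) choose j) * real (x choose (j + Suc R)))"
      proof (rule integral_mono)
      fix x
      show "\<bar>(if x = j then 1 else 0) - (\<Sum>r\<le>R. (-1) ^ r * real ((j + r) choose j) * real (x choose (j + r)))\<bar>
        \<le> real ((j + Suc R) choose j) * real (x choose (j + Suc R))"
        by (rule bonferroni)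
    qed (rule int)+
    finally show ?thesis by (simp add: b_def)
  qed
  have lim_s: "(\<lambda>n. s R n) \<longlonglongrightarrow> c * (\<Sum>r\<le>R. (- rate) ^ r / fact r)" for R
  proof -
    have "(\<lambda>n. s R n) \<longlonglongrightarrow> (\<Sum>r\<le>R. (-1) ^ r * real ((j + r) choose j) * (rate ^ (j + r) / fact (j + r)))"
      unfolding s_def b_def by (intro tendsto_intros mom)
    also have "(\<Sum>r\<le>R. (-1) ^ r * real ((j + r) choose j) * (rate ^ (j + r) / fact (j + r)))
        = (\<Sum>r\<le>R. (-1) ^ r * (c * (rate ^ r / fact r)))"
      by (simp only: mult.assoc cj)
    also have "\<dots> = c * (\<Sum>r\<le>R. (- rate) ^ r / fact r)"
      by (simp add: sum_distrib_left power_minus[of rate] mult_ac)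
    finally show ?thesis .
  qed
  have lim_t: "(\<lambda>n. real ((j + Suc R) choose j) * b (j + Suc R) n) \<longlonglongrightarrow> c * (rate ^ Suc R / fact (Suc R))" for R
    unfolding cj[symmetric] b_def by (intro tendsto_intros mom)
  have "(\<lambda>R. c * (\<Sum>r\<le>R. (- rate) ^ r / fact r)) \<longlonglongrightarrow> c * exp (- rate)"
    using exp_converges[of "- rate"] unfolding sums_def_le
    by (intro tendsto_intros) (simp add: field_simps)
  from LIMSEQ_D[OF this, of "e / 4"] obtain R1 where
    R1: "\<And>R. R \<ge> R1 \<Longrightarrow> \<bar>c * (\<Sum>r\<le>R. (- rate) ^ r / fact r) - c * exp (- rate)\<bar> < e / 4"
    using e by auto
  have "(\<lambda>R. c * (rate ^ Suc R / fact (Suc R))) \<longlonglongrightarrow> c * 0"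
  proof (intro tendsto_intros LIMSEQ_Suc[of "\<lambda>R. rate ^ R / fact R"])
    show "(\<lambda>R. rate ^ R / fact R) \<longlonglongrightarrow> 0"
      using summable_LIMSEQ_zero[OF sums_summable[OF exp_converges[of rate]]] by (simp add: field_simps)
  qed
  then have "eventually (\<lambda>R. c * (rate ^ Suc R / fact (Suc R)) < e / 4) sequentially"
    using e by (intro order_tendstoD(2)) auto
  then obtain R2 where R2: "\<And>R. R \<ge> R2 \<Longrightarrow> c * (rate ^ Suc R / fact (Suc R)) < e / 4"
    unfolding eventually_sequentially by blast
  define R where "R = max R1 R2"
  have "eventually (\<lambda>n. \<bar>s R n - c * (\<Sum>r\<le>R. (- rate) ^ r / fact r)\<bar> < e / 4) sequentially"
    using tendstoD[OF lim_s[of R], of "e / 4"] e by (simp add: dist_real_def)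
  moreover have "eventually (\<lambda>n. real ((j + Suc R) choose j) * b (j + Suc R) n < e / 4) sequentially"
    using lim_t[of R] R2[of R] by (intro order_tendstoD(2)) (auto simp: R_def)
  ultimately have "eventually (\<lambda>n. norm (pmf (X n) j - pmf (poisson_pmf rate) j) < e) sequentially"
    using fin
  proof eventually_elim
    case (elim n)
    have "pmf (poisson_pmf rate) j = c * exp (- rate)"
      using rate by (simp add: c_def)
    moreover have "R1 \<le> R" by (simp add: R_def)
    note R1[OF this] bound[OF elim(3), of R] elim(1,2)
    ultimately show ?case unfolding real_norm_def by linarith
  qed
  then show "\<exists>no. \<forall>n\<ge>no. norm (pmf (X n) j - pmf (poisson_pmf rate) j) < e"
    by (simp add: eventually_sequentially)
qed

lemma weak_conv_m_of_pmf:
  fixes X :: "nat \<Rightarrow> nat pmf"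
  assumes "\<And>j. (\<lambda>n. pmf (X n) j) \<longlonglongrightarrow> pmf Y j"
  shows "weak_conv_m (\<lambda>n. distr (X n) borel real) (distr Y borel real)"
proof -
  have "cdf (distr (measure_pmf P) borel real) x = (\<Sum>j | real j \<le> x. pmf P j)" for P :: "nat pmf" and x
  proof -
    have "{j. real j \<le> x} \<subseteq> {.. nat \<lfloor>x\<rfloor>}" by (auto simp: le_nat_iff le_floor_iff)
    then have "finite {j. real j \<le> x}" by (rule finite_subset) simp
    moreover have "cdf (distr (measure_pmf P) borel real) x = measure P {j. real j \<le> x}"
      by (simp add: cdf_def measure_distr vimage_def)
    ultimately show ?thesis by (simp add: measure_measure_pmf_finite)
  qed
  then show ?thesis
    unfolding weak_conv_m_def weak_conv_def by (auto intro!: tendsto_sum assms)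
qed

section \<open>Fourier inversion for Bernoulli sampling\<close>

text \<open>
  The indicator of the period of the exponentials after their argument has been divided by \<open>r\<close>.
  Values are complex so that it multiplies the integrands directly.
\<close>

definition window :: "real \<Rightarrow> real \<Rightarrow> complex" where
  "window r u = indicator {- (pi * r)..pi * r} u"

lemma window_measurable [measurable]: "window r \<in> borel_measurable borel"
  unfolding window_def by measurable

lemma norm_window_le: "norm (window r u) \<le> 1"
  by (simp add: window_def indicator_def)

lemma integrable_window_bounded:
  assumes [measurable]: "g \<in> borel_measurable borel" and "\<And>u. norm (g u) \<le> 1"
  shows "integrable lborel (\<lambda>u. window r u * g u :: complex)"
proof (rule Bochner_Integration.integrable_bound)
  show "integrable lborel (indicator {- (pi * r)..pi * r} :: real \<Rightarrow> real)"
    by (simp add: integrable_indicator_iff emeasure_lborel_Icc_eq)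
  show "AE u in lborel. norm (window r u * g u) \<le> norm (indicator {- (pi * r)..pi * r} u :: real)"
    using assms(2) by (auto simp: window_def norm_mult indicator_def)
qed measurable

lemma integral_window_iexp_1:
  "(LBINT u. window 1 u * iexp (of_int k * u)) = (if k = 0 then 2 * pi else 0)"
proof (cases "k = 0")
  case True
  then have "(\<lambda>u. window 1 u * iexp (of_int k * u)) = (\<lambda>u. complex_of_real (indicator {- pi..pi} u))"
    by (auto simp: window_def indicator_def)
  moreover have "(LBINT u. indicator {- pi..pi} u) = 2 * pi"
    by simp
  ultimately show ?thesis using True by (simp only: integral_complex_of_real) simp
next
  case False
  define F where "F u = iexp (of_int k * u) / (\<i> * of_int k)" for u
  have "has_bochner_integral lborel (\<lambda>u. indicator {- pi..pi} u *\<^sub>R iexp (of_int k * u)) (F pi - F (- pi))"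
  proof (rule has_bochner_integral_FTC_Icc)
    fix x
    have "((\<lambda>u. exp (\<i> * (of_int k * u)) / (\<i> * of_int k)) has_field_derivative iexp (of_int k * x)) (at (of_real x))"
      using False by (auto intro!: derivative_eq_intros simp: field_simps)
    from has_vector_derivative_real_field[OF this]
    show "(F has_vector_derivative iexp (of_int k * x)) (at x within {- pi..pi})"
      by (simp add: F_def[abs_def] has_vector_derivative_at_within)
  qed (auto intro!: continuous_intros)
  moreover have "F pi = F (- pi)"
  proof -
    have "sin (of_int k * pi) = 0" by (simp add: sin_zero_iff_int2)
    then have "iexp (of_int k * pi) = iexp (of_int k * (- pi))"
      by (intro complex_eqI) (simp_all add: Re_exp Im_exp)
    then show ?thesis unfolding F_def by (simp only:)
  qed
  moreover have "(\<lambda>u. window 1 u * iexp (of_int k * u)) = (\<lambda>u. indicator {- pi..pi} u *\<^sub>R iexp (of_int k * u))"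
    by (auto simp: window_def indicator_def)
  ultimately show ?thesis using False by (simp add: has_bochner_integral_integral_eq)
qed

lemma integral_window_iexp:
  assumes "r > 0"
  shows "(LBINT u. window r u * iexp (of_int k * u / r)) = (if k = 0 then 2 * pi * r else 0)"
proof -
  have "(LBINT u. window r u * iexp (of_int k * u / r))
     = r *\<^sub>R (LBINT u. window r (0 + r * u) * iexp (of_int k * (0 + r * u) / r))"
    using assms by (subst lborel_integral_real_affine[where c = r and t = 0]) auto
  also have "(\<lambda>u. window r (0 + r * u) * iexp (of_int k * (0 + r * u) / r)) = (\<lambda>u. window 1 u * iexp (of_int k * u))"
  proof
    fix u
    have "- (pi * r) \<le> r * u \<longleftrightarrow> - pi \<le> u" "r * u \<le> pi * r \<longleftrightarrow> u \<le> pi"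
      using assms mult_le_cancel_left_pos[of r "- pi" u] mult_le_cancel_left_pos[of r u pi] by (simp_all add: mult.commute)
    then show "window r (0 + r * u) * iexp (of_int k * (0 + r * u) / r) = window 1 u * iexp (of_int k * u)"
      using assms by (simp add: window_def indicator_def)
  qed
  finally show ?thesis unfolding integral_window_iexp_1 by (simp add: scaleR_conv_of_real)
qed

lemma prod_bernoulli_iexp:
  fixes q :: real and \<theta> :: "'a \<Rightarrow> real"
  assumes "finite J"
  shows "(\<Prod>j\<in>J. 1 + q * (iexp (\<theta> j) - 1)) =
    (\<Sum>I\<in>Pow J. complex_of_real (q ^ card I * (1 - q) ^ card (J - I)) * iexp (\<Sum>j\<in>I. \<theta> j))"
proof -
  have "(\<Prod>j\<in>J. 1 + q * (iexp (\<theta> j) - 1)) = (\<Prod>j\<in>J. q * iexp (\<theta> j) + (1 - complex_of_real q))"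
    by (simp add: algebra_simps)
  also have "\<dots> = (\<Sum>I\<in>Pow J. (\<Prod>j\<in>I. q * iexp (\<theta> j)) * (\<Prod>j\<in>J - I. 1 - complex_of_real q))"
    by (rule prod_add) fact
  also have "\<dots> = (\<Sum>I\<in>Pow J. complex_of_real (q ^ card I * (1 - q) ^ card (J - I)) * iexp (\<Sum>j\<in>I. \<theta> j))"
  proof (rule sum.cong[OF refl])
    fix I assume "I \<in> Pow J"
    then have "finite I" using assms finite_subset by auto
    then show "(\<Prod>j\<in>I. q * iexp (\<theta> j)) * (\<Prod>j\<in>J - I. 1 - complex_of_real q) =
        complex_of_real (q ^ card I * (1 - q) ^ card (J - I)) * iexp (\<Sum>j\<in>I. \<theta> j)"
      by (simp add: prod.distrib exp_sum sum_distrib_left)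
  qed
  finally show ?thesis .
qed

lemma integral_lborel_product:
  fixes f g :: "real \<Rightarrow> 'a::{real_normed_field, second_countable_topology, banach}"
  assumes f: "integrable lborel f" and g: "integrable lborel g"
  shows "integrable (lborel \<Otimes>\<^sub>M lborel) (\<lambda>(u, v). f u * g v)"
    and "(\<integral>z. (case z of (u, v) \<Rightarrow> f u * g v) \<partial>(lborel \<Otimes>\<^sub>M lborel)) = integral\<^sup>L lborel f * integral\<^sup>L lborel g"
proof -
  have [measurable]: "f \<in> borel_measurable borel" "g \<in> borel_measurable borel"
    using f g by auto
  show int: "integrable (lborel \<Otimes>\<^sub>M lborel) (\<lambda>(u, v). f u * g v)"
  proof (rule lborel_pair.Fubini_integrable)
    show "integrable lborel (\<lambda>x. LBINT y. norm (case (x, y) of (u, v) \<Rightarrow> f u * g v))"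
      using f by (simp add: norm_mult)
    show "AE x in lborel. integrable lborel (\<lambda>y. case (x, y) of (u, v) \<Rightarrow> f u * g v)"
      using g by simp
  qed measurable
  from lborel_pair.integral_fst'[OF int]
  show "(\<integral>z. (case z of (u, v) \<Rightarrow> f u * g v) \<partial>(lborel \<Otimes>\<^sub>M lborel)) = integral\<^sup>L lborel f * integral\<^sup>L lborel g"
    using f g by simp
qed

text \<open>
  Let each \<open>j\<close> in \<open>J\<close> be selected independently with probability \<open>q\<close>. At the rescaled frequencies \<open>u / r\<close> and
  \<open>v / r\<close> this is the joint characteristic function of the number of selected indices and of the sum of
  their values \<open>x j\<close>, twisted by the phase that extracts the pair \<open>(k, y)\<close> by Fourier inversion.
\<close>

definition bernoulli_fourier :: "real \<Rightarrow> real \<Rightarrow> 'a set \<Rightarrow> ('a \<Rightarrow> int) \<Rightarrow> nat \<Rightarrow> int \<Rightarrow> real \<Rightarrow> real \<Rightarrow> complex" where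
  "bernoulli_fourier r q J x k y u v =
     (\<Prod>j\<in>J. 1 + q * (iexp ((u + v * of_int (x j)) / r) - 1)) * iexp (- (real k * u / r)) * iexp (- (of_int y * v / r))"

lemma bernoulli_fourier_expand:
  assumes "finite J"
  shows "bernoulli_fourier r q J x k y u v =
    (\<Sum>I\<in>Pow J. complex_of_real (q ^ card I * (1 - q) ^ card (J - I)) *
       (iexp (of_int (int (card I) - int k) * u / r) * iexp (of_int ((\<Sum>j\<in>I. x j) - y) * v / r)))"
proof -
  have e: "iexp (\<Sum>j\<in>I. (u + v * of_int (x j)) / r) * iexp (- (real k * u / r)) * iexp (- (of_int y * v / r)) =
     iexp (of_int (int (card I) - int k) * u / r) * iexp (of_int ((\<Sum>j\<in>I. x j) - y) * v / r)" for I
  proof -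
    have "(\<Sum>j\<in>I. (u + v * of_int (x j)) / r) + - (real k * u / r) + - (of_int y * v / r) =
      of_int (int (card I) - int k) * u / r + of_int ((\<Sum>j\<in>I. x j) - y) * v / r"
      by (simp add: sum.distrib add_divide_distrib sum_divide_distrib[symmetric] sum_distrib_left[symmetric]
          diff_divide_distrib left_diff_distrib algebra_simps)
    then show ?thesis
      unfolding exp_add[symmetric] distrib_left[symmetric] of_real_add[symmetric] by simp
  qed
  show ?thesis
    unfolding bernoulli_fourier_def prod_bernoulli_iexp[OF assms] sum_distrib_right
    by (intro sum.cong refl) (simp only: e[unfolded mult.assoc] mult.assoc)
qed

lemma bernoulli_fourier_measurable [measurable]:
  "(\<lambda>(u, v). bernoulli_fourier r q J x k y u v) \<in> borel_measurable (lborel \<Otimes>\<^sub>M lborel)"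
  "(\<lambda>u. bernoulli_fourier r q J x k y u v) \<in> borel_measurable borel"
  unfolding bernoulli_fourier_def by (measurable; simp)+

text \<open>
  Fourier inversion: by orthogonality of the exponentials only the subsets with the required size and sum
  survive, and each of them has the same Bernoulli weight.
\<close>

lemma integral_bernoulli_fourier:
  assumes J: "finite J" and r: "r > 0"
  shows "(\<integral>z. (case z of (u, v) \<Rightarrow> window r u * window r v * bernoulli_fourier r q J x k y u v) \<partial>(lborel \<Otimes>\<^sub>M lborel)) =
    complex_of_real ((2 * pi * r)\<^sup>2 * (q ^ k * (1 - q) ^ (card J - k)) * card {I. I \<subseteq> J \<and> card I = k \<and> (\<Sum>j\<in>I. x j) = y})"
proof -
  let ?w = "\<lambda>I. complex_of_real (q ^ card I * (1 - q) ^ card (J - I))"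
  let ?f = "\<lambda>I u. window r u * iexp (of_int (int (card I) - int k) * u / r)"
  let ?g = "\<lambda>I v. window r v * iexp (of_int ((\<Sum>j\<in>I. x j) - y) * v / r)"
  have f: "integrable lborel (?f I)" and g: "integrable lborel (?g I)" for I
    by (intro integrable_window_bounded; simp)+
  have "(\<lambda>(u, v). window r u * window r v * bernoulli_fourier r q J x k y u v) =
     (\<lambda>z. \<Sum>I\<in>Pow J. ?w I * (case z of (u, v) \<Rightarrow> ?f I u * ?g I v))"
    by (auto simp: bernoulli_fourier_expand[OF J] sum_distrib_left mult_ac fun_eq_iff)
  then have "(\<integral>z. (case z of (u, v) \<Rightarrow> window r u * window r v * bernoulli_fourier r q J x k y u v) \<partial>(lborel \<Otimes>\<^sub>M lborel)) =
     (\<Sum>I\<in>Pow J. ?w I * ((\<integral>u. ?f I u \<partial>lborel) * (\<integral>v. ?g I v \<partial>lborel)))"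
    using integral_lborel_product[OF f g] by simp
  also have "\<dots> = (\<Sum>I\<in>Pow J. if card I = k \<and> (\<Sum>j\<in>I. x j) = y
      then complex_of_real ((2 * pi * r)\<^sup>2 * (q ^ k * (1 - q) ^ (card J - k))) else 0)"
    unfolding integral_window_iexp[OF r]
    by (intro sum.cong refl) (auto simp: card_Diff_subset power2_eq_square finite_subset[OF _ J])
  also have "\<dots> = (\<Sum>I\<in>{I. I \<subseteq> J \<and> card I = k \<and> (\<Sum>j\<in>I. x j) = y}.
      complex_of_real ((2 * pi * r)\<^sup>2 * (q ^ k * (1 - q) ^ (card J - k))))"
    using J by (intro sum.mono_neutral_cong_right) auto
  finally show ?thesis by simp
qed

text \<open>
  The one-dimensional version, which extracts the size of the subset only. Dividing the two-dimensional
  integral by this one removes the Bernoulli weight.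
\<close>

lemma integral_bernoulli_fourier_0:
  assumes J: "finite J" and r: "r > 0"
  shows "(LBINT u. window r u * bernoulli_fourier r q J x k y u 0) =
    complex_of_real (2 * pi * r * (q ^ k * (1 - q) ^ (card J - k)) * (card J choose k))"
proof -
  let ?w = "\<lambda>I. complex_of_real (q ^ card I * (1 - q) ^ card (J - I))"
  let ?f = "\<lambda>I u. window r u * iexp (of_int (int (card I) - int k) * u / r)"
  have f: "integrable lborel (?f I)" for I
    by (intro integrable_window_bounded; simp)+
  have "(\<lambda>u. window r u * bernoulli_fourier r q J x k y u 0) = (\<lambda>u. \<Sum>I\<in>Pow J. ?w I * ?f I u)"
    by (auto simp: bernoulli_fourier_expand[OF J] sum_distrib_left mult_ac fun_eq_iff)
  then have "(LBINT u. window r u * bernoulli_fourier r q J x k y u 0) =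
     (LBINT u. (\<Sum>I\<in>Pow J. ?w I * ?f I u))"
    by (simp only:)
  also have "\<dots> = (\<Sum>I\<in>Pow J. (LBINT u. ?w I * ?f I u))"
    by (intro Bochner_Integration.integral_sum integrable_mult_right f)
  also have "\<dots> = (\<Sum>I\<in>Pow J. ?w I * (\<integral>u. ?f I u \<partial>lborel))"
    by (simp only: integral_mult_right_zero)
  also have "\<dots> = (\<Sum>I\<in>Pow J. if card I = k
      then complex_of_real (2 * pi * r * (q ^ k * (1 - q) ^ (card J - k))) else 0)"
    unfolding integral_window_iexp[OF r]
    by (intro sum.cong refl) (auto simp: card_Diff_subset finite_subset[OF _ J])
  also have "\<dots> = (\<Sum>I\<in>{I. I \<subseteq> J \<and> card I = k}.
      complex_of_real (2 * pi * r * (q ^ k * (1 - q) ^ (card J - k))))"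
    using J by (intro sum.mono_neutral_cong_right) auto
  finally show ?thesis by (simp add: n_subsets[OF J])
qed

lemma gaussian_integral:
  assumes "s > 0"
  shows "integrable lborel (\<lambda>u. exp (- (s * u\<^sup>2)) :: real)"
    and "(LBINT u. exp (- (s * u\<^sup>2))) = sqrt (pi / s)"
proof -
  define d where "d = sqrt (1 / (2 * s))"
  have d: "d > 0" "d\<^sup>2 = 1 / (2 * s)" using assms by (auto simp: d_def)
  have eq: "exp (- (s * u\<^sup>2)) = sqrt (pi / s) * normal_density 0 d u" for u
  proof -
    have "sqrt (2 * pi * d\<^sup>2) = sqrt (pi / s)" using d(2) by simp
    moreover have "u\<^sup>2 / (2 * d\<^sup>2) = s * u\<^sup>2" unfolding d(2) by simp
    moreover have "sqrt (pi / s) > 0" using assms by simp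
    ultimately show ?thesis using assms by (simp add: normal_density_def)
  qed
  show "integrable lborel (\<lambda>u. exp (- (s * u\<^sup>2)) :: real)"
    unfolding eq using d(1) by simp
  show "(LBINT u. exp (- (s * u\<^sup>2))) = sqrt (pi / s)"
    unfolding eq using d(1) by simp
qed

lemma norm_bernoulli_iexp_le:
  assumes "0 \<le> q" "q \<le> 1 / 2"
  shows "norm (1 + complex_of_real q * (iexp t - 1)) \<le> exp (- (q / 2 * (1 - cos t)))"
proof -
  have sc: "(sin t)\<^sup>2 = 1 - (cos t)\<^sup>2" by (rule sin_squared_eq)
  have "(norm (1 + complex_of_real q * (iexp t - 1)))\<^sup>2 = (1 + q * (cos t - 1))\<^sup>2 + (q * sin t)\<^sup>2"
    unfolding cmod_power2 by (simp add: Re_exp Im_exp)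
  also have "\<dots> = 1 - 2 * q * (1 - q) * (1 - cos t)"
    unfolding power_mult_distrib sc by (simp add: power2_eq_square algebra_simps)
  also have "\<dots> \<le> 1 - q * (1 - cos t)"
  proof -
    have "q * (1 - cos t) * 1 \<le> q * (1 - cos t) * (2 * (1 - q))"
      using assms by (intro mult_left_mono) auto
    then show ?thesis by (simp add: mult_ac)
  qed
  also have "\<dots> \<le> exp (- (q * (1 - cos t)))"
    using exp_ge_add_one_self[of "- (q * (1 - cos t))"] by simp
  also have "\<dots> = (exp (- (q / 2 * (1 - cos t))))\<^sup>2"
    by (simp add: power2_eq_square flip: exp_add)
  finally show ?thesis by (rule power2_le_imp_le) simp
qed

lemma norm_bernoulli_fourier_le:
  assumes "0 \<le> q" "q \<le> 1 / 2"
  shows "norm (bernoulli_fourier r q J x k y u v) \<le>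
    exp (- (q / 2 * (\<Sum>j\<in>J. 1 - cos ((u + v * of_int (x j)) / r))))"
proof (cases "finite J")
  case True
  have "norm (bernoulli_fourier r q J x k y u v) =
     (\<Prod>j\<in>J. norm (1 + complex_of_real q * (iexp ((u + v * of_int (x j)) / r) - 1)))"
    by (simp add: bernoulli_fourier_def norm_mult prod_norm)
  also have "\<dots> \<le> (\<Prod>j\<in>J. exp (- (q / 2 * (1 - cos ((u + v * of_int (x j)) / r)))))"
    by (intro prod_mono conjI norm_ge_zero norm_bernoulli_iexp_le[OF assms])
  also have "\<dots> = exp (- (q / 2 * (\<Sum>j\<in>J. 1 - cos ((u + v * of_int (x j)) / r))))"
    unfolding exp_sum[OF True, symmetric] sum_negf sum_distrib_left ..
  finally show ?thesis .
qed (simp add: bernoulli_fourier_def norm_mult)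

section \<open>The nonlattice condition\<close>

text \<open>
  The subgroup is generated by its least positive element, which divides every element of \<open>A\<close>.
\<close>

lemma Gcd_in_int_subgroup:
  fixes H :: "int set"
  assumes zero: "0 \<in> H" and diff: "\<And>a b. a \<in> H \<Longrightarrow> b \<in> H \<Longrightarrow> a - b \<in> H" and "A \<subseteq> H"
  shows "Gcd A \<in> H"
proof (cases "H \<subseteq> {0}")
  case True
  then have "0 dvd Gcd A" using assms(3) by (intro Gcd_greatest) auto
  then have "Gcd A = 0" by (simp only: dvd_0_left_iff)
  then show ?thesis using zero by (simp only:)
next
  case False
  have neg: "- a \<in> H" if "a \<in> H" for a using diff[OF zero that] by simp
  have add: "a + b \<in> H" if "a \<in> H" "b \<in> H" for a b using diff[OF that(1) neg[OF that(2)]] by simp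
  have nmult: "int n * a \<in> H" if "a \<in> H" for n a
    using that by (induction n) (auto simp: zero distrib_right add)
  have mult: "c * a \<in> H" if "a \<in> H" for c a
  proof (cases "c \<ge> 0")
    case True
    then show ?thesis using nmult[OF that, of "nat c"] by simp
  next
    case False
    then show ?thesis using neg[OF nmult[OF that, of "nat (- c)"]] by simp
  qed
  define P where "P n \<longleftrightarrow> n > 0 \<and> int n \<in> H" for n
  obtain h where h: "h \<in> H" "h \<noteq> 0" using False by auto
  then have "P (nat \<bar>h\<bar>)" using neg[of h] by (auto simp: P_def abs_if)
  define d where "d = (LEAST n. P n)"
  have d: "P d" unfolding d_def by (rule LeastI) fact
  have least: "d \<le> n" if "P n" for n unfolding d_def using that by (rule Least_le)
  have "int d dvd a" if "a \<in> H" for a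
  proof (rule ccontr)
    assume *: "\<not> int d dvd a"
    have "a mod int d = a - (a div int d) * int d" by (simp add: minus_div_mult_eq_mod)
    also have "\<dots> \<in> H" using diff[OF that mult] d by (simp add: P_def)
    finally have "a mod int d \<in> H" .
    moreover have "int d > 0" using d by (simp add: P_def)
    then have "a mod int d \<ge> 0" "a mod int d < int d" by simp_all
    moreover have "a mod int d \<noteq> 0" using * by (simp add: dvd_eq_mod_eq_0)
    ultimately have "P (nat (a mod int d))" by (simp add: P_def)
    from least[OF this] \<open>a mod int d < int d\<close> \<open>a mod int d \<ge> 0\<close> show False by linarith
  qed
  then have "int d dvd Gcd A" using assms(3) by (auto intro: Gcd_greatest)
  then obtain k where "Gcd A = k * int d" by (metis dvd_def mult.commute)
  moreover have "k * int d \<in> H" using d by (intro mult) (simp add: P_def)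
  ultimately show ?thesis by simp
qed

lemma abs_sin_diff_le: "\<bar>sin (a - b)\<bar> \<le> \<bar>sin a\<bar> + \<bar>sin b\<bar>" for a b :: real
proof -
  have "\<bar>sin (a - b)\<bar> \<le> \<bar>sin a * cos b\<bar> + \<bar>cos a * sin b\<bar>"
    unfolding sin_diff by linarith
  also have "\<dots> \<le> \<bar>sin a\<bar> * 1 + 1 * \<bar>sin b\<bar>"
    unfolding abs_mult by (intro add_mono mult_mono) auto
  finally show ?thesis by simp
qed

lemma abs_sin_add_le: "\<bar>sin (a + b)\<bar> \<le> \<bar>sin a\<bar> + \<bar>sin b\<bar>" for a b :: real
  using abs_sin_diff_le[of a "- b"] by simp

lemma abs_sin_mult_le: "\<bar>sin (real n * x)\<bar> \<le> real n * \<bar>sin x\<bar>"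
proof (induction n)
  case (Suc n)
  then show ?case using abs_sin_add_le[of "real n * x" x] by (simp add: algebra_simps)
qed simp

lemma abs_le_pi_sin_half:
  assumes "\<bar>t\<bar> \<le> pi"
  shows "\<bar>t\<bar> \<le> pi * \<bar>sin (t / 2)\<bar>"
proof -
  have "convex_on {0..pi} (\<lambda>x. - sin x)"
    by (rule f''_ge0_imp_convex[where f' = "\<lambda>x. - cos x" and f'' = "\<lambda>x. sin x"])
       (auto intro!: derivative_eq_intros sin_ge_zero)
  from convex_onD[OF this, of "\<bar>t\<bar> / pi" 0 "pi / 2"]
  have "\<bar>t\<bar> / pi \<le> sin (\<bar>t\<bar> / 2)"
    using assms by (simp add: field_simps)
  moreover have "sin (\<bar>t\<bar> / 2) \<le> \<bar>sin (t / 2)\<bar>" by (cases "t \<ge> 0") auto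
  ultimately have "\<bar>t\<bar> / pi \<le> \<bar>sin (t / 2)\<bar>" by linarith
  then show ?thesis by (simp add: field_simps)
qed

text \<open>
  Up to a constant factor, \<open>\<bar>sin (x / 2)\<bar>\<close> is the distance from \<open>x\<close> to the multiples of \<open>2 \<pi>\<close>, and it is subadditive.
  Hence the integers \<open>k\<close> for which \<open>\<bar>sin (k t / 2)\<bar>\<close> is bounded by a multiple of such a finite sum form a subgroup. It
  contains all differences of elements of \<open>S\<close>, and so their greatest common divisor 1.
\<close>

lemma sin_half_bound_of_Gcd:
  fixes S :: "nat set"
  assumes "Gcd {int i - int j | i j. i \<in> S \<and> j \<in> S} = 1"
  shows "\<exists>F C. finite F \<and> F \<subseteq> S \<and> C \<ge> 0 \<and>
    (\<forall>s t. \<bar>sin (t / 2)\<bar> \<le> C * (\<Sum>i\<in>F. \<bar>sin ((s + t * (real i - 1)) / 2)\<bar>))"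
proof -
  let ?sum = "\<lambda>F s t. \<Sum>i\<in>F. \<bar>sin ((s + t * (real i - 1)) / 2)\<bar>"
  define good where "good k F C \<longleftrightarrow> finite F \<and> F \<subseteq> S \<and> C \<ge> 0 \<and>
    (\<forall>s t. \<bar>sin (of_int k * t / 2)\<bar> \<le> C * ?sum F s t)" for k F C
  define H where "H = {k. \<exists>F C. good k F C}"
  have "Gcd {int i - int j | i j. i \<in> S \<and> j \<in> S} \<in> H"
  proof (rule Gcd_in_int_subgroup)
    have "good 0 {} 0" by (simp add: good_def)
    then show "0 \<in> H" unfolding H_def by blast
  next
    fix a b assume "a \<in> H" "b \<in> H"
    then obtain Fa Ca Fb Cb where a: "good a Fa Ca" and b: "good b Fb Cb" unfolding H_def by blast
    have "good (a - b) (Fa \<union> Fb) (Ca + Cb)"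
      unfolding good_def
    proof (intro conjI allI)
      fix s t :: real
      have "\<bar>sin (of_int (a - b) * t / 2)\<bar> \<le> \<bar>sin (of_int a * t / 2)\<bar> + \<bar>sin (of_int b * t / 2)\<bar>"
        using abs_sin_diff_le[of "of_int a * t / 2" "of_int b * t / 2"] by (simp add: left_diff_distrib diff_divide_distrib)
      also have "\<dots> \<le> Ca * ?sum Fa s t + Cb * ?sum Fb s t"
        using a b by (intro add_mono) (auto simp: good_def)
      also have "\<dots> \<le> Ca * ?sum (Fa \<union> Fb) s t + Cb * ?sum (Fa \<union> Fb) s t"
        using a b by (intro add_mono mult_left_mono sum_mono2) (auto simp: good_def)
      finally show "\<bar>sin (of_int (a - b) * t / 2)\<bar> \<le> (Ca + Cb) * ?sum (Fa \<union> Fb) s t"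
        by (simp add: distrib_right)
    qed (use a b in \<open>auto simp: good_def\<close>)
    then show "a - b \<in> H" unfolding H_def by blast
  next
    show "{int i - int j | i j. i \<in> S \<and> j \<in> S} \<subseteq> H"
    proof clarify
      fix i j assume ij: "i \<in> S" "j \<in> S"
      have "good (int i - int j) {i, j} 1"
        unfolding good_def
      proof (intro conjI allI)
        fix s t :: real
        have eq: "of_int (int i - int j) * t / 2 = (s + t * (real i - 1)) / 2 - (s + t * (real j - 1)) / 2"
          by (simp add: field_simps)
        show "\<bar>sin (of_int (int i - int j) * t / 2)\<bar> \<le> 1 * ?sum {i, j} s t"
          unfolding eq using abs_sin_diff_le[of "(s + t * (real i - 1)) / 2" "(s + t * (real j - 1)) / 2"]
          by (cases "i = j") auto
      qed (use ij in auto)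
      then show "int i - int j \<in> H" unfolding H_def by blast
    qed
  qed
  then obtain F C where "good 1 F C" using assms unfolding H_def by auto
  then show ?thesis unfolding good_def by (intro exI[of _ F] exI[of _ C]) simp
qed

text \<open>
  The quantitative form of the nonlattice condition that yields the dominating function. The finite sum
  in \<open>sin_half_bound_of_Gcd\<close> controls \<open>t\<close>, one more summand then controls \<open>s\<close>, and \<open>1 - cos x\<close> equals
  \<open>2 (sin (x / 2))\<^sup>2\<close>.
\<close>

lemma quadratic_lower_bound_of_Gcd:
  fixes S :: "nat set"
  assumes "Gcd {int i - int j | i j. i \<in> S \<and> j \<in> S} = 1"
  shows "\<exists>F c. finite F \<and> F \<subseteq> S \<and> c > 0 \<and>
    (\<forall>s t. \<bar>s\<bar> \<le> pi \<longrightarrow> \<bar>t\<bar> \<le> pi \<longrightarrow>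
       c * (s\<^sup>2 + t\<^sup>2) \<le> (\<Sum>i\<in>F. 1 - cos (s + t * (real i - 1))))"
proof -
  obtain F0 C where F0: "finite F0" "F0 \<subseteq> S" "C \<ge> 0"
    "\<And>s t. \<bar>sin (t / 2)\<bar> \<le> C * (\<Sum>i\<in>F0. \<bar>sin ((s + t * (real i - 1)) / 2)\<bar>)"
    using sin_half_bound_of_Gcd[OF assms] by blast
  obtain i0 where i0: "i0 \<in> S"
    using assms by (cases "S = {}") auto
  define F where "F = insert i0 F0"
  define B where "B s t = (\<Sum>i\<in>F. \<bar>sin ((s + t * (real i - 1)) / 2)\<bar>)" for s t
  \<comment> \<open>Since \<open>s\<close> equals \<open>(s + t (i0 - 1)) - i0 t + t\<close>, the bound on \<open>t\<close> is used \<open>i0 + 1\<close> times.\<close>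
  define D where "D = 1 + (real i0 + 1) * C"
  have D: "D \<ge> 1" "C \<le> D" using F0(3) mult_left_mono[of 0 "real i0" C] by (auto simp: D_def distrib_right)
  have finF: "finite F" "F \<noteq> {}" using F0 by (auto simp: F_def)
  have B0: "B s t \<ge> 0" for s t unfolding B_def by (intro sum_nonneg) auto
  have t: "\<bar>sin (t / 2)\<bar> \<le> C * B s t" for s t
  proof -
    have "(\<Sum>i\<in>F0. \<bar>sin ((s + t * (real i - 1)) / 2)\<bar>) \<le> B s t"
      unfolding B_def F_def using F0(1) by (intro sum_mono2) auto
    then show ?thesis using F0(3,4) order_trans mult_left_mono by meson
  qed
  have s: "\<bar>sin (s / 2)\<bar> \<le> D * B s t" for s t
  proof -
    have e: "(s + t * (real i0 - 1)) / 2 - real i0 * (t / 2) + t / 2 = s / 2" by (simp add: field_simps)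
    have "\<bar>sin (s / 2)\<bar> \<le> \<bar>sin ((s + t * (real i0 - 1)) / 2)\<bar> + \<bar>sin (real i0 * (t / 2))\<bar> + \<bar>sin (t / 2)\<bar>"
      using abs_sin_add_le[of "(s + t * (real i0 - 1)) / 2 - real i0 * (t / 2)" "t / 2"]
        abs_sin_diff_le[of "(s + t * (real i0 - 1)) / 2" "real i0 * (t / 2)"]
      unfolding e by linarith
    also have "\<bar>sin ((s + t * (real i0 - 1)) / 2)\<bar> \<le> B s t"
      unfolding B_def using finF by (intro member_le_sum[of i0]) (auto simp: F_def)
    also have "\<bar>sin (real i0 * (t / 2))\<bar> \<le> real i0 * (C * B s t)"
      using abs_sin_mult_le[of i0 "t / 2"] mult_left_mono[OF t[of t s], of "real i0"] by linarith
    also note t[of t s]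
    finally show ?thesis by (simp add: D_def algebra_simps)
  qed
  define c where "c = 1 / (pi\<^sup>2 * D\<^sup>2 * real (card F))"
  have card: "real (card F) > 0" using finF by (simp add: card_gt_0_iff)
  then have c: "c > 0" using D by (simp add: c_def)
  have "c * (s\<^sup>2 + t\<^sup>2) \<le> (\<Sum>i\<in>F. 1 - cos (s + t * (real i - 1)))" if "\<bar>s\<bar> \<le> pi" "\<bar>t\<bar> \<le> pi" for s t
  proof -
    have "\<bar>t\<bar> \<le> pi * (D * B s t)"
    proof -
      have "\<bar>sin (t / 2)\<bar> \<le> D * B s t" using t[of t s] mult_right_mono[OF D(2) B0[of s t]] by linarith
      then show ?thesis using abs_le_pi_sin_half[OF that(2)] mult_left_mono[of _ _ pi] pi_ge_zero order_trans by blast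
    qed
    then have t2: "t\<^sup>2 \<le> (pi * (D * B s t))\<^sup>2" using abs_le_square_iff[of t "pi * (D * B s t)"] D B0[of s t] by simp
    have "\<bar>s\<bar> \<le> pi * (D * B s t)"
      using abs_le_pi_sin_half[OF that(1)] mult_left_mono[OF s[of s t] pi_ge_zero] by linarith
    then have "s\<^sup>2 \<le> (pi * (D * B s t))\<^sup>2" using abs_le_square_iff[of s "pi * (D * B s t)"] D B0[of s t] by simp
    with t2 have "s\<^sup>2 + t\<^sup>2 \<le> 2 * (pi\<^sup>2 * D\<^sup>2) * (B s t)\<^sup>2" by (simp add: power_mult_distrib)
    also have "(B s t)\<^sup>2 \<le> (\<Sum>i\<in>F. \<bar>sin ((s + t * (real i - 1)) / 2)\<bar>\<^sup>2) * card F"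
      unfolding B_def by (rule sum_squared_le_sum_of_squares)
    also have "(\<Sum>i\<in>F. \<bar>sin ((s + t * (real i - 1)) / 2)\<bar>\<^sup>2) = (\<Sum>i\<in>F. 1 - cos (s + t * (real i - 1))) / 2"
      unfolding sum_divide_distrib
    proof (rule sum.cong[OF refl])
      fix i
      have "(sin (x / 2))\<^sup>2 = (1 - cos x) / 2" for x :: real
        using cos_double_sin[of "x / 2"] by simp
      then show "\<bar>sin ((s + t * (real i - 1)) / 2)\<bar>\<^sup>2 = (1 - cos (s + t * (real i - 1))) / 2"
        by (simp only: power2_abs)
    qed
    finally have "s\<^sup>2 + t\<^sup>2 \<le> (pi\<^sup>2 * D\<^sup>2 * real (card F)) * (\<Sum>i\<in>F. 1 - cos (s + t * (real i - 1)))"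
      using D by (simp add: mult_ac mult_left_mono)
    moreover have "pi\<^sup>2 * D\<^sup>2 * real (card F) > 0" using card D by simp
    ultimately show ?thesis by (simp add: c_def field_simps)
  qed
  then show ?thesis using finF c F0(2) i0 by (intro exI[of _ F] exI[of _ c]) (auto simp: F_def)
qed

section \<open>Triangular arrays of degrees\<close>

text \<open>
  Only the entries \<open>d n j\<close> with \<open>j < N n\<close> belong to row \<open>n\<close>. Uniform integrability of the squared entries is
  assumed in place of convergence of the second moments because it clearly survives the removal of entries.
\<close>

locale degree_array =
  fixes N :: "nat \<Rightarrow> nat" and d :: "nat \<Rightarrow> nat \<Rightarrow> nat" and p :: "nat pmf"
  assumes size: "filterlim N at_top sequentially"
    and frequency: "\<And>i. (\<lambda>n. real (card {j. j < N n \<and> d n j = i}) / real (N n)) \<longlonglongrightarrow> pmf p i"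
    and tail: "\<And>\<epsilon>. \<epsilon> > 0 \<Longrightarrow> \<exists>K. eventually (\<lambda>n.
        (\<Sum>j | j < N n \<and> K < d n j. (real (d n j))\<^sup>2) \<le> \<epsilon> * real (N n)) sequentially"
    and second_moment: "summable (\<lambda>i. (real i)\<^sup>2 * pmf p i)"
begin

lemma eventually_size_pos: "eventually (\<lambda>n. N n > 0) sequentially"
  using size[unfolded filterlim_at_top, rule_format, of 1] by eventually_elim simp

text \<open>
  The entries up to a large bound \<open>K\<close> are handled by the convergence of the frequencies, the others by uniform
  integrability and the quadratic growth bound.
\<close>

lemma tendsto_average:
  assumes f: "\<And>i. i > 0 \<Longrightarrow> \<bar>f i\<bar> \<le> C * (real i)\<^sup>2"
  shows "(\<lambda>n. (\<Sum>j<N n. f (d n j)) / real (N n)) \<longlonglongrightarrow> (\<Sum>i. f i * pmf p i)"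
proof (rule tendstoI)
  fix e :: real assume e: "e > 0"
  have C: "C \<ge> 0" using f[of 1] by simp
  define \<epsilon> where "\<epsilon> = e / (4 * (C + 1))"
  have \<epsilon>: "\<epsilon> > 0" "C * \<epsilon> \<le> e / 4" using e C by (auto simp: \<epsilon>_def field_simps)
  have abs: "\<bar>f i * pmf p i\<bar> \<le> C * ((real i)\<^sup>2 * pmf p i)" if "i > 0" for i
    using mult_right_mono[OF f[OF that], of "pmf p i"] by (simp add: abs_mult mult_ac)
  have summ: "summable (\<lambda>i. f i * pmf p i)"
  proof (rule summable_comparison_test_ev)
    show "eventually (\<lambda>i. norm (f i * pmf p i) \<le> C * ((real i)\<^sup>2 * pmf p i)) sequentially"
      using eventually_gt_at_top[of 0] by eventually_elim (simp add: abs)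
    show "summable (\<lambda>i. C * ((real i)\<^sup>2 * pmf p i))" by (intro summable_mult second_moment)
  qed
  obtain K1 where K1: "eventually (\<lambda>n. (\<Sum>j | j < N n \<and> K1 < d n j. (real (d n j))\<^sup>2) \<le> \<epsilon> * real (N n)) sequentially"
    using tail[OF \<epsilon>(1)] by blast
  have "(\<lambda>n. \<Sum>i<n. f i * pmf p i) \<longlonglongrightarrow> (\<Sum>i. f i * pmf p i)" by (rule summable_LIMSEQ[OF summ])
  from tendstoD[OF this, of "e / 4"] obtain K2 where
    K2: "\<And>n. n \<ge> K2 \<Longrightarrow> \<bar>(\<Sum>i<n. f i * pmf p i) - (\<Sum>i. f i * pmf p i)\<bar> < e / 4"
    using e by (auto simp: eventually_sequentially dist_real_def)
  define K where "K = max K1 K2"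
  have "(\<lambda>n. \<Sum>i\<le>K. f i * (real (card {j. j < N n \<and> d n j = i}) / real (N n))) \<longlonglongrightarrow> (\<Sum>i\<le>K. f i * pmf p i)"
    by (intro tendsto_intros frequency)
  from tendstoD[OF this, of "e / 4"] have
    K3: "eventually (\<lambda>n. \<bar>(\<Sum>i\<le>K. f i * (real (card {j. j < N n \<and> d n j = i}) / real (N n))) - (\<Sum>i\<le>K. f i * pmf p i)\<bar> < e / 4) sequentially"
    using e by (simp add: dist_real_def)
  show "eventually (\<lambda>n. dist ((\<Sum>j<N n. f (d n j)) / real (N n)) (\<Sum>i. f i * pmf p i) < e) sequentially"
    using K1 K3 eventually_size_pos
  proof eventually_elim
    case (elim n)
    let ?N = "real (N n)"
    have n: "?N > 0" using elim by simp
    have "(\<Sum>j<N n. f (d n j)) = (\<Sum>j | j < N n \<and> d n j \<le> K. f (d n j)) + (\<Sum>j | j < N n \<and> K < d n j. f (d n j))"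
      by (subst sum.union_disjoint[symmetric]) (auto intro!: sum.cong)
    also have "(\<Sum>j | j < N n \<and> d n j \<le> K. f (d n j)) = (\<Sum>i\<le>K. \<Sum>j | j \<in> {j. j < N n \<and> d n j \<le> K} \<and> d n j = i. f (d n j))"
      by (rule sum.group[symmetric]) auto
    also have "\<dots> = (\<Sum>i\<le>K. f i * real (card {j. j < N n \<and> d n j = i}))"
    proof (rule sum.cong[OF refl])
      fix i assume "i \<in> {..K}"
      then have "{j. j \<in> {j. j < N n \<and> d n j \<le> K} \<and> d n j = i} = {j. j < N n \<and> d n j = i}" by auto
      then show "(\<Sum>j | j \<in> {j. j < N n \<and> d n j \<le> K} \<and> d n j = i. f (d n j)) = f i * real (card {j. j < N n \<and> d n j = i})"
        by simp
    qed
    finally have eq: "(\<Sum>j<N n. f (d n j)) / ?N = (\<Sum>i\<le>K. f i * (real (card {j. j < N n \<and> d n j = i}) / ?N))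
       + (\<Sum>j | j < N n \<and> K < d n j. f (d n j)) / ?N"
      by (simp add: add_divide_distrib sum_divide_distrib)
    have "\<bar>\<Sum>j | j < N n \<and> K < d n j. f (d n j)\<bar> \<le> (\<Sum>j | j < N n \<and> K < d n j. C * (real (d n j))\<^sup>2)"
      by (rule order_trans[OF sum_abs sum_mono]) (auto intro: f)
    also have "\<dots> \<le> (\<Sum>j | j < N n \<and> K1 < d n j. C * (real (d n j))\<^sup>2)"
      using C by (intro sum_mono2) (auto simp: K_def)
    also have "\<dots> \<le> C * (\<epsilon> * ?N)"
      unfolding sum_distrib_left[symmetric] using elim(1) C by (intro mult_left_mono)
    also have "\<dots> = (C * \<epsilon>) * ?N" by simp
    also have "\<dots> \<le> e / 4 * ?N" using \<epsilon>(2) n by (intro mult_right_mono) auto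
    finally have "\<bar>(\<Sum>j | j < N n \<and> K < d n j. f (d n j)) / ?N\<bar> \<le> e / 4"
      using n by (simp add: abs_divide pos_divide_le_eq)
    moreover have "\<bar>(\<Sum>i\<le>K. f i * pmf p i) - (\<Sum>i. f i * pmf p i)\<bar> < e / 4"
      using K2[of "Suc K"] by (simp add: K_def lessThan_Suc_atMost)
    ultimately show ?case
      unfolding dist_real_def eq using elim(2) e by linarith
  qed
qed

end

section \<open>Local limit theorem for sampling without replacement\<close>

lemma iexp_quadratic_error:
  "cmod (iexp x - 1 - \<i> * x + x\<^sup>2 / 2) \<le> x\<^sup>2"
  "cmod (iexp x - 1 - \<i> * x + x\<^sup>2 / 2) \<le> \<bar>x\<bar> ^ 3 / 6"
proof -
  have "(\<Sum>k\<le>2. (\<i> * x) ^ k / fact k) = 1 + \<i> * x - x\<^sup>2 / 2"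
    by (simp add: numeral_2_eq_2 power2_eq_square algebra_simps)
  then have e: "iexp x - (\<Sum>k\<le>2. (\<i> * x) ^ k / fact k) = iexp x - 1 - \<i> * x + x\<^sup>2 / 2"
    by simp
  show "cmod (iexp x - 1 - \<i> * x + x\<^sup>2 / 2) \<le> x\<^sup>2"
    using iexp_approx2[of x 2] unfolding e by simp
  show "cmod (iexp x - 1 - \<i> * x + x\<^sup>2 / 2) \<le> \<bar>x\<bar> ^ 3 / 6"
    using iexp_approx1[of x 2] unfolding e by (simp add: eval_nat_numeral)
qed

lemma norm_exp_minus_linear_le:
  fixes z :: complex
  assumes "norm z \<le> 1"
  shows "norm (1 + z - exp z) \<le> 3 * (norm z)\<^sup>2"
proof -
  have "norm (exp z - (\<Sum>k\<le>1. z ^ k / fact k)) \<le> exp \<bar>Re z\<bar> * (norm z) ^ Suc 1 / fact 1"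
    by (rule Taylor_exp)
  then have "norm (exp z - (1 + z)) \<le> exp \<bar>Re z\<bar> * (norm z)\<^sup>2"
    by (simp add: power2_eq_square)
  also have "exp \<bar>Re z\<bar> \<le> exp 1"
    using abs_Re_le_cmod[of z] assms by simp
  also have "exp 1 \<le> (3::real)" by (rule exp_le)
  finally show ?thesis by (simp add: norm_minus_commute mult_right_mono)
qed

text \<open>
  The Poisson approximation of the Bernoulli characteristic function. It is quadratic in \<open>q\<close>, so it costs
  nothing in the limit, and it leaves a single exponential to be expanded.
\<close>

lemma norm_prod_bernoulli_minus_exp_le:
  assumes "0 \<le> q" "q \<le> 1 / 2"
  shows "norm ((\<Prod>j\<in>J. 1 + complex_of_real q * (iexp (\<theta> j) - 1)) -
      (\<Prod>j\<in>J. exp (complex_of_real q * (iexp (\<theta> j) - 1)))) \<le> 3 * q\<^sup>2 * (\<Sum>j\<in>J. (\<theta> j)\<^sup>2)"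
proof -
  let ?z = "\<lambda>j. complex_of_real q * (iexp (\<theta> j) - 1)"
  have "norm ((\<Prod>j\<in>J. 1 + ?z j) - (\<Prod>j\<in>J. exp (?z j))) \<le> (\<Sum>j\<in>J. norm (1 + ?z j - exp (?z j)))"
  proof (rule norm_prod_diff)
    fix j
    have "q * (1 - cos (\<theta> j)) \<ge> 0" using assms by simp
    then show "norm (1 + ?z j) \<le> 1"
      using norm_bernoulli_iexp_le[OF assms, of "\<theta> j"] by (simp add: order_trans)
    have "Re (?z j) \<le> 0" using assms by (simp add: Re_exp mult_nonneg_nonpos)
    then show "norm (exp (?z j)) \<le> 1" by simp
  qed
  also have "\<dots> \<le> (\<Sum>j\<in>J. 3 * q\<^sup>2 * (\<theta> j)\<^sup>2)"
  proof (rule sum_mono)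
    fix j
    have "norm (iexp (\<theta> j) - 1) \<le> \<bar>\<theta> j\<bar>"
      using iexp_approx1[of "\<theta> j" 0] by simp
    moreover have "norm (iexp (\<theta> j) - 1) \<le> 2"
      using norm_triangle_ineq4[of "iexp (\<theta> j)" 1] by simp
    ultimately have 1: "norm (?z j) \<le> q * \<bar>\<theta> j\<bar>" "norm (?z j) \<le> q * 2"
      using assms(1) by (simp_all add: norm_mult mult_left_mono)
    have "norm (1 + ?z j - exp (?z j)) \<le> 3 * (norm (?z j))\<^sup>2"
      using 1(2) assms by (intro norm_exp_minus_linear_le) linarith
    also have "\<dots> \<le> 3 * (q * \<bar>\<theta> j\<bar>)\<^sup>2"
      using 1(1) by (intro mult_left_mono power_mono) auto
    finally show "norm (1 + ?z j - exp (?z j)) \<le> 3 * q\<^sup>2 * (\<theta> j)\<^sup>2"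
      by (simp add: power_mult_distrib)
  qed
  finally show ?thesis by (simp add: sum_distrib_left)
qed

definition mean_square_deviation :: "nat pmf \<Rightarrow> real" where
  "mean_square_deviation p = (\<Sum>i. (real i - 1)\<^sup>2 * pmf p i)"

text \<open>
  The setting of the local limit theorem: \<open>m n\<close> entries of row \<open>n\<close> are sampled without replacement. Row sums
  may differ from the row length by a bounded amount, since removing blocks changes the difference.
\<close>

locale sampling_array = degree_array +
  fixes m :: "nat \<Rightarrow> nat"
  assumes span: "Gcd {int i - int j | i j. i \<in> set_pmf p \<and> j \<in> set_pmf p} = 1"
    and sample_size: "filterlim m at_top sequentially"
    and sample_fraction: "(\<lambda>n. real (m n) / real (N n)) \<longlonglongrightarrow> 0"
    and balanced: "\<exists>B. eventually (\<lambda>n. \<bar>\<Sum>j<N n. real (d n j) - 1\<bar> \<le> B) sequentially"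
begin

abbreviation variance :: real where
  "variance \<equiv> mean_square_deviation p"

definition r :: "nat \<Rightarrow> real" where "r n = sqrt (real (m n))"

definition q :: "nat \<Rightarrow> real" where "q n = real (m n) / real (N n)"

definition fourier :: "nat \<Rightarrow> real \<Rightarrow> real \<Rightarrow> complex" where
  "fourier n u v = bernoulli_fourier (r n) (q n) {..<N n} (\<lambda>j. int (d n j) - 1) (m n) (-1) u v"

lemma square_minus_one_le: "\<bar>(real i - 1)\<^sup>2\<bar> \<le> 1 * (real i)\<^sup>2" if "i > 0"
  using that abs_le_square_iff[of "real i - 1" "real i"] by simp

lemma summable_variance: "summable (\<lambda>i. (real i - 1)\<^sup>2 * pmf p i)"
proof (rule summable_comparison_test_ev)
  show "eventually (\<lambda>i. norm ((real i - 1)\<^sup>2 * pmf p i) \<le> (real i)\<^sup>2 * pmf p i) sequentially"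
    using eventually_gt_at_top[of 0]
  proof eventually_elim
    case (elim i)
    then show ?case using mult_right_mono[OF square_minus_one_le, of i "pmf p i"] by simp
  qed
qed (rule second_moment)

lemma variance_pos: "variance > 0"
proof -
  have "\<exists>i. i \<in> set_pmf p \<and> i \<noteq> 1"
  proof (rule ccontr)
    assume "\<not> ?thesis"
    then have *: "i = 1" if "i \<in> set_pmf p" for i using that by blast
    have "0 dvd Gcd {int i - int j | i j. i \<in> set_pmf p \<and> j \<in> set_pmf p}"
      by (rule Gcd_greatest) (auto dest!: *)
    then show False unfolding span by simp
  qed
  then obtain i where "i \<in> set_pmf p" "i \<noteq> 1" by blast
  then have "(real i - 1)\<^sup>2 * pmf p i > 0" by (simp add: pmf_positive)
  then show ?thesis
    unfolding mean_square_deviation_def by (intro suminf_pos2[OF summable_variance]) auto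
qed

lemma r_at_top: "filterlim r at_top sequentially"
  unfolding r_def by (intro filterlim_compose[OF sqrt_at_top] filterlim_compose[OF filterlim_real_sequentially] sample_size)

lemma q_tendsto_0: "q \<longlonglongrightarrow> 0"
  using sample_fraction unfolding q_def[abs_def] .

lemma eventually_regular: "eventually (\<lambda>n. m n > 0 \<and> N n > 0 \<and> q n \<le> 1 / 2 \<and> q n > 0 \<and> r n > 0 \<and> m n \<le> N n) sequentially"
proof -
  have "eventually (\<lambda>n. q n < 1 / 2) sequentially"
    using q_tendsto_0 by (rule order_tendstoD) simp
  moreover have "eventually (\<lambda>n. m n \<ge> 1) sequentially"
    using sample_size[unfolded filterlim_at_top] by blast
  ultimately show ?thesis
    using eventually_size_pos by eventually_elim (auto simp: q_def r_def field_simps)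
qed

lemma sq_sum_expand:
  "(\<Sum>j<N n. (u + v * (real (d n j) - 1))\<^sup>2) =
     real (N n) * u\<^sup>2 + 2 * u * v * (\<Sum>j<N n. real (d n j) - 1) + v\<^sup>2 * (\<Sum>j<N n. (real (d n j) - 1)\<^sup>2)"
proof -
  have "(u + v * (real (d n j) - 1))\<^sup>2 = u\<^sup>2 + 2 * u * v * (real (d n j) - 1) + v\<^sup>2 * (real (d n j) - 1)\<^sup>2" for j
    by (simp add: power2_eq_square algebra_simps)
  then show ?thesis by (simp add: sum.distrib sum_distrib_left)
qed

lemma bounded_over_at_top:
  assumes "eventually (\<lambda>n. \<bar>f n\<bar> \<le> B) sequentially" "filterlim g at_top sequentially"
  shows "(\<lambda>n. f n / g n) \<longlonglongrightarrow> (0::real)"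
proof (rule Lim_null_comparison)
  show "(\<lambda>n. B / g n) \<longlonglongrightarrow> 0" using tendsto_divide_0[OF tendsto_const filterlim_at_top_imp_at_infinity[OF assms(2)]] .
  have "eventually (\<lambda>n. g n > 0) sequentially" using assms(2) by (simp add: filterlim_at_top_dense)
  with assms(1) show "eventually (\<lambda>n. norm (f n / g n) \<le> B / g n) sequentially"
    by eventually_elim (simp add: divide_right_mono)
qed

lemma real_N_at_top: "filterlim (\<lambda>n. real (N n)) at_top sequentially"
  by (intro filterlim_compose[OF filterlim_real_sequentially] size)

lemma tendsto_average_sq:
  "(\<lambda>n. (\<Sum>j<N n. (u + v * (real (d n j) - 1))\<^sup>2) / real (N n)) \<longlonglongrightarrow> u\<^sup>2 + variance * v\<^sup>2"
proof -
  obtain B where B: "eventually (\<lambda>n. \<bar>\<Sum>j<N n. real (d n j) - 1\<bar> \<le> B) sequentially" using balanced by blast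
  have 1: "(\<lambda>n. (\<Sum>j<N n. real (d n j) - 1) / real (N n)) \<longlonglongrightarrow> 0"
    using B real_N_at_top by (rule bounded_over_at_top)
  have 2: "(\<lambda>n. (\<Sum>j<N n. (real (d n j) - 1)\<^sup>2) / real (N n)) \<longlonglongrightarrow> variance"
    unfolding mean_square_deviation_def by (rule tendsto_average[OF square_minus_one_le])
  have "(\<lambda>n. u\<^sup>2 + 2 * u * v * ((\<Sum>j<N n. real (d n j) - 1) / real (N n)) + v\<^sup>2 * ((\<Sum>j<N n. (real (d n j) - 1)\<^sup>2) / real (N n)))
     \<longlonglongrightarrow> u\<^sup>2 + 2 * u * v * 0 + v\<^sup>2 * variance"
    by (intro tendsto_intros 1 2)
  then have "(\<lambda>n. u\<^sup>2 + 2 * u * v * ((\<Sum>j<N n. real (d n j) - 1) / real (N n)) + v\<^sup>2 * ((\<Sum>j<N n. (real (d n j) - 1)\<^sup>2) / real (N n)))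
     \<longlonglongrightarrow> u\<^sup>2 + variance * v\<^sup>2" by (simp add: mult.commute)
  moreover have "eventually (\<lambda>n. u\<^sup>2 + 2 * u * v * ((\<Sum>j<N n. real (d n j) - 1) / real (N n)) + v\<^sup>2 * ((\<Sum>j<N n. (real (d n j) - 1)\<^sup>2) / real (N n))
     = (\<Sum>j<N n. (u + v * (real (d n j) - 1))\<^sup>2) / real (N n)) sequentially"
    using eventually_size_pos by eventually_elim (simp add: sq_sum_expand add_divide_distrib)
  ultimately show ?thesis by (rule Lim_transform_eventually)
qed

definition taylor_error :: "nat \<Rightarrow> real \<Rightarrow> real \<Rightarrow> complex" where
  "taylor_error n u v = (\<Sum>j<N n. q n * (iexp ((u + v * (real (d n j) - 1)) / r n) - 1
      - \<i> * ((u + v * (real (d n j) - 1)) / r n) + ((u + v * (real (d n j) - 1)) / r n)\<^sup>2 / 2))"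

text \<open>
  With \<open>w\<close> denoting \<open>u + v (d n j - 1)\<close>, the summand of an entry is at most \<open>w\<^sup>2 / N\<close> times the minimum of 1 and
  \<open>\<bar>w\<bar> / (6 r)\<close>. The second bound makes the contribution of entries up to \<open>K\<close> vanish because \<open>r\<close> tends to
  infinity, and the first one together with uniform integrability makes that of the others small.
\<close>

lemma taylor_error_tendsto_0: "(\<lambda>n. taylor_error n u v) \<longlonglongrightarrow> 0"
proof (rule tendstoI)
  fix e :: real assume e: "e > 0"
  define U where "U = 2 * u\<^sup>2 + 2 * v\<^sup>2"
  have U: "U \<ge> 0" by (simp add: U_def)
  define \<epsilon> where "\<epsilon> = e / (2 * (U + 1))"
  have \<epsilon>: "\<epsilon> > 0" "U * \<epsilon> \<le> e / 2" using e U by (auto simp: \<epsilon>_def field_simps)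
  obtain K where K: "eventually (\<lambda>n. (\<Sum>j | j < N n \<and> K < d n j. (real (d n j))\<^sup>2) \<le> \<epsilon> * real (N n)) sequentially"
    using tail[OF \<epsilon>(1)] by blast
  define W where "W = \<bar>u\<bar> + \<bar>v\<bar> * (real K + 1)"
  define w where "w n j = u + v * (real (d n j) - 1)" for n j
  define avg where "avg n = (\<Sum>j<N n. (w n j)\<^sup>2) / real (N n)" for n
  have "(\<lambda>n. avg n * W / 6 / r n) \<longlonglongrightarrow> 0"
    unfolding avg_def w_def
    by (rule tendsto_divide_0[OF _ filterlim_at_top_imp_at_infinity[OF r_at_top]]) (rule tendsto_intros tendsto_average_sq | simp)+
  then have "eventually (\<lambda>n. avg n * W / 6 / r n < e / 2) sequentially"
    using e by (intro order_tendstoD(2)) auto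
  then show "eventually (\<lambda>n. dist (taylor_error n u v) 0 < e) sequentially"
    using K eventually_regular
  proof eventually_elim
    case (elim n)
    let ?N = "real (N n)"
    have pos: "?N > 0" "r n > 0" "q n > 0" using elim(3) by auto
    have qr: "q n * (w n j / r n)\<^sup>2 = (w n j)\<^sup>2 / ?N" for j
      using pos elim(3) by (simp add: q_def r_def power_divide)
    let ?E = "\<lambda>j. q n * cmod (iexp (w n j / r n) - 1 - \<i> * complex_of_real (w n j / r n) + complex_of_real ((w n j / r n)\<^sup>2 / 2))"
    have E1: "?E j \<le> (w n j)\<^sup>2 / ?N * (W / 6 / r n)" if "d n j \<le> K" for j
    proof -
      have "\<bar>w n j\<bar> \<le> \<bar>u\<bar> + \<bar>v\<bar> * \<bar>real (d n j) - 1\<bar>"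
        unfolding w_def abs_mult[symmetric] by (rule abs_triangle_ineq)
      also have "\<dots> \<le> W" unfolding W_def using that by (intro add_left_mono mult_left_mono) auto
      finally have wW: "\<bar>w n j\<bar> \<le> W" .
      have 1: "?E j \<le> q n * (\<bar>w n j / r n\<bar> ^ 3 / 6)"
        using iexp_quadratic_error(2)[of "w n j / r n"] pos by (intro mult_left_mono) auto
      have 2: "q n * (\<bar>w n j / r n\<bar> ^ 3 / 6) = (w n j)\<^sup>2 / ?N * (\<bar>w n j\<bar> / 6 / r n)"
      proof -
        have "\<bar>x\<bar> ^ 3 = x\<^sup>2 * \<bar>x\<bar>" for x :: real
          by (simp add: power3_eq_cube power2_eq_square)
        from this[of "w n j / r n"] show ?thesis
          unfolding qr[symmetric] using pos by (simp only:) (simp add: abs_divide)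
      qed
      have 3: "(w n j)\<^sup>2 / ?N * (\<bar>w n j\<bar> / 6 / r n) \<le> (w n j)\<^sup>2 / ?N * (W / 6 / r n)"
      proof (rule mult_left_mono)
        show "\<bar>w n j\<bar> / 6 / r n \<le> W / 6 / r n"
          using divide_right_mono[OF wW, of "6 * r n"] pos by simp
      qed simp
      from 1 3 show ?thesis unfolding 2 by (rule order_trans)
    qed
    have E2: "?E j \<le> U * (real (d n j))\<^sup>2 / ?N" if "d n j > K" for j
    proof -
      have "?E j \<le> q n * (w n j / r n)\<^sup>2"
        using iexp_quadratic_error(1)[of "w n j / r n"] pos by (intro mult_left_mono) auto
      then have 1: "?E j \<le> (w n j)\<^sup>2 / ?N" unfolding qr .
      have 2: "(w n j)\<^sup>2 \<le> 2 * u\<^sup>2 + 2 * (v * (real (d n j) - 1))\<^sup>2"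
        unfolding w_def using sum_squares_bound[of u "v * (real (d n j) - 1)"] by (simp add: power2_sum)
      have 3: "2 * (v * (real (d n j) - 1))\<^sup>2 \<le> 2 * v\<^sup>2 * (real (d n j))\<^sup>2"
        using square_minus_one_le[of "d n j"] that by (simp add: power_mult_distrib mult_left_mono)
      have 4: "2 * u\<^sup>2 \<le> 2 * u\<^sup>2 * (real (d n j))\<^sup>2"
        using mult_left_mono[of 1 "(real (d n j))\<^sup>2" "2 * u\<^sup>2"] that by (simp add: one_le_power)
      have "(w n j)\<^sup>2 \<le> U * (real (d n j))\<^sup>2"
        unfolding U_def distrib_right using 2 3 4 by linarith
      then have "(w n j)\<^sup>2 / ?N \<le> U * (real (d n j))\<^sup>2 / ?N"
        using pos by (intro divide_right_mono) auto
      with 1 show ?thesis by linarith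
    qed
    have 1: "cmod (taylor_error n u v) \<le> (\<Sum>j<N n. ?E j)"
      unfolding taylor_error_def w_def[symmetric] using pos
      by (intro order_trans[OF norm_sum] sum_mono) (simp add: norm_mult)
    have 2: "(\<Sum>j<N n. ?E j) = (\<Sum>j | j < N n \<and> d n j \<le> K. ?E j) + (\<Sum>j | j < N n \<and> K < d n j. ?E j)"
      by (subst sum.union_disjoint[symmetric]) (auto intro!: sum.cong)
    have 3: "(\<Sum>j | j < N n \<and> d n j \<le> K. ?E j) \<le> (\<Sum>j | j < N n \<and> d n j \<le> K. (w n j)\<^sup>2 / ?N * (W / 6 / r n))"
      by (rule sum_mono) (use E1 in blast)
    have 4: "(\<Sum>j | j < N n \<and> d n j \<le> K. (w n j)\<^sup>2 / ?N * (W / 6 / r n)) \<le> (\<Sum>j<N n. (w n j)\<^sup>2 / ?N * (W / 6 / r n))"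
      using pos by (intro sum_mono2) (auto simp: W_def)
    have 5: "(\<Sum>j<N n. (w n j)\<^sup>2 / ?N * (W / 6 / r n)) = avg n * W / 6 / r n"
      unfolding sum_distrib_right[symmetric] sum_divide_distrib[symmetric] avg_def by simp
    have 6: "(\<Sum>j | j < N n \<and> K < d n j. ?E j) \<le> (\<Sum>j | j < N n \<and> K < d n j. U * (real (d n j))\<^sup>2 / ?N)"
      by (rule sum_mono) (use E2 in blast)
    have 7: "(\<Sum>j | j < N n \<and> K < d n j. U * (real (d n j))\<^sup>2 / ?N) = U * (\<Sum>j | j < N n \<and> K < d n j. (real (d n j))\<^sup>2) / ?N"
      by (simp add: sum_distrib_left sum_divide_distrib)
    have 8: "U * (\<Sum>j | j < N n \<and> K < d n j. (real (d n j))\<^sup>2) / ?N \<le> U * (\<epsilon> * ?N) / ?N"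
      using elim(2) U pos by (intro divide_right_mono mult_left_mono) auto
    have 9: "U * (\<epsilon> * ?N) / ?N \<le> e / 2" using \<epsilon>(2) pos by simp
    have "cmod (taylor_error n u v) < e" using elim(1) 1 2 3 4 5 6 7 8 9 by linarith
    then show ?case by simp
  qed
qed

text \<open>
  After the Poisson approximation the exponent is the Taylor error minus half the average of the squares,
  plus imaginary terms. The phase cancels the linear term \<open>\<i> m u / r\<close>, and the remaining imaginary terms tend
  to 0 because the row sums are balanced and \<open>r\<close> tends to infinity.
\<close>

lemma fourier_tendsto: "(\<lambda>n. fourier n u v) \<longlonglongrightarrow> exp (- ((u\<^sup>2 + variance * v\<^sup>2) / 2))"
proof -
  define w where "w n j = u + v * (real (d n j) - 1)" for n j
  define avg where "avg n = (\<Sum>j<N n. (w n j)\<^sup>2) / real (N n)" for n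
  define S where "S n = (\<Sum>j<N n. real (d n j) - 1)" for n
  define z where "z n j = complex_of_real (q n) * (iexp (w n j / r n) - 1)" for n j
  define c where "c n = iexp (- (real (m n) * u / r n)) * iexp (- (of_int (-1) * v / r n))" for n
  define E where "E n = exp (taylor_error n u v - complex_of_real (avg n / 2) + \<i> * complex_of_real (q n * v * (S n / r n) + v / r n))" for n
  have avg_lim: "avg \<longlonglongrightarrow> u\<^sup>2 + variance * v\<^sup>2"
    unfolding avg_def[abs_def] w_def by (rule tendsto_average_sq)
  have fourier: "fourier n u v = (\<Prod>j<N n. 1 + z n j) * c n" for n
    by (simp add: fourier_def bernoulli_fourier_def z_def w_def c_def)
  have E: "(\<Prod>j<N n. exp (z n j)) * c n = E n"
    if reg: "m n > 0 \<and> N n > 0 \<and> q n \<le> 1 / 2 \<and> q n > 0 \<and> r n > 0 \<and> m n \<le> N n" for n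
  proof -
    have qr: "q n * (w n j / r n)\<^sup>2 = (w n j)\<^sup>2 / real (N n)" for j
      using reg by (simp add: q_def r_def power_divide)
    have zj: "z n j = complex_of_real (q n) * (iexp (w n j / r n) - 1 - \<i> * complex_of_real (w n j / r n) + complex_of_real ((w n j / r n)\<^sup>2 / 2))
        + \<i> * complex_of_real (q n * w n j / r n) - complex_of_real ((w n j)\<^sup>2 / real (N n) / 2)" for j
      unfolding qr[symmetric] z_def by (simp add: algebra_simps)
    have sq: "(\<Sum>j<N n. q n * w n j / r n) = real (m n) * u / r n + q n * v * (S n / r n)"
    proof -
      have "(\<Sum>j<N n. w n j) = real (N n) * u + v * S n"
        by (simp add: w_def S_def sum.distrib sum_distrib_left)
      then have "(\<Sum>j<N n. q n * w n j / r n) = q n * (real (N n) * u + v * S n) / r n"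
        by (metis sum_distrib_left sum_divide_distrib)
      also have "q n * (real (N n) * u + v * S n) = real (m n) * u + q n * v * S n"
        using reg by (simp add: q_def field_simps)
      finally show ?thesis by (simp add: add_divide_distrib)
    qed
    have "(\<Sum>j<N n. z n j) = taylor_error n u v + \<i> * complex_of_real (real (m n) * u / r n + q n * v * (S n / r n)) - complex_of_real (avg n / 2)"
    proof -
      have "(\<Sum>j<N n. z n j) = (\<Sum>j<N n. complex_of_real (q n) * (iexp (w n j / r n) - 1 - \<i> * complex_of_real (w n j / r n) + complex_of_real ((w n j / r n)\<^sup>2 / 2)))
        + \<i> * complex_of_real (\<Sum>j<N n. q n * w n j / r n) - complex_of_real (\<Sum>j<N n. (w n j)\<^sup>2 / real (N n) / 2)"
        by (subst zj) (simp only: sum.distrib sum_subtractf sum_distrib_left of_real_sum)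
      moreover have "(\<Sum>j<N n. complex_of_real (q n) * (iexp (w n j / r n) - 1 - \<i> * complex_of_real (w n j / r n) + complex_of_real ((w n j / r n)\<^sup>2 / 2))) = taylor_error n u v"
        unfolding taylor_error_def w_def by simp
      moreover have "(\<Sum>j<N n. (w n j)\<^sup>2 / real (N n) / 2) = avg n / 2"
        by (simp add: avg_def sum_divide_distrib)
      ultimately show ?thesis using sq by (simp only:)
    qed
    then have "(\<Prod>j<N n. exp (z n j)) = exp (taylor_error n u v + \<i> * complex_of_real (real (m n) * u / r n + q n * v * (S n / r n)) - complex_of_real (avg n / 2))"
      by (simp only: exp_sum[OF finite_lessThan, symmetric])
    then show ?thesis
      unfolding E_def c_def by (simp flip: exp_add add: algebra_simps)
  qed
  have "E \<longlonglongrightarrow> exp (0 - complex_of_real ((u\<^sup>2 + variance * v\<^sup>2) / 2) + \<i> * complex_of_real (0 * v * 0 + 0))"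
  proof -
    obtain B where B: "eventually (\<lambda>n. \<bar>S n\<bar> \<le> B) sequentially" using balanced unfolding S_def by blast
    have 1: "(\<lambda>n. S n / r n) \<longlonglongrightarrow> 0" by (rule bounded_over_at_top[OF B r_at_top])
    have 2: "(\<lambda>n. v / r n) \<longlonglongrightarrow> 0" by (rule bounded_over_at_top[of _ "\<bar>v\<bar>", OF _ r_at_top]) simp
    have 3: "(\<lambda>n. q n * v * (S n / r n) + v / r n) \<longlonglongrightarrow> 0 * v * 0 + 0"
      by (rule tendsto_add[OF tendsto_mult[OF tendsto_mult[OF q_tendsto_0 tendsto_const] 1] 2])
    have 4: "(\<lambda>n. avg n / 2) \<longlonglongrightarrow> (u\<^sup>2 + variance * v\<^sup>2) / 2"
      by (rule tendsto_divide[OF avg_lim tendsto_const]) simp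
    show ?thesis
      unfolding E_def[abs_def]
      by (intro tendsto_exp tendsto_add tendsto_diff tendsto_mult tendsto_const taylor_error_tendsto_0
          tendsto_of_real[OF 3] tendsto_of_real[OF 4])
  qed
  then have E_lim: "E \<longlonglongrightarrow> exp (- ((u\<^sup>2 + variance * v\<^sup>2) / 2))"
    by (simp flip: exp_of_real)
  have "(\<lambda>n. fourier n u v - E n) \<longlonglongrightarrow> 0"
  proof (rule Lim_null_comparison)
    show "(\<lambda>n. 3 * q n * avg n) \<longlonglongrightarrow> 0"
      using tendsto_mult[OF tendsto_mult[OF tendsto_const q_tendsto_0, of 3] avg_lim] by simp
    show "eventually (\<lambda>n. norm (fourier n u v - E n) \<le> 3 * q n * avg n) sequentially"
      using eventually_regular
    proof eventually_elim
      case (elim n)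
      have "norm (fourier n u v - E n) = norm ((\<Prod>j<N n. 1 + z n j) - (\<Prod>j<N n. exp (z n j)))"
        unfolding fourier E[OF elim, symmetric] left_diff_distrib[symmetric] norm_mult by (simp add: c_def norm_mult)
      also have "\<dots> \<le> 3 * (q n)\<^sup>2 * (\<Sum>j<N n. (w n j / r n)\<^sup>2)"
        unfolding z_def using elim by (intro norm_prod_bernoulli_minus_exp_le) auto
      also have "\<dots> = 3 * q n * (\<Sum>j<N n. q n * (w n j / r n)\<^sup>2)"
        by (simp add: power2_eq_square sum_distrib_left mult_ac)
      also have "(\<Sum>j<N n. q n * (w n j / r n)\<^sup>2) = avg n"
        using elim by (simp add: avg_def q_def r_def power_divide sum_divide_distrib)
      finally show ?case .
    qed
  qed
  from tendsto_add[OF this E_lim] show ?thesis by simp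
qed

definition dominated :: "real \<Rightarrow> nat \<Rightarrow> bool" where
  "dominated c n \<longleftrightarrow> (\<forall>u v. \<bar>u\<bar> \<le> pi * r n \<longrightarrow> \<bar>v\<bar> \<le> pi * r n \<longrightarrow>
      norm (fourier n u v) \<le> exp (- (c * (u\<^sup>2 + v\<^sup>2))))"

text \<open>
  The modulus is at most \<open>exp (- (q / 2) \<Sum>j. 1 - cos \<theta>)\<close>, where \<open>\<theta>\<close> is the angle of the entry \<open>j\<close>. Each of
  the finitely many degrees in \<open>F\<close> eventually occupies at least a fraction \<open>\<delta>\<close> of the row, so the sum is at
  least \<open>\<delta> N\<close> times the trigonometric sum bounded below by \<open>quadratic_lower_bound_of_Gcd\<close>; the factors
  \<open>q\<close>, \<open>N\<close> and \<open>r\<^sup>2\<close> cancel.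
\<close>

lemma fourier_dominated:
  "\<exists>c>0. eventually (\<lambda>n. dominated c n) sequentially"
proof -
  obtain F c0 where F: "finite F" "F \<subseteq> set_pmf p" "c0 > 0"
    "\<And>s t. \<bar>s\<bar> \<le> pi \<Longrightarrow> \<bar>t\<bar> \<le> pi \<Longrightarrow> c0 * (s\<^sup>2 + t\<^sup>2) \<le> (\<Sum>i\<in>F. 1 - cos (s + t * (real i - 1)))"
    using quadratic_lower_bound_of_Gcd[OF span] by blast
  define \<delta> where "\<delta> = Min (insert 1 ((\<lambda>i. pmf p i / 2) ` F))"
  have \<delta>: "\<delta> > 0" "\<And>i. i \<in> F \<Longrightarrow> \<delta> \<le> pmf p i / 2"
  proof -
    show "\<delta> > 0" using F(1,2) by (auto simp: \<delta>_def pmf_positive)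
    show "\<delta> \<le> pmf p i / 2" if "i \<in> F" for i
      unfolding \<delta>_def using F(1) that by (intro Min_le) auto
  qed
  have ev: "eventually (\<lambda>n. \<forall>i\<in>F. \<delta> < real (card {j. j < N n \<and> d n j = i}) / real (N n)) sequentially"
  proof (intro eventually_ball_finite ballI)
    fix i assume i: "i \<in> F"
    then have "pmf p i > 0" using F(2) by (auto simp: pmf_positive)
    then have "\<delta> < pmf p i" using \<delta>(2)[OF i] by linarith
    with frequency[of i] show "eventually (\<lambda>n. \<delta> < real (card {j. j < N n \<and> d n j = i}) / real (N n)) sequentially"
      by (rule order_tendstoD)
  qed fact
  show ?thesis
  proof (intro exI conjI)
    show "\<delta> * c0 / 2 > 0" using \<delta> F by simp
    show "eventually (\<lambda>n. dominated (\<delta> * c0 / 2) n) sequentially"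
      using ev eventually_regular
    proof eventually_elim
      case (elim n)
      show ?case
        unfolding dominated_def
      proof (intro allI impI)
        fix u v assume uv: "\<bar>u\<bar> \<le> pi * r n" "\<bar>v\<bar> \<le> pi * r n"
        define s t where "s = u / r n" and "t = v / r n"
        have st: "\<bar>s\<bar> \<le> pi" "\<bar>t\<bar> \<le> pi"
          using uv elim(2) by (auto simp: s_def t_def abs_divide pos_divide_le_eq)
        define h where "h i = 1 - cos (s + t * (real i - 1))" for i
        have h0: "h i \<ge> 0" for i by (simp add: h_def)
        have 1: "norm (fourier n u v) \<le> exp (- (q n / 2 * (\<Sum>j<N n. h (d n j))))"
        proof -
          have "norm (fourier n u v) \<le> exp (- (q n / 2 * (\<Sum>j<N n. 1 - cos ((u + v * of_int (int (d n j) - 1)) / r n))))"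
            unfolding fourier_def using elim(2) by (intro norm_bernoulli_fourier_le) auto
          also have "(\<lambda>j. 1 - cos ((u + v * of_int (int (d n j) - 1)) / r n)) = (\<lambda>j. h (d n j))"
            by (auto simp: h_def s_def t_def add_divide_distrib)
          finally show ?thesis .
        qed
        have "(\<Sum>i\<in>F. \<delta> * real (N n) * h i) \<le> (\<Sum>i\<in>F. real (card {j. j < N n \<and> d n j = i}) * h i)"
        proof (rule sum_mono)
          fix i assume "i \<in> F"
          then have "\<delta> * real (N n) \<le> real (card {j. j < N n \<and> d n j = i})"
            using elim by (auto simp: pos_less_divide_eq less_imp_le)
          then show "\<delta> * real (N n) * h i \<le> real (card {j. j < N n \<and> d n j = i}) * h i"
            using h0 by (rule mult_right_mono)
        qed
        also have "\<dots> = (\<Sum>i\<in>F. \<Sum>j | j \<in> {j. j < N n \<and> d n j \<in> F} \<and> d n j = i. h (d n j))"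
        proof (rule sum.cong[OF refl])
          fix i assume "i \<in> F"
          then have "{j. j \<in> {j. j < N n \<and> d n j \<in> F} \<and> d n j = i} = {j. j < N n \<and> d n j = i}" by auto
          then show "real (card {j. j < N n \<and> d n j = i}) * h i = (\<Sum>j | j \<in> {j. j < N n \<and> d n j \<in> F} \<and> d n j = i. h (d n j))"
            by simp
        qed
        also have "\<dots> = (\<Sum>j | j < N n \<and> d n j \<in> F. h (d n j))"
          using F(1) by (intro sum.group) auto
        also have "\<dots> \<le> (\<Sum>j<N n. h (d n j))"
          using h0 by (intro sum_mono2) auto
        finally have 2: "\<delta> * real (N n) * (\<Sum>i\<in>F. h i) \<le> (\<Sum>j<N n. h (d n j))"
          by (simp add: sum_distrib_left)
        have 3: "\<delta> * real (N n) * (c0 * (s\<^sup>2 + t\<^sup>2)) \<le> \<delta> * real (N n) * (\<Sum>i\<in>F. h i)"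
          unfolding h_def using \<delta>(1) F(4)[OF st] by (intro mult_left_mono) auto
        have 4: "q n / 2 * (\<delta> * real (N n) * (c0 * (s\<^sup>2 + t\<^sup>2))) = \<delta> * c0 / 2 * (u\<^sup>2 + v\<^sup>2)"
          using elim(2) by (simp add: s_def t_def q_def r_def power_divide field_simps)
        have "q n / 2 * (\<delta> * real (N n) * (c0 * (s\<^sup>2 + t\<^sup>2))) \<le> q n / 2 * (\<Sum>j<N n. h (d n j))"
          using order_trans[OF 3 2] elim(2) by (intro mult_left_mono) auto
        then have "exp (- (q n / 2 * (\<Sum>j<N n. h (d n j)))) \<le> exp (- (\<delta> * c0 / 2 * (u\<^sup>2 + v\<^sup>2)))"
          unfolding 4 by simp
        with 1 show "norm (fourier n u v) \<le> exp (- (\<delta> * c0 / 2 * (u\<^sup>2 + v\<^sup>2)))" by (rule order_trans)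
      qed
    qed
  qed
qed

lemma window_tendsto: "(\<lambda>n. window (r n) u) \<longlonglongrightarrow> 1"
proof (rule tendsto_eventually)
  have "eventually (\<lambda>n. r n \<ge> \<bar>u\<bar> / pi) sequentially"
    using r_at_top by (simp add: filterlim_at_top)
  then show "eventually (\<lambda>n. window (r n) u = 1) sequentially"
  proof eventually_elim
    case (elim n)
    then have "\<bar>u\<bar> \<le> pi * r n" by (simp add: field_simps)
    then show ?case by (simp add: window_def indicator_def abs_le_iff minus_le_iff)
  qed
qed

lemma norm_window_fourier_le:
  assumes "dominated c n"
  shows "norm (window (r n) u * window (r n) v * fourier n u v) \<le> exp (- (c * u\<^sup>2)) * exp (- (c * v\<^sup>2))"
proof (cases "\<bar>u\<bar> \<le> pi * r n \<and> \<bar>v\<bar> \<le> pi * r n")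
  case True
  have "norm (window (r n) u * window (r n) v * fourier n u v) \<le> 1 * 1 * norm (fourier n u v)"
    unfolding norm_mult by (intro mult_right_mono mult_mono norm_window_le) auto
  also have "\<dots> \<le> exp (- (c * (u\<^sup>2 + v\<^sup>2)))" using assms True by (simp add: dominated_def)
  also have "\<dots> = exp (- (c * u\<^sup>2)) * exp (- (c * v\<^sup>2))"
    by (simp flip: exp_add add: algebra_simps)
  finally show ?thesis .
next
  case False
  then have zero: "window (r n) u * window (r n) v = 0"
    by (auto simp: window_def indicator_def abs_le_iff)
  show ?thesis unfolding zero by simp
qed

lemma integral_fourier_tendsto:
  "(\<lambda>n. \<integral>z. (case z of (u, v) \<Rightarrow> window (r n) u * window (r n) v * fourier n u v) \<partial>(lborel \<Otimes>\<^sub>M lborel))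
     \<longlonglongrightarrow> complex_of_real (sqrt (2 * pi) * sqrt (2 * pi / variance))"
proof -
  obtain c where c: "c > 0" and ev: "eventually (\<lambda>n. dominated c n) sequentially"
    using fourier_dominated by blast
  \<comment> \<open>Domination holds only eventually, so the integrands are set to 0 where it fails.\<close>
  define s where "s n z = (if dominated c n then (case z of (u, v) \<Rightarrow> window (r n) u * window (r n) v * fourier n u v) else 0)" for n and z :: "real \<times> real"
  define f where "f = (\<lambda>(u, v). complex_of_real (exp (- (1 / 2 * u\<^sup>2))) * complex_of_real (exp (- (variance / 2 * v\<^sup>2))))"
  have gf: "integrable lborel (\<lambda>u. complex_of_real (exp (- (1 / 2 * u\<^sup>2))))"
       "integrable lborel (\<lambda>v. complex_of_real (exp (- (variance / 2 * v\<^sup>2))))"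
    using gaussian_integral(1)[of "1 / 2"] gaussian_integral(1)[of "variance / 2"] variance_pos by simp_all
  have lim: "(\<lambda>n. integral\<^sup>L (lborel \<Otimes>\<^sub>M lborel) (s n)) \<longlonglongrightarrow> integral\<^sup>L (lborel \<Otimes>\<^sub>M lborel) f"
  proof (rule integral_dominated_convergence)
    show "f \<in> borel_measurable (lborel \<Otimes>\<^sub>M lborel)" unfolding f_def by measurable
    show "s n \<in> borel_measurable (lborel \<Otimes>\<^sub>M lborel)" for n
    proof -
      have [measurable]: "(\<lambda>z. fourier n (fst z) (snd z)) \<in> borel_measurable (lborel \<Otimes>\<^sub>M lborel)"
        using bernoulli_fourier_measurable(1)[of "r n" "q n" "{..<N n}" "\<lambda>j. int (d n j) - 1" "m n" "-1"]
        by (simp add: fourier_def split_beta')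
      have "(\<lambda>(u, v). window (r n) u * window (r n) v * fourier n u v) \<in> borel_measurable (lborel \<Otimes>\<^sub>M lborel)"
        unfolding split_beta' by measurable
      then show ?thesis by (cases "dominated c n") (simp_all add: s_def[abs_def])
    qed
    show "integrable (lborel \<Otimes>\<^sub>M lborel) (\<lambda>(u, v). exp (- (c * u\<^sup>2)) * exp (- (c * v\<^sup>2)))"
      by (rule integral_lborel_product(1)) (rule gaussian_integral(1)[OF c])+
    show "AE z in lborel \<Otimes>\<^sub>M lborel. (\<lambda>n. s n z) \<longlonglongrightarrow> f z"
    proof (rule AE_I2)
      fix z :: "real \<times> real"
      obtain u v where z: "z = (u, v)" by (cases z)
      have l: "(\<lambda>n. window (r n) u * window (r n) v * fourier n u v) \<longlonglongrightarrow> 1 * 1 * complex_of_real (exp (- ((u\<^sup>2 + variance * v\<^sup>2) / 2)))"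
        by (intro tendsto_mult window_tendsto fourier_tendsto)
      have e: "1 * 1 * complex_of_real (exp (- ((u\<^sup>2 + variance * v\<^sup>2) / 2))) = f z"
      proof -
        have "exp (- ((u\<^sup>2 + variance * v\<^sup>2) / 2)) = exp (- (1 / 2 * u\<^sup>2)) * exp (- (variance / 2 * v\<^sup>2))"
          by (simp flip: exp_add add: algebra_simps add_divide_distrib)
        then show ?thesis by (simp only: f_def z split_conv of_real_mult[symmetric] mult_1_left)
      qed
      have ev': "eventually (\<lambda>n. window (r n) u * window (r n) v * fourier n u v = s n z) sequentially"
        using ev by eventually_elim (simp add: s_def z)
      show "(\<lambda>n. s n z) \<longlonglongrightarrow> f z"
        using Lim_transform_eventually[OF l ev'] unfolding e .
    qed
    show "AE z in lborel \<Otimes>\<^sub>M lborel. norm (s n z) \<le> (case z of (u, v) \<Rightarrow> exp (- (c * u\<^sup>2)) * exp (- (c * v\<^sup>2)))" for n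
    proof (rule AE_I2)
      fix z :: "real \<times> real"
      obtain u v where z: "z = (u, v)" by (cases z)
      show "norm (s n z) \<le> (case z of (u, v) \<Rightarrow> exp (- (c * u\<^sup>2)) * exp (- (c * v\<^sup>2)))"
      proof (cases "dominated c n")
        case True
        then show ?thesis
          using norm_window_fourier_le[of c n u v] by (simp add: s_def z)
      qed (simp add: s_def z)
    qed
  qed
  have "integral\<^sup>L (lborel \<Otimes>\<^sub>M lborel) f = complex_of_real (sqrt (2 * pi) * sqrt (2 * pi / variance))"
    using integral_lborel_product(2)[OF gf] gaussian_integral(2)[of "1 / 2"] gaussian_integral(2)[of "variance / 2"] variance_pos
    unfolding f_def integral_complex_of_real by (simp add: mult.commute)
  moreover have "eventually (\<lambda>n. integral\<^sup>L (lborel \<Otimes>\<^sub>M lborel) (s n) =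
     (\<integral>z. (case z of (u, v) \<Rightarrow> window (r n) u * window (r n) v * fourier n u v) \<partial>(lborel \<Otimes>\<^sub>M lborel))) sequentially"
    using ev by eventually_elim (simp add: s_def[abs_def])
  ultimately show ?thesis using Lim_transform_eventually[OF lim] by simp
qed

lemma integral_fourier_0_tendsto:
  "(\<lambda>n. LBINT u. window (r n) u * fourier n u 0) \<longlonglongrightarrow> complex_of_real (sqrt (2 * pi))"
proof -
  obtain c where c: "c > 0" and ev: "eventually (\<lambda>n. dominated c n) sequentially"
    using fourier_dominated by blast
  define ok where "ok n \<longleftrightarrow> dominated c n \<and> r n > 0" for n
  have ev_ok: "eventually ok sequentially"
    using ev eventually_regular by eventually_elim (simp add: ok_def)
  define s where "s n u = (if ok n then window (r n) u * fourier n u 0 else 0)" for n u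
  define f where "f = (\<lambda>u. complex_of_real (exp (- (1 / 2 * u\<^sup>2))))"
  have lim: "(\<lambda>n. integral\<^sup>L lborel (s n)) \<longlonglongrightarrow> integral\<^sup>L lborel f"
  proof (rule integral_dominated_convergence)
    show "f \<in> borel_measurable lborel" unfolding f_def by measurable
    show "s n \<in> borel_measurable lborel" for n
    proof -
      have [measurable]: "(\<lambda>u. fourier n u 0) \<in> borel_measurable borel"
        unfolding fourier_def by (rule bernoulli_fourier_measurable(2))
      show ?thesis unfolding s_def by (cases "ok n") simp_all
    qed
    show "integrable lborel (\<lambda>u. exp (- (c * u\<^sup>2)))" by (rule gaussian_integral(1)[OF c])
    show "AE u in lborel. (\<lambda>n. s n u) \<longlonglongrightarrow> f u"
    proof (rule AE_I2)
      fix u :: real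
      have l: "(\<lambda>n. window (r n) u * fourier n u 0) \<longlonglongrightarrow> 1 * complex_of_real (exp (- ((u\<^sup>2 + variance * 0\<^sup>2) / 2)))"
        by (intro tendsto_mult window_tendsto fourier_tendsto)
      have e: "1 * complex_of_real (exp (- ((u\<^sup>2 + variance * 0\<^sup>2) / 2))) = f u"
        by (simp add: f_def)
      have ev': "eventually (\<lambda>n. window (r n) u * fourier n u 0 = s n u) sequentially"
        using ev_ok by eventually_elim (simp add: s_def)
      show "(\<lambda>n. s n u) \<longlonglongrightarrow> f u"
        using Lim_transform_eventually[OF l ev'] unfolding e .
    qed
    show "AE u in lborel. norm (s n u) \<le> exp (- (c * u\<^sup>2))" for n
    proof (rule AE_I2)
      fix u :: real
      show "norm (s n u) \<le> exp (- (c * u\<^sup>2))"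
      proof (cases "ok n")
        case True
        then have "window (r n) 0 = 1" by (simp add: ok_def window_def indicator_def)
        then show ?thesis
          using norm_window_fourier_le[of c n u 0] True unfolding ok_def by (simp add: s_def ok_def)
      qed (simp add: s_def)
    qed
  qed
  have "integral\<^sup>L lborel f = complex_of_real (sqrt (2 * pi))"
    using gaussian_integral(2)[of "1 / 2"] unfolding f_def integral_complex_of_real by (simp add: mult.commute)
  moreover have "eventually (\<lambda>n. integral\<^sup>L lborel (s n) = (LBINT u. window (r n) u * fourier n u 0)) sequentially"
    using ev_ok by eventually_elim (simp add: s_def[abs_def])
  ultimately show ?thesis using Lim_transform_eventually[OF lim] by simp
qed

text \<open>
  Both Fourier integrals converge by dominated convergence to Gaussian integrals, and their quotient is the
  fraction of \<open>m\<close>-subsets with the required sum up to the factor \<open>2 \<pi> r\<close>.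
\<close>

theorem local_limit_subsets:
  "(\<lambda>n. sqrt (real (m n)) *
      (real (card {I. I \<subseteq> {..<N n} \<and> card I = m n \<and> (\<Sum>j\<in>I. int (d n j) - 1) = -1}) / real (N n choose m n)))
   \<longlonglongrightarrow> 1 / sqrt (2 * pi * variance)"
proof -
  define cnt where "cnt n = real (card {I. I \<subseteq> {..<N n} \<and> card I = m n \<and> (\<Sum>j\<in>I. int (d n j) - 1) = -1})" for n
  define I2 where "I2 n = (2 * pi * r n)\<^sup>2 * (q n ^ m n * (1 - q n) ^ (N n - m n)) * cnt n" for n
  define I1 where "I1 n = 2 * pi * r n * (q n ^ m n * (1 - q n) ^ (N n - m n)) * real (N n choose m n)" for n
  have "(\<lambda>n. complex_of_real (I2 n)) \<longlonglongrightarrow> complex_of_real (sqrt (2 * pi) * sqrt (2 * pi / variance))"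
  proof (rule Lim_transform_eventually[OF integral_fourier_tendsto])
    show "eventually (\<lambda>n. (\<integral>z. (case z of (u, v) \<Rightarrow> window (r n) u * window (r n) v * fourier n u v) \<partial>(lborel \<Otimes>\<^sub>M lborel)) = complex_of_real (I2 n)) sequentially"
      using eventually_regular
    proof eventually_elim
      case (elim n)
      show ?case unfolding fourier_def I2_def cnt_def
        by (subst integral_bernoulli_fourier) (use elim in auto)
    qed
  qed
  then have L2: "I2 \<longlonglongrightarrow> sqrt (2 * pi) * sqrt (2 * pi / variance)" by (simp only: tendsto_of_real_iff)
  have "(\<lambda>n. complex_of_real (I1 n)) \<longlonglongrightarrow> complex_of_real (sqrt (2 * pi))"
  proof (rule Lim_transform_eventually[OF integral_fourier_0_tendsto])
    show "eventually (\<lambda>n. (LBINT u. window (r n) u * fourier n u 0) = complex_of_real (I1 n)) sequentially"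
      using eventually_regular
    proof eventually_elim
      case (elim n)
      show ?case unfolding fourier_def I1_def
        by (subst integral_bernoulli_fourier_0) (use elim in auto)
    qed
  qed
  then have L1: "I1 \<longlonglongrightarrow> sqrt (2 * pi)" by (simp only: tendsto_of_real_iff)
  have "(\<lambda>n. I2 n / I1 n / (2 * pi)) \<longlonglongrightarrow> sqrt (2 * pi) * sqrt (2 * pi / variance) / sqrt (2 * pi) / (2 * pi)"
    by (intro tendsto_divide L1 L2 tendsto_const) auto
  moreover have "sqrt (2 * pi) * sqrt (2 * pi / variance) / sqrt (2 * pi) / (2 * pi) = 1 / sqrt (2 * pi * variance)"
  proof -
    have "2 * pi = sqrt (2 * pi) * sqrt (2 * pi)" by simp
    then show ?thesis
      using variance_pos by (simp add: real_sqrt_divide real_sqrt_mult field_simps)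
  qed
  moreover have "eventually (\<lambda>n. I2 n / I1 n / (2 * pi) = sqrt (real (m n)) * (cnt n / real (N n choose m n))) sequentially"
    using eventually_regular
  proof eventually_elim
    case (elim n)
    define W where "W = q n ^ m n * (1 - q n) ^ (N n - m n)"
    have "W > 0" using elim by (simp add: W_def)
    moreover have "real (N n choose m n) > 0" using elim by simp
    moreover have "r n > 0" using elim by simp
    ultimately show ?case
      unfolding I2_def I1_def r_def[symmetric] W_def[symmetric] by (simp add: power2_eq_square)
  qed
  ultimately have "(\<lambda>n. sqrt (real (m n)) * (cnt n / real (N n choose m n))) \<longlonglongrightarrow> 1 / sqrt (2 * pi * variance)"
    using Lim_transform_eventually by fastforce
  then show ?thesis unfolding cnt_def .
qed

end

section \<open>Several blocks\<close>

text \<open>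
  The first block of a random arrangement is a uniformly random \<open>m\<close>-subset of the entries: both sides count
  pairs of an arrangement \<open>w\<close> and an \<open>m\<close>-set of positions at which the entries of \<open>w\<close> sum to \<open>s\<close>.
\<close>

lemma card_permutations_block_sum:
  fixes xs :: "nat list"
  assumes "mset xs = M" "m \<le> size M"
  shows "(size M choose m) * card {w \<in> permutations_of_multiset M. sum_list (take m w) = s} =
    card (permutations_of_multiset M) * card {I. I \<subseteq> {..<size M} \<and> card I = m \<and> (\<Sum>j\<in>I. xs ! j) = s}"
proof -
  let ?S = "permutations_of_multiset M"
  let ?N = "size M"
  let ?subs = "{I. I \<subseteq> {..<?N} \<and> card I = m}"
  have fin: "finite ?subs" by simp
  have "(\<Sum>I\<in>?subs. card {w \<in> ?S. (\<Sum>j\<in>I. w ! j) = s}) =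
     (\<Sum>I\<in>?subs. card {w \<in> ?S. sum_list (take m w) = s})"
  proof (rule sum.cong[OF refl])
    fix I assume I: "I \<in> ?subs"
    then have finI: "finite I" by (auto intro: finite_subset)
    define pos where "pos = sorted_list_of_set I"
    have pos: "distinct pos" "set pos = I" "length pos = m"
      using finI I by (auto simp: pos_def)
    have "card {w \<in> ?S. sum_list (map ((!) w) pos) = s} = card {w \<in> ?S. sum_list (take (length pos) w) = s}"
      using I pos by (intro card_permutations_at_positions) auto
    moreover have "sum_list (map ((!) w) pos) = (\<Sum>j\<in>I. w ! j)" for w :: "nat list"
      using pos by (simp add: sum_list_distinct_conv_sum_set)
    ultimately show "card {w \<in> ?S. (\<Sum>j\<in>I. w ! j) = s} = card {w \<in> ?S. sum_list (take m w) = s}"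
      using pos(3) by simp
  qed
  also have "\<dots> = (?N choose m) * card {w \<in> ?S. sum_list (take m w) = s}"
    by (simp add: n_subsets)
  finally have 1: "(\<Sum>I\<in>?subs. card {w \<in> ?S. (\<Sum>j\<in>I. w ! j) = s}) = (?N choose m) * card {w \<in> ?S. sum_list (take m w) = s}" .
  have 2: "(\<Sum>I\<in>?subs. card {w \<in> ?S. (\<Sum>j\<in>I. w ! j) = s}) = (\<Sum>w\<in>?S. card {I \<in> ?subs. (\<Sum>j\<in>I. w ! j) = s})"
    unfolding card_eq_sum by (rule sum.swap_restrict) (simp_all add: fin)
  have "(\<Sum>w\<in>?S. card {I \<in> ?subs. (\<Sum>j\<in>I. w ! j) = s}) = (\<Sum>w\<in>?S. card {I \<in> ?subs. (\<Sum>j\<in>I. xs ! j) = s})"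
  proof (rule sum.cong[OF refl])
    fix w assume "w \<in> ?S"
    then have "mset w = mset xs" using assms(1) by (simp add: permutations_of_multisetD)
    then obtain g where g: "g permutes {..<length xs}" "permute_list g xs = w"
      by (rule mset_eq_permutation)
    have len: "length xs = ?N" using assms(1) by auto
    have nth: "w ! j = xs ! g j" if "j < ?N" for j
      using g that len by (auto simp: permute_list_nth)
    have "bij_betw (image g) {I \<in> ?subs. (\<Sum>j\<in>I. w ! j) = s} {I \<in> ?subs. (\<Sum>j\<in>I. xs ! j) = s}"
    proof (rule bij_betw_byWitness[where f' = "image (inv g)"])
      have inj: "inj g" using g(1) by (rule permutes_inj)
      have sum: "(\<Sum>j\<in>g ` I. xs ! j) = (\<Sum>j\<in>I. w ! j)" if "I \<subseteq> {..<?N}" for I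
        using that nth by (subst sum.reindex) (auto intro!: inj_on_subset[OF inj] sum.cong)
      show "\<forall>I\<in>{I \<in> ?subs. (\<Sum>j\<in>I. w ! j) = s}. inv g ` g ` I = I"
        using inj by (simp add: image_image)
      show inv: "\<forall>I\<in>{I \<in> ?subs. (\<Sum>j\<in>I. xs ! j) = s}. g ` inv g ` I = I"
        using permutes_surj[OF g(1)] by (simp add: image_image surj_f_inv_f)
      have sub: "g ` I \<subseteq> {..<?N}" if "I \<subseteq> {..<?N}" for I
        using that g(1) permutes_image[OF g(1)] len by auto
      have sub': "inv g ` I \<subseteq> {..<?N}" if "I \<subseteq> {..<?N}" for I
        using that permutes_image[OF permutes_inv[OF g(1)]] len by auto
      have card: "card (g ` I) = card I" for I
        by (rule card_image) (rule inj_on_subset[OF inj], simp)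
      show "image g ` {I \<in> ?subs. (\<Sum>j\<in>I. w ! j) = s} \<subseteq> {I \<in> ?subs. (\<Sum>j\<in>I. xs ! j) = s}"
        using sub card sum by auto
      show "image (inv g) ` {I \<in> ?subs. (\<Sum>j\<in>I. xs ! j) = s} \<subseteq> {I \<in> ?subs. (\<Sum>j\<in>I. w ! j) = s}"
      proof (rule image_subsetI)
        fix I assume I: "I \<in> {I \<in> ?subs. (\<Sum>j\<in>I. xs ! j) = s}"
        then have sI: "I \<subseteq> {..<?N}" by simp
        have gi: "g ` inv g ` I = I" using permutes_surj[OF g(1)] by (simp add: image_image surj_f_inv_f)
        show "inv g ` I \<in> {I \<in> ?subs. (\<Sum>j\<in>I. w ! j) = s}"
          using I sub'[OF sI] card[of "inv g ` I"] sum[OF sub'[OF sI]] unfolding gi by simp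
      qed
    qed
    then show "card {I \<in> ?subs. (\<Sum>j\<in>I. w ! j) = s} = card {I \<in> ?subs. (\<Sum>j\<in>I. xs ! j) = s}"
      by (rule bij_betw_same_card)
  qed
  also have "\<dots> = card ?S * card {I \<in> ?subs. (\<Sum>j\<in>I. xs ! j) = s}" by simp
  also have "{I \<in> ?subs. (\<Sum>j\<in>I. xs ! j) = s} = {I. I \<subseteq> {..<?N} \<and> card I = m \<and> (\<Sum>j\<in>I. xs ! j) = s}" by blast
  finally show ?thesis using 1 2 by linarith
qed

definition block_prob :: "nat \<Rightarrow> nat \<Rightarrow> nat multiset \<Rightarrow> real" where
  "block_prob m k M = real (num_initial m (\<lambda>u. sum_list u + 1 = m) k M) / real (card (permutations_of_multiset M))"

definition block_multisets :: "nat \<Rightarrow> nat multiset \<Rightarrow> nat multiset set" where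
  "block_multisets m M = {A. A \<subseteq># M \<and> size A = m \<and> sum_mset A + 1 = m}"

lemma finite_block_multisets: "finite (block_multisets m M)"
  by (rule finite_subset[OF _ finite_submultisets[of M]]) (auto simp: block_multisets_def)

lemma card_permutations_pos: "card (permutations_of_multiset M) > 0"
  by (simp add: card_gt_0_iff)

text \<open>
  Conditioning on the multiset \<open>A\<close> of entries in the first block; \<open>wt A\<close> is the probability that this multiset
  is \<open>A\<close>, and it does not depend on \<open>k\<close>.
\<close>

lemma block_prob_Suc:
  assumes "m \<le> size M"
  shows "\<exists>wt. (\<forall>A. wt A \<ge> 0) \<and> (\<forall>k. block_prob m (Suc k) M = (\<Sum>A\<in>block_multisets m M. wt A * block_prob m k (M - A)))"
proof (intro exI conjI allI)
  let ?S = "permutations_of_multiset"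
  define wt where "wt A = real (card {u \<in> ?S A. sum_list u + 1 = m}) * real (card (?S (M - A))) / real (card (?S M))" for A
  show "wt A \<ge> 0" for A by (simp add: wt_def)
  fix k
  have empty: "{u \<in> ?S A. sum_list u + 1 = m} = {}" if "sum_mset A + 1 \<noteq> m" for A
    using that by (auto simp: permutations_of_multiset_def sum_mset_sum_list)
  have zero: "card {u \<in> ?S A. sum_list u + 1 = m} = 0" if "sum_mset A + 1 \<noteq> m" for A
    unfolding empty[OF that] by simp
  have "num_initial m (\<lambda>u. sum_list u + 1 = m) (Suc k) M =
     (\<Sum>A | A \<subseteq># M \<and> size A = m. card {u \<in> ?S A. sum_list u + 1 = m} * num_initial m (\<lambda>u. sum_list u + 1 = m) k (M - A))"
    by (rule num_initial_Suc[OF assms])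
  also have "\<dots> = (\<Sum>A\<in>block_multisets m M. card {u \<in> ?S A. sum_list u + 1 = m} * num_initial m (\<lambda>u. sum_list u + 1 = m) k (M - A))"
  proof (rule sum.mono_neutral_right)
    show "finite {A. A \<subseteq># M \<and> size A = m}"
      by (rule finite_subset[OF _ finite_submultisets[of M]]) auto
    show "block_multisets m M \<subseteq> {A. A \<subseteq># M \<and> size A = m}" by (auto simp: block_multisets_def)
    show "\<forall>A\<in>{A. A \<subseteq># M \<and> size A = m} - block_multisets m M.
        card {u \<in> ?S A. sum_list u + 1 = m} * num_initial m (\<lambda>u. sum_list u + 1 = m) k (M - A) = 0"
    proof
      fix A assume "A \<in> {A. A \<subseteq># M \<and> size A = m} - block_multisets m M"
      then have "sum_mset A + 1 \<noteq> m" by (auto simp: block_multisets_def)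
      from zero[OF this] show "card {u \<in> ?S A. sum_list u + 1 = m} * num_initial m (\<lambda>u. sum_list u + 1 = m) k (M - A) = 0"
        by (simp only: mult_zero_left)
    qed
  qed
  finally have eq: "num_initial m (\<lambda>u. sum_list u + 1 = m) (Suc k) M =
     (\<Sum>A\<in>block_multisets m M. card {u \<in> ?S A. sum_list u + 1 = m} * num_initial m (\<lambda>u. sum_list u + 1 = m) k (M - A))" .
  show "block_prob m (Suc k) M = (\<Sum>A\<in>block_multisets m M. wt A * block_prob m k (M - A))"
    unfolding block_prob_def eq of_nat_sum sum_divide_distrib
  proof (rule sum.cong[OF refl])
    fix A
    have "real (card (?S (M - A))) > 0" using card_permutations_pos[of "M - A"] by simp
    then show "real (card {u \<in> ?S A. sum_list u + 1 = m} * num_initial m (\<lambda>u. sum_list u + 1 = m) k (M - A)) / real (card (?S M))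
      = wt A * (real (num_initial m (\<lambda>u. sum_list u + 1 = m) k (M - A)) / real (card (?S (M - A))))"
      by (simp add: wt_def)
  qed
qed

lemma block_prob_0: "block_prob m 0 M = 1"
  using card_permutations_pos[of M] by (simp add: block_prob_def num_initial_def)

lemma block_prob_Suc_bounds:
  assumes "m \<le> size M"
    and "\<And>A. A \<in> block_multisets m M \<Longrightarrow> L \<le> block_prob m k (M - A) \<and> block_prob m k (M - A) \<le> U"
  shows "block_prob m 1 M * L \<le> block_prob m (Suc k) M" "block_prob m (Suc k) M \<le> block_prob m 1 M * U"
proof -
  obtain wt where wt: "\<And>A. wt A \<ge> 0"
    "\<And>k. block_prob m (Suc k) M = (\<Sum>A\<in>block_multisets m M. wt A * block_prob m k (M - A))"
    using block_prob_Suc[OF assms(1)] by blast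
  have one: "block_prob m 1 M = (\<Sum>A\<in>block_multisets m M. wt A)"
    using wt(2)[of 0] by (simp add: block_prob_0)
  show "block_prob m 1 M * L \<le> block_prob m (Suc k) M"
    unfolding one wt(2)[of k] sum_distrib_right using assms(2) wt(1) by (intro sum_mono mult_left_mono) auto
  show "block_prob m (Suc k) M \<le> block_prob m 1 M * U"
    unfolding one wt(2)[of k] sum_distrib_right using assms(2) wt(1) by (intro sum_mono mult_left_mono) auto
qed

lemma block_prob_1:
  fixes xs :: "nat list"
  assumes "mset xs = M" "m \<le> size M"
  shows "block_prob m 1 M = real (card {I. I \<subseteq> {..<size M} \<and> card I = m \<and> (\<Sum>j\<in>I. int (xs ! j) - 1) = -1}) / real (size M choose m)"
proof -
  have "(size M choose m) > 0" using assms(2) by simp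
  have "{I. I \<subseteq> {..<size M} \<and> card I = m \<and> (\<Sum>j\<in>I. int (xs ! j) - 1) = -1} =
      {I. I \<subseteq> {..<size M} \<and> card I = m \<and> (\<Sum>j\<in>I. xs ! j) + 1 = m}"
    by (auto simp: sum_subtractf simp flip: of_nat_sum)
  moreover have "(size M choose m) * num_initial m (\<lambda>u. sum_list u + 1 = m) 1 M =
     card (permutations_of_multiset M) * card {I. I \<subseteq> {..<size M} \<and> card I = m \<and> (\<Sum>j\<in>I. xs ! j) + 1 = m}"
  proof (cases m)
    case 0
    then show ?thesis by (simp add: num_initial_def)
  next
    case (Suc s)
    then show ?thesis
      using card_permutations_block_sum[OF assms, of s] by (simp add: num_initial_def)
  qed
  then have "real (size M choose m) * real (num_initial m (\<lambda>u. sum_list u + 1 = m) 1 M) =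
     real (card (permutations_of_multiset M)) * real (card {I. I \<subseteq> {..<size M} \<and> card I = m \<and> (\<Sum>j\<in>I. xs ! j) + 1 = m})"
    by (simp only: of_nat_mult[symmetric])
  ultimately show ?thesis
    using \<open>(size M choose m) > 0\<close> card_permutations_pos[of M]
    by (simp add: block_prob_def field_simps)
qed

text \<open>
  The hypotheses of the local limit theorem, phrased for the multisets of row entries.
\<close>

definition regular :: "nat pmf \<Rightarrow> (nat \<Rightarrow> nat multiset) \<Rightarrow> (nat \<Rightarrow> nat) \<Rightarrow> bool" where
  "regular p M m \<longleftrightarrow>
     filterlim (\<lambda>n. size (M n)) at_top sequentially \<and>
     (\<forall>i. (\<lambda>n. real (count (M n) i) / real (size (M n))) \<longlonglongrightarrow> pmf p i) \<and>
     (\<forall>\<epsilon>>0. \<exists>K. eventually (\<lambda>n. (\<Sum>i\<in>#M n. if K < i then (real i)\<^sup>2 else 0) \<le> \<epsilon> * real (size (M n))) sequentially) \<and>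
     filterlim m at_top sequentially \<and>
     (\<lambda>n. real (m n) / real (size (M n))) \<longlonglongrightarrow> 0 \<and>
     (\<exists>B. eventually (\<lambda>n. \<bar>real (sum_mset (M n)) - real (size (M n))\<bar> \<le> B) sequentially)"

lemma sum_nth_eq_sum_mset:
  fixes g :: "nat \<Rightarrow> 'b::comm_monoid_add"
  shows "(\<Sum>j<length xs. g (xs ! j)) = (\<Sum>i\<in>#mset xs. g i)"
proof -
  have "(\<Sum>j<length xs. g (xs ! j)) = sum_list (map g xs)"
    by (simp add: sum_list_sum_nth atLeast0LessThan)
  then show ?thesis by (simp only: sum_mset_sum_list[symmetric] mset_map)
qed

lemma sampling_array_of_regular:
  assumes "regular p M m" "summable (\<lambda>i. (real i)\<^sup>2 * pmf p i)"
    and "Gcd {int i - int j | i j. i \<in> set_pmf p \<and> j \<in> set_pmf p} = 1"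
    and xs: "\<And>n. mset (xs n) = M n"
  shows "sampling_array (\<lambda>n. size (M n)) (\<lambda>n j. xs n ! j) p m"
proof -
  have len: "size (M n) = length (xs n)" for n using arg_cong[OF xs[of n], of size] by simp
  have cnt: "card {j. j < length (xs n) \<and> xs n ! j = i} = count (M n) i" for n i
    unfolding xs[symmetric, of n] count_mset
    by (simp add: count_list_eq_length_filter length_filter_conv_card eq_commute)
  have tail: "(\<Sum>j | j < length (xs n) \<and> K < xs n ! j. (real (xs n ! j))\<^sup>2) = (\<Sum>i\<in>#M n. if K < i then (real i)\<^sup>2 else 0)" for K n
  proof -
    have "(\<Sum>j | j < length (xs n) \<and> K < xs n ! j. (real (xs n ! j))\<^sup>2) = (\<Sum>j<length (xs n). if K < xs n ! j then (real (xs n ! j))\<^sup>2 else 0)"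
      by (intro sum.mono_neutral_cong_left) auto
    then show ?thesis unfolding sum_nth_eq_sum_mset[of "\<lambda>i. if K < i then (real i)\<^sup>2 else 0"] xs .
  qed
  have bal: "(\<Sum>j<length (xs n). real (xs n ! j) - 1) = real (sum_mset (M n)) - real (size (M n))" for n
  proof -
    have "(\<Sum>j<length (xs n). xs n ! j) = sum_mset (M n)"
      using sum_nth_eq_sum_mset[of "\<lambda>i. i" "xs n"] by (simp add: xs)
    then show ?thesis by (simp add: sum_subtractf len flip: of_nat_sum)
  qed
  show ?thesis
    using assms(1-3) unfolding regular_def len
    by unfold_locales (auto simp: cnt tail bal len)
qed

lemma block_prob_1_tendsto:
  assumes "regular p M m" "summable (\<lambda>i. (real i)\<^sup>2 * pmf p i)"
    and "Gcd {int i - int j | i j. i \<in> set_pmf p \<and> j \<in> set_pmf p} = 1"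
  shows "(\<lambda>n. sqrt (real (m n)) * block_prob (m n) 1 (M n)) \<longlonglongrightarrow> 1 / sqrt (2 * pi * mean_square_deviation p)"
proof -
  have "\<exists>xs. mset xs = M n" for n by (rule ex_mset)
  then obtain xs where xs: "\<And>n. mset (xs n) = M n" by metis
  interpret sampling_array "\<lambda>n. size (M n)" "\<lambda>n j. xs n ! j" p m
    by (rule sampling_array_of_regular[OF assms xs])
  have "eventually (\<lambda>n. sqrt (real (m n)) *
      (real (card {I. I \<subseteq> {..<size (M n)} \<and> card I = m n \<and> (\<Sum>j\<in>I. int (xs n ! j) - 1) = -1}) / real (size (M n) choose m n))
     = sqrt (real (m n)) * block_prob (m n) 1 (M n)) sequentially"
    using eventually_regular
  proof eventually_elim
    case (elim n)
    then show ?case by (subst block_prob_1[OF xs]) auto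
  qed
  from Lim_transform_eventually[OF local_limit_subsets this] show ?thesis
    by simp
qed

text \<open>
  Whatever block is removed, the hypotheses persist, because only a vanishing fraction of entries is lost.
\<close>

lemma regular_remove:
  assumes reg: "regular p M m"
    and A: "\<And>n. A n \<subseteq># M n \<and> (A n = {#} \<or> size (A n) = m n \<and> sum_mset (A n) + 1 = m n)"
  shows "regular p (\<lambda>n. M n - A n) m"
proof -
  let ?size = "\<lambda>n. real (size (M n))"
  have size: "size (M n - A n) + size (A n) = size (M n)" for n
    using A[of n] by (simp add: size_Diff_submset size_mset_mono)
  have sizeA: "size (A n) \<le> m n" for n using A[of n] by auto
  have count: "count (M n - A n) i + count (A n) i = count (M n) i" for n i
    using A[of n] by (simp add: mset_subset_eq_count)
  have countA: "count (A n) i \<le> m n" for n i using count_le_size[of "A n" i] sizeA[of n] by linarith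
  have M: "M n = M n - A n + A n" for n using A[of n] by simp
  have mn: "(\<lambda>n. real (m n) / ?size n) \<longlonglongrightarrow> 0" and top: "filterlim (\<lambda>n. size (M n)) at_top sequentially"
    using reg by (auto simp: regular_def)
  have pos: "eventually (\<lambda>n. size (M n) > 0) sequentially"
    using top[unfolded filterlim_at_top, rule_format, of 1] by eventually_elim simp
  have half: "eventually (\<lambda>n. size (M n) \<le> 2 * size (M n - A n) \<and> size (M n) > 0) sequentially"
  proof -
    have "eventually (\<lambda>n. real (m n) / ?size n < 1 / 2) sequentially"
      using mn by (rule order_tendstoD) simp
    then show ?thesis using pos
    proof eventually_elim
      case (elim n)
      then have "2 * m n < size (M n)" by (simp add: field_simps)
      then show ?case using size[of n] sizeA[of n] elim by linarith
    qed
  qed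
  have small: "(\<lambda>n. real (f n) / ?size n) \<longlonglongrightarrow> 0" if "\<And>n. f n \<le> m n" for f
  proof (rule tendsto_sandwich[OF _ _ tendsto_const mn])
    show "eventually (\<lambda>n. 0 \<le> real (f n) / ?size n) sequentially" by simp
    show "eventually (\<lambda>n. real (f n) / ?size n \<le> real (m n) / ?size n) sequentially"
      using that by (intro always_eventually allI divide_right_mono) auto
  qed
  show ?thesis
    unfolding regular_def
  proof (intro conjI allI impI)
    show "filterlim (\<lambda>n. size (M n - A n)) at_top sequentially"
      unfolding filterlim_at_top
    proof
      fix Z :: nat
      from top have "eventually (\<lambda>n. 2 * Z \<le> size (M n)) sequentially" by (simp add: filterlim_at_top)
      then show "eventually (\<lambda>n. Z \<le> size (M n - A n)) sequentially"
        using half by eventually_elim linarith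
    qed
    show "(\<lambda>n. real (count (M n - A n) i) / real (size (M n - A n))) \<longlonglongrightarrow> pmf p i" for i
    proof -
      have cM: "(\<lambda>n. real (count (M n) i) / ?size n) \<longlonglongrightarrow> pmf p i" using reg by (simp add: regular_def)
      have "(\<lambda>n. (real (count (M n) i) / ?size n - real (count (A n) i) / ?size n) / (1 - real (size (A n)) / ?size n)) \<longlonglongrightarrow> (pmf p i - 0) / (1 - 0)"
        by (intro tendsto_divide tendsto_diff tendsto_const cM small countA sizeA) simp
      moreover have "eventually (\<lambda>n. (real (count (M n) i) / ?size n - real (count (A n) i) / ?size n) / (1 - real (size (A n)) / ?size n)
          = real (count (M n - A n) i) / real (size (M n - A n))) sequentially"
        using half
      proof eventually_elim
        case (elim n)
        have "real (count (M n) i) / ?size n - real (count (A n) i) / ?size n = real (count (M n - A n) i) / ?size n"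
          using count[of n i] by (simp add: diff_divide_distrib[symmetric] del: count_diff)
        moreover have "1 - real (size (A n)) / ?size n = real (size (M n - A n)) / ?size n"
        proof -
          have "real (size (M n - A n)) = ?size n - real (size (A n))" using size[of n] by linarith
          moreover have "?size n \<noteq> 0" using elim by linarith
          ultimately show ?thesis by (simp add: diff_divide_distrib)
        qed
        ultimately show ?case using elim by (simp del: count_diff)
      qed
      ultimately show ?thesis using Lim_transform_eventually by fastforce
    qed
    show "\<exists>K. eventually (\<lambda>n. (\<Sum>i\<in>#M n - A n. if K < i then (real i)\<^sup>2 else 0) \<le> \<epsilon> * real (size (M n - A n))) sequentially"
      if "\<epsilon> > 0" for \<epsilon> :: real
    proof -
      have "\<exists>K. eventually (\<lambda>n. (\<Sum>i\<in>#M n. if K < i then (real i)\<^sup>2 else 0) \<le> \<epsilon> / 2 * ?size n) sequentially"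
      proof -
        have "\<epsilon> / 2 > 0" using that by simp
        with reg show ?thesis unfolding regular_def by blast
      qed
      then obtain K where K: "eventually (\<lambda>n. (\<Sum>i\<in>#M n. if K < i then (real i)\<^sup>2 else 0) \<le> \<epsilon> / 2 * ?size n) sequentially"
        by blast
      have "eventually (\<lambda>n. (\<Sum>i\<in>#M n - A n. if K < i then (real i)\<^sup>2 else 0) \<le> \<epsilon> * real (size (M n - A n))) sequentially"
        using K half
      proof eventually_elim
        case (elim n)
        define g where "g i = (if K < i then (real i)\<^sup>2 else 0)" for i
        have "(\<Sum>i\<in>#M n. g i) = (\<Sum>i\<in>#M n - A n. g i) + (\<Sum>i\<in>#A n. g i)"
          by (subst M) (simp only: image_mset_union sum_mset.union)
        moreover have "(\<Sum>i\<in>#B. g i) \<ge> 0" for B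
          by (induction B) (auto simp: g_def)
        ultimately have "(\<Sum>i\<in>#M n - A n. g i) \<le> (\<Sum>i\<in>#M n. g i)" by (metis le_add_same_cancel1)
        also have "\<dots> \<le> \<epsilon> / 2 * ?size n" using elim(1) unfolding g_def .
        also have "\<dots> \<le> \<epsilon> / 2 * (2 * real (size (M n - A n)))"
        proof (rule mult_left_mono)
          have "size (M n) \<le> 2 * size (M n - A n)" using elim(2) by blast
          then show "?size n \<le> 2 * real (size (M n - A n))" by linarith
        qed (use that in simp)
        finally show ?case unfolding g_def by simp
      qed
      then show ?thesis by blast
    qed
    show "filterlim m at_top sequentially" using reg by (simp add: regular_def)
    show "(\<lambda>n. real (m n) / real (size (M n - A n))) \<longlonglongrightarrow> 0"
    proof (rule Lim_null_comparison)
      show "(\<lambda>n. 2 * (real (m n) / ?size n)) \<longlonglongrightarrow> 0"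
        using tendsto_mult[OF tendsto_const mn, of 2] by simp
      show "eventually (\<lambda>n. norm (real (m n) / real (size (M n - A n))) \<le> 2 * (real (m n) / ?size n)) sequentially"
        using half
      proof eventually_elim
        case (elim n)
        then have 1: "?size n \<le> 2 * real (size (M n - A n))" "real (size (M n - A n)) > 0" "?size n > 0" by linarith+
        have "real (m n) * ?size n \<le> real (m n) * (2 * real (size (M n - A n)))"
          using 1(1) by (rule mult_left_mono) simp
        then show ?case using 1(2,3) by (simp add: field_simps)
      qed
    qed
    obtain B where B: "eventually (\<lambda>n. \<bar>real (sum_mset (M n)) - ?size n\<bar> \<le> B) sequentially"
      using reg by (auto simp: regular_def)
    have "eventually (\<lambda>n. \<bar>real (sum_mset (M n - A n)) - real (size (M n - A n))\<bar> \<le> B + 1) sequentially"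
      using B
    proof eventually_elim
      case (elim n)
      have s: "sum_mset (M n) = sum_mset (M n - A n) + sum_mset (A n)"
        by (subst M) (rule sum_mset.union)
      have "A n = {#} \<or> size (A n) = sum_mset (A n) + 1" using A[of n] by auto
      then have "\<bar>real (sum_mset (A n)) - real (size (A n))\<bar> \<le> 1" by auto
      then show ?case using elim s size[of n] by linarith
    qed
    then show "\<exists>B. eventually (\<lambda>n. \<bar>real (sum_mset (M n - A n)) - real (size (M n - A n))\<bar> \<le> B) sequentially" by blast
  qed
qed

text \<open>
  Induction on \<open>k\<close>, splitting off the first block. Conditionally on its contents \<open>A\<close>, the other blocks are the
  first \<open>k\<close> blocks of a random arrangement of \<open>M - A\<close>. Uniformity in \<open>A\<close> is obtained by choosing for each \<open>n\<close>
  the most and the least favourable \<open>A\<close>: the induction hypothesis applies to both resulting sequences.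
\<close>

theorem block_prob_tendsto:
  assumes "regular p M m" "summable (\<lambda>i. (real i)\<^sup>2 * pmf p i)"
    and "Gcd {int i - int j | i j. i \<in> set_pmf p \<and> j \<in> set_pmf p} = 1"
  shows "(\<lambda>n. sqrt (real (m n)) ^ k * block_prob (m n) k (M n)) \<longlonglongrightarrow> (1 / sqrt (2 * pi * mean_square_deviation p)) ^ k"
  using assms(1)
proof (induction k arbitrary: M)
  case 0
  then show ?case by (simp add: block_prob_0)
next
  case (Suc k)
  let ?c = "1 / sqrt (2 * pi * mean_square_deviation p)"
  let ?s = "\<lambda>n. sqrt (real (m n))"
  let ?As = "\<lambda>n. block_multisets (m n) (M n)"
  let ?f = "\<lambda>n A. block_prob (m n) k (M n - A)"
  have ex: "\<exists>A B. (A \<subseteq># M n \<and> (A = {#} \<or> size A = m n \<and> sum_mset A + 1 = m n)) \<and>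
      (B \<subseteq># M n \<and> (B = {#} \<or> size B = m n \<and> sum_mset B + 1 = m n)) \<and>
      (\<forall>C\<in>?As n. ?f n A \<le> ?f n C \<and> ?f n C \<le> ?f n B)" for n
  \<comment> \<open>If no admissible first block exists then the empty multiset serves as a placeholder, which
    keeps the sequence of remainders regular.\<close>
  proof (cases "?As n = {}")
    case True
    then show ?thesis by (intro exI[of _ "{#}"]) auto
  next
    case False
    define A where "A = arg_min_on (?f n) (?As n)"
    define B where "B = arg_min_on (\<lambda>A. - ?f n A) (?As n)"
    have "A \<in> ?As n" "B \<in> ?As n"
      unfolding A_def B_def using False finite_block_multisets by (auto intro: arg_min_if_finite)
    moreover have "?f n A \<le> ?f n C" "?f n C \<le> ?f n B" if "C \<in> ?As n" for C
      using arg_min_least[OF finite_block_multisets False that, of "?f n"]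
        arg_min_least[OF finite_block_multisets False that, of "\<lambda>A. - ?f n A"]
      by (simp_all add: A_def B_def)
    ultimately show ?thesis unfolding block_multisets_def by blast
  qed
  then obtain A B where
    A: "\<And>n. A n \<subseteq># M n \<and> (A n = {#} \<or> size (A n) = m n \<and> sum_mset (A n) + 1 = m n)" and
    B: "\<And>n. B n \<subseteq># M n \<and> (B n = {#} \<or> size (B n) = m n \<and> sum_mset (B n) + 1 = m n)" and
    AB: "\<And>n C. C \<in> ?As n \<Longrightarrow> ?f n (A n) \<le> ?f n C \<and> ?f n C \<le> ?f n (B n)"
    by metis
  have limA: "(\<lambda>n. ?s n ^ k * ?f n (A n)) \<longlonglongrightarrow> ?c ^ k"
    by (rule Suc.IH) (rule regular_remove[OF Suc.prems A])
  have limB: "(\<lambda>n. ?s n ^ k * ?f n (B n)) \<longlonglongrightarrow> ?c ^ k"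
    by (rule Suc.IH) (rule regular_remove[OF Suc.prems B])
  have lim1: "(\<lambda>n. ?s n * block_prob (m n) 1 (M n)) \<longlonglongrightarrow> ?c"
    by (rule block_prob_1_tendsto[OF Suc.prems assms(2,3)])
  have le: "eventually (\<lambda>n. m n \<le> size (M n)) sequentially"
  proof -
    have "(\<lambda>n. real (m n) / real (size (M n))) \<longlonglongrightarrow> 0" using Suc.prems by (simp add: regular_def)
    then have "eventually (\<lambda>n. real (m n) / real (size (M n)) < 1) sequentially"
      by (rule order_tendstoD) simp
    moreover have "eventually (\<lambda>n. size (M n) \<ge> 1) sequentially"
      using Suc.prems by (simp add: regular_def filterlim_at_top)
    ultimately show ?thesis by eventually_elim (simp add: field_simps)
  qed
  show ?case
  proof (rule tendsto_sandwich)
    show "(\<lambda>n. (?s n * block_prob (m n) 1 (M n)) * (?s n ^ k * ?f n (A n))) \<longlonglongrightarrow> ?c ^ Suc k"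
      unfolding power_Suc by (rule tendsto_mult[OF lim1 limA])
    show "(\<lambda>n. (?s n * block_prob (m n) 1 (M n)) * (?s n ^ k * ?f n (B n))) \<longlonglongrightarrow> ?c ^ Suc k"
      unfolding power_Suc by (rule tendsto_mult[OF lim1 limB])
    show "eventually (\<lambda>n. (?s n * block_prob (m n) 1 (M n)) * (?s n ^ k * ?f n (A n)) \<le> ?s n ^ Suc k * block_prob (m n) (Suc k) (M n)) sequentially"
      using le
    proof eventually_elim
      case (elim n)
      have "?s n ^ Suc k * (block_prob (m n) 1 (M n) * ?f n (A n)) \<le> ?s n ^ Suc k * block_prob (m n) (Suc k) (M n)"
      proof (rule mult_left_mono)
        show "block_prob (m n) 1 (M n) * ?f n (A n) \<le> block_prob (m n) (Suc k) (M n)"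
          by (rule block_prob_Suc_bounds(1)[OF elim]) (rule AB)
      qed (rule zero_le_power, simp)
      then show ?case by (simp only: power_Suc mult_ac)
    qed
    show "eventually (\<lambda>n. ?s n ^ Suc k * block_prob (m n) (Suc k) (M n) \<le> (?s n * block_prob (m n) 1 (M n)) * (?s n ^ k * ?f n (B n))) sequentially"
      using le
    proof eventually_elim
      case (elim n)
      have "?s n ^ Suc k * block_prob (m n) (Suc k) (M n) \<le> ?s n ^ Suc k * (block_prob (m n) 1 (M n) * ?f n (B n))"
      proof (rule mult_left_mono)
        show "block_prob (m n) (Suc k) (M n) \<le> block_prob (m n) 1 (M n) * ?f n (B n)"
          by (rule block_prob_Suc_bounds(2)[OF elim]) (rule AB)
      qed (rule zero_le_power, simp)
      then show ?case by (simp only: power_Suc mult_ac)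
    qed
  qed
qed

section \<open>Random trees with given degree statistic\<close>

definition stat_multiset :: "(nat \<Rightarrow> nat) \<Rightarrow> nat multiset" where
  "stat_multiset n = (\<Sum>i | n i > 0. replicate_mset (n i) i)"

lemma sum_stat_multiset:
  fixes g :: "nat \<Rightarrow> 'b::comm_semiring_1"
  shows "(\<Sum>i\<in>#stat_multiset n. g i) = (\<Sum>i | n i > 0. of_nat (n i) * g i)"
proof -
  have "(\<Sum>i\<in>#(\<Sum>i\<in>S. replicate_mset (n i) i). g i) = (\<Sum>i\<in>S. of_nat (n i) * g i)" for S
    by (induction S rule: infinite_finite_induct) (auto simp: image_mset_union)
  then show ?thesis by (simp add: stat_multiset_def)
qed

lemma count_stat_multiset:
  assumes "finite {i. n i > 0}"
  shows "count (stat_multiset n) i = n i"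
  using assms by (simp add: stat_multiset_def count_sum sum.delta)

lemma size_stat_multiset: "size (stat_multiset n) = stat_size n"
  using sum_stat_multiset[of "\<lambda>_. 1::nat" n] by (simp add: stat_size_def)

lemma sum_mset_stat_multiset:
  assumes "degree_statistic n"
  shows "sum_mset (stat_multiset n) + 1 = size (stat_multiset n)"
  using assms sum_stat_multiset[of "\<lambda>i. i" n]
  by (simp add: degree_statistic_def size_stat_multiset stat_size_def mult.commute)

lemma trees_with_eq:
  assumes "finite {i. n i > 0}"
  shows "trees_with n = {T. mset (preorder_word T) = stat_multiset n}"
  unfolding trees_with_def
  by (auto simp: multiset_eq_iff count_stat_multiset[OF assms] count_mset_preorder_word simp del: count_mset)

lemma bij_betw_preorder_word:
  assumes "finite {i. n i > 0}"
  shows "bij_betw preorder_word (trees_with n) {w \<in> permutations_of_multiset (stat_multiset n). tree_word w}"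
  unfolding bij_betw_def trees_with_eq[OF assms]
  using inj_preorder_word by (auto simp: permutations_of_multiset_def tree_word_def intro: inj_on_subset)

lemma trees_with_finite_nonempty:
  assumes "degree_statistic n"
  shows "finite (trees_with n)" "trees_with n \<noteq> {}"
    and "stat_size n * card (trees_with n) = card (permutations_of_multiset (stat_multiset n))"
proof -
  have fin: "finite {i. n i > 0}" using assms by (simp add: degree_statistic_def)
  note bij = bij_betw_preorder_word[OF fin]
  show "finite (trees_with n)" using bij_betw_finite[OF bij] by simp
  have "card (permutations_of_multiset (stat_multiset n)) = stat_size n * card {w \<in> permutations_of_multiset (stat_multiset n). tree_word w}"
    using sum_rotation_invariant[OF sum_mset_stat_multiset[OF assms], of "\<lambda>_. 1"] by (simp add: size_stat_multiset)
  then show c: "stat_size n * card (trees_with n) = card (permutations_of_multiset (stat_multiset n))"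
    using bij_betw_same_card[OF bij] by simp
  show "trees_with n \<noteq> {}"
  proof
    assume "trees_with n = {}"
    then have "card (permutations_of_multiset (stat_multiset n)) = 0" using c by (metis card.empty mult_0_right)
    then show False using card_permutations_pos[of "stat_multiset n"] by linarith
  qed
qed

text \<open>
  Rotation invariance passes from trees to arrangements and cancels the factor \<open>stat_size n\<close>; the cycle lemma
  inside the \<open>k\<close> blocks contributes the power of \<open>m\<close>.
\<close>

lemma expectation_binomial_num_fringe:
  assumes n: "degree_statistic n" and m: "1 \<le> m" "m \<le> stat_size n" and k: "k * m \<le> stat_size n"
  shows "measure_pmf.expectation (map_pmf (num_fringe m) (random_tree n)) (\<lambda>x. real (x choose k)) =
    real (card (separated (stat_size n) m k)) / (fact k * real m ^ k) * block_prob m k (stat_multiset n)"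
proof -
  let ?M = "stat_multiset n"
  let ?S = "permutations_of_multiset ?M"
  note fin = trees_with_finite_nonempty[OF n]
  have finn: "finite {i. n i > 0}" using n by (simp add: degree_statistic_def)
  note bij = bij_betw_preorder_word[OF finn]
  have len: "length (preorder_word T) = stat_size n" if "T \<in> trees_with n" for T
    using that unfolding trees_with_eq[OF finn] size_stat_multiset[symmetric] by (metis mem_Collect_eq size_mset)
  have "(\<Sum>T\<in>trees_with n. num_fringe m T choose k) = (\<Sum>T\<in>trees_with n. cyclic_fringe m (preorder_word T) choose k)"
    using m(2) len by (intro sum.cong refl) (simp add: num_fringe_eq_cyclic_fringe)
  also have "\<dots> = (\<Sum>w\<in>{w \<in> ?S. tree_word w}. cyclic_fringe m w choose k)"
    by (rule sum.reindex_bij_betw[OF bij])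
  finally have "stat_size n * (\<Sum>T\<in>trees_with n. num_fringe m T choose k) = (\<Sum>w\<in>?S. cyclic_fringe m w choose k)"
    using sum_rotation_invariant[OF sum_mset_stat_multiset[OF n], of "\<lambda>w. cyclic_fringe m w choose k"]
    by (simp add: size_stat_multiset cyclic_fringe_rotate)
  then have "fact k * m ^ k * (stat_size n * (\<Sum>T\<in>trees_with n. num_fringe m T choose k)) =
      card (separated (stat_size n) m k) * (m ^ k * num_initial m tree_word k ?M)"
    using sum_binomial_cyclic_fringe[of m ?M k] m by (simp add: size_stat_multiset mult_ac)
  also have "m ^ k * num_initial m tree_word k ?M = num_initial m (\<lambda>u. sum_list u + 1 = m) k ?M"
    using k m by (intro num_initial_tree_word) (simp_all add: size_stat_multiset)
  finally have "real (fact k * m ^ k * (stat_size n * (\<Sum>T\<in>trees_with n. num_fringe m T choose k))) =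
      real (card (separated (stat_size n) m k) * num_initial m (\<lambda>u. sum_list u + 1 = m) k ?M)" by (simp only:)
  then have eq: "fact k * real m ^ k * (real (stat_size n) * (\<Sum>T\<in>trees_with n. real (num_fringe m T choose k))) =
      real (card (separated (stat_size n) m k)) * real (num_initial m (\<lambda>u. sum_list u + 1 = m) k ?M)"
    by simp
  have c: "real (stat_size n) * real (card (trees_with n)) = real (card ?S)"
    using fin(3) by (metis of_nat_mult)
  have pos: "real (stat_size n) > 0" "real (card (trees_with n)) > 0" "real m ^ k > 0" "real (card ?S) > 0"
    using m fin card_permutations_pos[of ?M] by (auto simp: card_gt_0_iff)
  have "measure_pmf.expectation (map_pmf (num_fringe m) (random_tree n)) (\<lambda>x. real (x choose k)) =
      (\<Sum>T\<in>trees_with n. real (num_fringe m T choose k)) / real (card (trees_with n))"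
    unfolding random_tree_def using fin by (simp add: integral_pmf_of_set)
  also have "\<dots> = (real (stat_size n) * (\<Sum>T\<in>trees_with n. real (num_fringe m T choose k))) / real (card ?S)"
    unfolding c[symmetric] using pos by simp
  also have "real (stat_size n) * (\<Sum>T\<in>trees_with n. real (num_fringe m T choose k)) =
     real (card (separated (stat_size n) m k)) * real (num_initial m (\<lambda>u. sum_list u + 1 = m) k ?M) / (fact k * real m ^ k)"
    using eq pos by (simp add: field_simps)
  finally show ?thesis by (simp add: block_prob_def)
qed

text \<open>
  By \<open>card_separated_ge\<close>, adding one more starting point loses at most the fraction \<open>2 k m / N\<close>, which tends to 0.
\<close>

lemma separated_tendsto:
  assumes m: "eventually (\<lambda>\<kappa>. 1 \<le> m \<kappa> \<and> m \<kappa> \<le> N \<kappa>) sequentially"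
    and mN: "(\<lambda>\<kappa>. real (m \<kappa>) / real (N \<kappa>)) \<longlonglongrightarrow> 0"
  shows "(\<lambda>\<kappa>. real (card (separated (N \<kappa>) (m \<kappa>) k)) / real (N \<kappa>) ^ k) \<longlonglongrightarrow> 1"
proof (induction k)
  case 0
  have "separated N' m' 0 = {[]}" for N' m' by (auto simp: separated_def)
  then show ?case by simp
next
  case (Suc k)
  let ?s = "\<lambda>k \<kappa>. real (card (separated (N \<kappa>) (m \<kappa>) k)) / real (N \<kappa>) ^ k"
  show ?case
  proof (rule tendsto_sandwich)
    have "(\<lambda>\<kappa>. ?s k \<kappa> * (1 - 2 * real k * (real (m \<kappa>) / real (N \<kappa>)))) \<longlonglongrightarrow> 1 * (1 - 2 * real k * 0)"
      by (intro tendsto_mult tendsto_diff tendsto_const Suc.IH mN)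
    then show "(\<lambda>\<kappa>. ?s k \<kappa> * (1 - 2 * real k * (real (m \<kappa>) / real (N \<kappa>)))) \<longlonglongrightarrow> 1" by simp
    show "eventually (\<lambda>\<kappa>. ?s k \<kappa> * (1 - 2 * real k * (real (m \<kappa>) / real (N \<kappa>))) \<le> ?s (Suc k) \<kappa>) sequentially"
      using m
    proof eventually_elim
      case (elim \<kappa>)
      then have N: "real (N \<kappa>) > 0" by linarith
      have "?s k \<kappa> * (1 - 2 * real k * (real (m \<kappa>) / real (N \<kappa>))) =
          real (card (separated (N \<kappa>) (m \<kappa>) k)) * (real (N \<kappa>) - 2 * real (m \<kappa>) * real k) / real (N \<kappa>) ^ Suc k"
        using N by (simp add: field_simps)
      also have "\<dots> \<le> ?s (Suc k) \<kappa>"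
        using card_separated_ge[of "m \<kappa>" "N \<kappa>" k] elim N by (intro divide_right_mono) auto
      finally show ?case .
    qed
    show "eventually (\<lambda>\<kappa>. ?s (Suc k) \<kappa> \<le> 1) sequentially"
      using m
    proof eventually_elim
      case (elim \<kappa>)
      then have N: "real (N \<kappa>) ^ Suc k > 0" by simp
      have "real (card (separated (N \<kappa>) (m \<kappa>) (Suc k))) \<le> real (N \<kappa>) ^ Suc k"
        using card_separated_le[of "N \<kappa>" "m \<kappa>" "Suc k"] by (metis of_nat_le_iff of_nat_power)
      with N show ?case by (simp only: divide_le_eq_1) simp
    qed
  qed (rule tendsto_const)
qed

lemma expectation_nat_pmf:
  fixes f :: "nat \<Rightarrow> real"
  assumes "summable (\<lambda>i. \<bar>f i\<bar> * pmf p i)"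
  shows "measure_pmf.expectation p f = (\<Sum>i. f i * pmf p i)"
proof -
  have "integrable (count_space UNIV) (\<lambda>i. pmf p i * f i)"
    using assms by (simp add: integrable_count_space_nat_iff abs_mult mult.commute)
  then have "(\<integral>i. pmf p i * f i \<partial>count_space UNIV) = (\<Sum>i. pmf p i * f i)"
    by (rule integral_count_space_nat)
  then show ?thesis
    by (simp add: measure_pmf_eq_density integral_density mult.commute)
qed

text \<open>
  The hypothesis says that the mean is 1.
\<close>

lemma variance_nat_pmf_mean_1:
  fixes p :: "nat pmf"
  assumes s: "summable (\<lambda>i. (real i)\<^sup>2 * pmf p i)" and mean: "(\<Sum>i. (real i - 1) * pmf p i) = 0"
  shows "measure_pmf.variance p real = mean_square_deviation p"
proof -
  have dom: "summable (\<lambda>i. \<bar>f i\<bar> * pmf p i)" if "\<And>i. i > 0 \<Longrightarrow> \<bar>f i\<bar> \<le> (real i)\<^sup>2" for f :: "nat \<Rightarrow> real"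
  proof (rule summable_comparison_test_ev[OF _ s])
    show "eventually (\<lambda>i. norm (\<bar>f i\<bar> * pmf p i) \<le> (real i)\<^sup>2 * pmf p i) sequentially"
      using eventually_gt_at_top[of 0] by eventually_elim (simp add: mult_right_mono that)
  qed
  have sq: "\<bar>(real i - 1)\<^sup>2\<bar> \<le> (real i)\<^sup>2" if "i > 0" for i :: nat
    using that abs_le_square_iff[of "real i - 1" "real i"] by simp
  have lin: "\<bar>real i\<bar> \<le> (real i)\<^sup>2" if "i > 0" for i :: nat
    using that mult_left_mono[of 1 "real i" "real i"] by (simp add: power2_eq_square)
  have "measure_pmf.expectation p real - 1 = measure_pmf.expectation p (\<lambda>i. real i - 1)"
  proof -
    have "integrable (measure_pmf p) real"
      using dom[OF lin] by (simp add: measure_pmf_eq_density integrable_density integrable_count_space_nat_iff abs_mult mult.commute)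
    then show ?thesis by simp
  qed
  also have "\<dots> = 0"
  proof -
    have "\<bar>real i - 1\<bar> \<le> (real i)\<^sup>2" if "i > 0" for i :: nat
    proof -
      have "real i \<ge> 1" using that by simp
      then show ?thesis using lin[OF that] by linarith
    qed
    from expectation_nat_pmf[OF dom[OF this]] show ?thesis using mean by simp
  qed
  finally have "measure_pmf.expectation p real = 1" by simp
  then show ?thesis
    using expectation_nat_pmf[OF dom[OF sq]] by (simp add: mean_square_deviation_def)
qed

lemma Gcd_support_of_nonlattice:
  assumes "nonlattice p"
  shows "Gcd {int i - int j | i j. i \<in> set_pmf p \<and> j \<in> set_pmf p} = 1"
proof -
  have "lattice_span p = 1" using assms by (simp add: nonlattice_def)
  then have "nat (Gcd {int i - int j | i j. pmf p i > 0 \<and> pmf p j > 0}) = 1"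
    by (auto simp: lattice_span_def one_enat_def split: if_splits)
  then have "nat (Gcd {int i - int j | i j. i \<in> set_pmf p \<and> j \<in> set_pmf p}) = 1"
    by (simp only: pmf_positive_iff)
  then show ?thesis by linarith
qed

text \<open>
  Convergence of the second moments together with pointwise convergence gives uniform integrability: the part
  of the second moment above \<open>K\<close> converges to that of \<open>p\<close>, which is small for large \<open>K\<close>.
\<close>

lemma regular_stat_multiset:
  assumes ev: "eventually (\<lambda>\<kappa>. degree_statistic (n \<kappa>) \<and> stat_size (n \<kappa>) > 0) sequentially"
    and size: "filterlim (\<lambda>\<kappa>. stat_size (n \<kappa>)) at_top sequentially"
    and freq: "\<And>i. (\<lambda>\<kappa>. stat_prob (n \<kappa>) i) \<longlonglongrightarrow> pmf p i"
    and summ: "summable (\<lambda>i. (real i)\<^sup>2 * pmf p i)"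
    and second: "(\<lambda>\<kappa>. \<Sum>i. (real i)\<^sup>2 * stat_prob (n \<kappa>) i) \<longlonglongrightarrow> (\<Sum>i. (real i)\<^sup>2 * pmf p i)"
    and m_top: "filterlim m at_top sequentially"
    and mN: "(\<lambda>\<kappa>. real (m \<kappa>) / real (stat_size (n \<kappa>))) \<longlonglongrightarrow> 0"
  shows "regular p (\<lambda>\<kappa>. stat_multiset (n \<kappa>)) m"
  unfolding regular_def size_stat_multiset
proof (intro conjI allI impI)
  show "filterlim (\<lambda>\<kappa>. stat_size (n \<kappa>)) at_top sequentially" by (rule size)
  have freq_ev: "eventually (\<lambda>\<kappa>. stat_prob (n \<kappa>) i = real (count (stat_multiset (n \<kappa>)) i) / real (stat_size (n \<kappa>))) sequentially" for i
    using ev by eventually_elim (simp add: stat_prob_def count_stat_multiset degree_statistic_def)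
  show "(\<lambda>\<kappa>. real (count (stat_multiset (n \<kappa>)) i) / real (stat_size (n \<kappa>))) \<longlonglongrightarrow> pmf p i" for i
    by (rule Lim_transform_eventually[OF freq freq_ev])
  show "\<exists>K. eventually (\<lambda>\<kappa>. (\<Sum>i\<in>#stat_multiset (n \<kappa>). if K < i then (real i)\<^sup>2 else 0) \<le> \<epsilon> * real (stat_size (n \<kappa>))) sequentially"
    if \<epsilon>: "\<epsilon> > 0" for \<epsilon> :: real
  proof -
    let ?Q = "\<Sum>i. (real i)\<^sup>2 * pmf p i"
    have "(\<lambda>K. \<Sum>i<K. (real i)\<^sup>2 * pmf p i) \<longlonglongrightarrow> ?Q" by (rule summable_LIMSEQ[OF summ])
    then have "eventually (\<lambda>K. (\<Sum>i<K. (real i)\<^sup>2 * pmf p i) > ?Q - \<epsilon>) sequentially"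
      using \<epsilon> by (intro order_tendstoD(1)) auto
    then obtain K0 where K0: "\<And>K. K \<ge> K0 \<Longrightarrow> (\<Sum>i<K. (real i)\<^sup>2 * pmf p i) > ?Q - \<epsilon>"
      unfolding eventually_sequentially by blast
    have K: "(\<Sum>i\<le>K0. (real i)\<^sup>2 * pmf p i) > ?Q - \<epsilon>"
      using K0[of "Suc K0"] by (simp add: lessThan_Suc_atMost)
    have "(\<lambda>\<kappa>. (\<Sum>i. (real i)\<^sup>2 * stat_prob (n \<kappa>) i) - (\<Sum>i\<le>K0. (real i)\<^sup>2 * stat_prob (n \<kappa>) i))
        \<longlonglongrightarrow> ?Q - (\<Sum>i\<le>K0. (real i)\<^sup>2 * pmf p i)"
      by (intro tendsto_intros freq second)
    then have "eventually (\<lambda>\<kappa>. (\<Sum>i. (real i)\<^sup>2 * stat_prob (n \<kappa>) i) - (\<Sum>i\<le>K0. (real i)\<^sup>2 * stat_prob (n \<kappa>) i) < \<epsilon>) sequentially"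
      using K by (intro order_tendstoD(2)) auto
    then have "eventually (\<lambda>\<kappa>. (\<Sum>i\<in>#stat_multiset (n \<kappa>). if K0 < i then (real i)\<^sup>2 else 0) \<le> \<epsilon> * real (stat_size (n \<kappa>))) sequentially"
      using ev
    proof eventually_elim
      case (elim \<kappa>)
      let ?supp = "{i. n \<kappa> i > 0}"
      have fin: "finite ?supp" using elim(2) by (simp add: degree_statistic_def)
      have N: "real (stat_size (n \<kappa>)) > 0" using elim(2) by simp
      have 1: "(\<Sum>i. (real i)\<^sup>2 * stat_prob (n \<kappa>) i) = (\<Sum>i\<in>?supp. (real i)\<^sup>2 * stat_prob (n \<kappa>) i)"
        by (rule suminf_finite[OF fin]) (simp add: stat_prob_def)
      have 2: "(\<Sum>i\<le>K0. (real i)\<^sup>2 * stat_prob (n \<kappa>) i) = (\<Sum>i\<in>?supp. if i \<le> K0 then (real i)\<^sup>2 * stat_prob (n \<kappa>) i else 0)"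
      proof -
        have "(\<Sum>i\<le>K0. (real i)\<^sup>2 * stat_prob (n \<kappa>) i) = (\<Sum>i\<in>?supp \<inter> {..K0}. (real i)\<^sup>2 * stat_prob (n \<kappa>) i)"
          by (rule sum.mono_neutral_right) (auto simp: stat_prob_def)
        also have "\<dots> = (\<Sum>i\<in>?supp. if i \<le> K0 then (real i)\<^sup>2 * stat_prob (n \<kappa>) i else 0)"
          by (subst sum.inter_restrict[OF fin]) simp
        finally show ?thesis .
      qed
      have "(\<Sum>i\<in>#stat_multiset (n \<kappa>). if K0 < i then (real i)\<^sup>2 else 0) / real (stat_size (n \<kappa>))
          = (\<Sum>i\<in>?supp. real (n \<kappa> i) * (if K0 < i then (real i)\<^sup>2 else 0)) / real (stat_size (n \<kappa>))"
        unfolding sum_stat_multiset ..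
      also have "\<dots> = (\<Sum>i\<in>?supp. (real i)\<^sup>2 * stat_prob (n \<kappa>) i - (if i \<le> K0 then (real i)\<^sup>2 * stat_prob (n \<kappa>) i else 0))"
        unfolding sum_divide_distrib by (intro sum.cong refl) (auto simp: stat_prob_def)
      also have "\<dots> = (\<Sum>i. (real i)\<^sup>2 * stat_prob (n \<kappa>) i) - (\<Sum>i\<le>K0. (real i)\<^sup>2 * stat_prob (n \<kappa>) i)"
        unfolding 1 2 sum_subtractf ..
      finally have "(\<Sum>i\<in>#stat_multiset (n \<kappa>). if K0 < i then (real i)\<^sup>2 else 0) / real (stat_size (n \<kappa>)) < \<epsilon>" using elim(1) by simp
      then show ?case using N by (simp add: pos_divide_less_eq less_imp_le)
    qed
    then show ?thesis by blast
  qed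
  have "eventually (\<lambda>\<kappa>. \<bar>real (sum_mset (stat_multiset (n \<kappa>))) - real (stat_size (n \<kappa>))\<bar> \<le> 1) sequentially"
    using ev
  proof eventually_elim
    case (elim \<kappa>)
    then have "sum_mset (stat_multiset (n \<kappa>)) + 1 = stat_size (n \<kappa>)"
      using sum_mset_stat_multiset[of "n \<kappa>"] by (simp add: size_stat_multiset)
    then show ?case by linarith
  qed
  then show "\<exists>B. eventually (\<lambda>\<kappa>. \<bar>real (sum_mset (stat_multiset (n \<kappa>))) - real (stat_size (n \<kappa>))\<bar> \<le> B) sequentially" by blast
qed (rule m_top mN)+

text \<open>
  The average of \<open>d - 1\<close> over a row tends to 0 because the row sums are balanced, and to its mean under \<open>p\<close>
  by uniform integrability.
\<close>

lemma mean_1_of_regular: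
  assumes "regular p M m" "summable (\<lambda>i. (real i)\<^sup>2 * pmf p i)"
    and "Gcd {int i - int j | i j. i \<in> set_pmf p \<and> j \<in> set_pmf p} = 1"
  shows "(\<Sum>i. (real i - 1) * pmf p i) = 0" and "mean_square_deviation p > 0"
proof -
  have "\<exists>xs. mset xs = M \<kappa>" for \<kappa> by (rule ex_mset)
  then obtain xs where xs: "\<And>\<kappa>. mset (xs \<kappa>) = M \<kappa>" by metis
  interpret sampling_array "\<lambda>\<kappa>. size (M \<kappa>)" "\<lambda>\<kappa> j. xs \<kappa> ! j" p m
    by (rule sampling_array_of_regular[OF assms xs])
  show "mean_square_deviation p > 0" by (rule variance_pos)
  have "\<bar>real i - 1\<bar> \<le> 1 * (real i)\<^sup>2" if "i > 0" for i :: nat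
  proof -
    have "real i \<ge> 1" using that by simp
    then show ?thesis using mult_left_mono[of 1 "real i" "real i"] unfolding power2_eq_square by linarith
  qed
  from tendsto_average[OF this] have
    "(\<lambda>\<kappa>. (\<Sum>j<size (M \<kappa>). real (xs \<kappa> ! j) - 1) / real (size (M \<kappa>))) \<longlonglongrightarrow> (\<Sum>i. (real i - 1) * pmf p i)" .
  moreover obtain B where "eventually (\<lambda>\<kappa>. \<bar>\<Sum>j<size (M \<kappa>). real (xs \<kappa> ! j) - 1\<bar> \<le> B) sequentially"
    using balanced by blast
  from bounded_over_at_top[OF this real_N_at_top]
  have "(\<lambda>\<kappa>. (\<Sum>j<size (M \<kappa>). real (xs \<kappa> ! j) - 1) / real (size (M \<kappa>))) \<longlonglongrightarrow> 0" .
  ultimately show "(\<Sum>i. (real i - 1) * pmf p i) = 0" by (rule LIMSEQ_unique)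
qed

lemma filterlim_powr_at_top:
  fixes s :: real
  assumes "s > 0"
  shows "filterlim (\<lambda>x. x powr s) at_top at_top"
proof -
  have "filterlim (\<lambda>x. exp (s * ln x)) at_top at_top"
    by (intro filterlim_compose[OF exp_at_top] filterlim_tendsto_pos_mult_at_top[OF tendsto_const assms ln_at_top])
  then show ?thesis
  proof (rule filterlim_mono_eventually[OF _ order_refl order_refl])
    show "eventually (\<lambda>x. exp (s * ln x) = x powr s) at_top"
      using eventually_gt_at_top[of 0] by eventually_elim (simp add: powr_def)
  qed
qed

theorem theorem5p2:
  fixes n :: "nat \<Rightarrow> nat \<Rightarrow> nat" and p :: "nat pmf" and m :: "nat \<Rightarrow> nat" and a :: real
  assumes "\<And>\<kappa>. \<kappa> \<ge> 1 \<Longrightarrow> degree_statistic (n \<kappa>)"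
    and "filterlim (\<lambda>\<kappa>. stat_size (n \<kappa>)) at_top sequentially"
    and "\<And>i. (\<lambda>\<kappa>. stat_prob (n \<kappa>) i) \<longlonglongrightarrow> pmf p i"
    and "summable (\<lambda>i. (real i)\<^sup>2 * pmf p i)"
    and "(\<lambda>\<kappa>. \<Sum>i. (real i)\<^sup>2 * stat_prob (n \<kappa>) i) \<longlonglongrightarrow> (\<Sum>i. (real i)\<^sup>2 * pmf p i)"
    and "nonlattice p"
    and "\<And>\<kappa>. \<kappa> \<ge> 1 \<Longrightarrow> 1 \<le> m \<kappa> \<and> m \<kappa> \<le> stat_size (n \<kappa>)"
    and "a > 0"
    and "(\<lambda>\<kappa>. real (m \<kappa>)) \<sim>[sequentially] (\<lambda>\<kappa>. a * real (stat_size (n \<kappa>)) powr (2 / 3))"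
  shows "weak_conv_m
    (\<lambda>\<kappa>. distr (random_tree (n \<kappa>)) borel (\<lambda>T. real (num_fringe (m \<kappa>) T)))
    (distr (poisson_pmf ((2 * pi * measure_pmf.variance p real * a ^ 3) powr (- 1 / 2))) borel real)"
proof -
  define M where "M \<kappa> = stat_multiset (n \<kappa>)" for \<kappa>
  define N where "N \<kappa> = stat_size (n \<kappa>)" for \<kappa>
  \<comment> \<open>The hypothesis on \<open>m\<close> says that \<open>t\<close> tends to 1.\<close>
  define t where "t \<kappa> = real (m \<kappa>) / (a * real (N \<kappa>) powr (2 / 3))" for \<kappa>
  note gcd1 = Gcd_support_of_nonlattice[OF assms(6)]
  have sizeM: "size (M \<kappa>) = N \<kappa>" for \<kappa> by (simp add: M_def N_def size_stat_multiset)
  have ev: "eventually (\<lambda>\<kappa>. degree_statistic (n \<kappa>) \<and> 1 \<le> m \<kappa> \<and> m \<kappa> \<le> N \<kappa> \<and> N \<kappa> > 0) sequentially"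
    using eventually_ge_at_top[of 1]
  proof eventually_elim
    case (elim \<kappa>)
    then show ?case using assms(1)[of \<kappa>] assms(7)[of \<kappa>] by (auto simp: N_def)
  qed
  have N_top: "filterlim (\<lambda>\<kappa>. real (N \<kappa>)) at_top sequentially"
    unfolding N_def by (intro filterlim_compose[OF filterlim_real_sequentially] assms(2))
  have t_lim: "t \<longlonglongrightarrow> 1"
  proof -
    have "((\<lambda>\<kappa>. if real (m \<kappa>) = 0 \<and> a * real (stat_size (n \<kappa>)) powr (2 / 3) = 0 then 1
        else real (m \<kappa>) / (a * real (stat_size (n \<kappa>)) powr (2 / 3))) \<longlongrightarrow> 1) sequentially"
      using assms(9) by (simp add: asymp_equiv_def)
    then show ?thesis
      by (rule Lim_transform_eventually) (use ev in eventually_elim, auto simp: t_def N_def)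
  qed
  have m_eq: "eventually (\<lambda>\<kappa>. real (m \<kappa>) = t \<kappa> * a * real (N \<kappa>) powr (2 / 3)) sequentially"
    using ev by eventually_elim (use assms(8) in \<open>simp add: t_def\<close>)
  have ta: "(\<lambda>\<kappa>. t \<kappa> * a) \<longlonglongrightarrow> a" using tendsto_mult[OF t_lim tendsto_const, of a] by simp
  have m_top: "filterlim m at_top sequentially"
  proof -
    have "filterlim (\<lambda>\<kappa>. t \<kappa> * a * real (N \<kappa>) powr (2 / 3)) at_top sequentially"
      by (rule filterlim_tendsto_pos_mult_at_top[OF ta assms(8)]) (rule filterlim_compose[OF filterlim_powr_at_top N_top], simp)
    then have "filterlim (\<lambda>\<kappa>. real (m \<kappa>)) at_top sequentially"
      by (rule filterlim_mono_eventually[OF _ order_refl order_refl]) (use m_eq in eventually_elim, simp)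
    then have "eventually (\<lambda>\<kappa>. real Z \<le> real (m \<kappa>)) sequentially" for Z
      by (simp only: filterlim_at_top)
    then show ?thesis by (simp add: filterlim_at_top)
  qed
  have mN: "(\<lambda>\<kappa>. real (m \<kappa>) / real (N \<kappa>)) \<longlonglongrightarrow> 0"
  proof -
    have "(\<lambda>\<kappa>. t \<kappa> * a * real (N \<kappa>) powr (- 1 / 3)) \<longlonglongrightarrow> a * 0"
      by (rule tendsto_mult[OF ta tendsto_neg_powr[OF _ N_top]]) simp
    then have "(\<lambda>\<kappa>. t \<kappa> * a * real (N \<kappa>) powr (- 1 / 3)) \<longlonglongrightarrow> 0" by simp
    moreover have "eventually (\<lambda>\<kappa>. t \<kappa> * a * real (N \<kappa>) powr (- 1 / 3) = real (m \<kappa>) / real (N \<kappa>)) sequentially"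
      using m_eq ev
    proof eventually_elim
      case (elim \<kappa>)
      have "real (N \<kappa>) powr (2 / 3 - 1) = real (N \<kappa>) powr (2 / 3) / real (N \<kappa>) powr 1"
        by (rule powr_diff)
      then have "real (N \<kappa>) powr (- 1 / 3) = real (N \<kappa>) powr (2 / 3) / real (N \<kappa>)"
        using elim(2) by simp
      then show ?case unfolding elim(1) by (simp only: times_divide_eq_right)
    qed
    ultimately show ?thesis by (rule Lim_transform_eventually)
  qed
  have reg: "regular p M m"
    unfolding M_def using assms(2-5) mN m_top ev
    by (intro regular_stat_multiset) (auto elim: eventually_mono simp: N_def)
  have V: "measure_pmf.variance p real = mean_square_deviation p" and Vpos: "mean_square_deviation p > 0"
    using variance_nat_pmf_mean_1[OF assms(4)] mean_1_of_regular[OF reg assms(4) gcd1] by auto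
  define rate where "rate = (2 * pi * measure_pmf.variance p real * a ^ 3) powr (- 1 / 2)"
  let ?c = "1 / sqrt (2 * pi * mean_square_deviation p)"
  have rate: "rate > 0" using Vpos assms(8) by (simp add: rate_def V)
  have rate_eq: "a powr (- 3 / 2) * ?c = rate"
  proof -
    have "rate = (2 * pi * mean_square_deviation p) powr (- 1 / 2) * (a ^ 3) powr (- 1 / 2)"
      unfolding rate_def V using Vpos assms(8) by (subst powr_mult) auto
    also have "(a ^ 3) powr (- 1 / 2) = a powr (- 3 / 2)"
      using assms(8) by (simp add: powr_powr flip: powr_numeral)
    also have "(2 * pi * mean_square_deviation p) powr (- 1 / 2) = ?c"
      using Vpos by (simp add: powr_minus_divide powr_half_sqrt)
    finally show ?thesis by simp
  qed
  define X where "X \<kappa> = map_pmf (num_fringe (m \<kappa>)) (random_tree (n \<kappa>))" for \<kappa>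
  have ratio: "(\<lambda>\<kappa>. real (N \<kappa>) / (real (m \<kappa>) * sqrt (real (m \<kappa>)))) \<longlonglongrightarrow> a powr (- 3 / 2)"
  proof -
    have "(\<lambda>\<kappa>. (t \<kappa> * a) powr (- 3 / 2)) \<longlonglongrightarrow> a powr (- 3 / 2)"
      using ta assms(8) by (intro tendsto_intros) auto
    moreover have "eventually (\<lambda>\<kappa>. (t \<kappa> * a) powr (- 3 / 2) = real (N \<kappa>) / (real (m \<kappa>) * sqrt (real (m \<kappa>)))) sequentially"
      using m_eq ev
    proof eventually_elim
      case (elim \<kappa>)
      have pos: "real (m \<kappa>) > 0" "real (N \<kappa>) > 0" using elim(2) by auto
      have "t \<kappa> * a = real (m \<kappa>) * real (N \<kappa>) powr (- 2 / 3)"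
        unfolding elim(1) using pos by (simp add: powr_minus field_simps)
      then have "(t \<kappa> * a) powr (- 3 / 2) = real (m \<kappa>) powr (- 3 / 2) * real (N \<kappa>)"
        using pos by (simp add: powr_mult powr_powr)
      also have "real (m \<kappa>) powr (- 3 / 2) = 1 / (real (m \<kappa>) * sqrt (real (m \<kappa>)))"
      proof -
        have "real (m \<kappa>) powr (3 / 2) = real (m \<kappa>) powr (1 + 1 / 2)" by simp
        also have "\<dots> = real (m \<kappa>) * sqrt (real (m \<kappa>))"
          using pos by (simp only: powr_add powr_half_sqrt powr_one less_imp_le)
        finally show ?thesis using powr_minus_divide[of "real (m \<kappa>)" "3 / 2"] by simp
      qed
      finally show ?case by simp
    qed
    ultimately show ?thesis by (rule Lim_transform_eventually)
  qed
  have moments: "(\<lambda>\<kappa>. measure_pmf.expectation (X \<kappa>) (\<lambda>x. real (x choose k))) \<longlonglongrightarrow> rate ^ k / fact k" for k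
  proof -
    have sep: "(\<lambda>\<kappa>. real (card (separated (N \<kappa>) (m \<kappa>) k)) / real (N \<kappa>) ^ k) \<longlonglongrightarrow> 1"
      using ev by (intro separated_tendsto mN) (auto elim: eventually_mono)
    have "(\<lambda>\<kappa>. real (card (separated (N \<kappa>) (m \<kappa>) k)) / real (N \<kappa>) ^ k *
        (real (N \<kappa>) / (real (m \<kappa>) * sqrt (real (m \<kappa>)))) ^ k *
        (sqrt (real (m \<kappa>)) ^ k * block_prob (m \<kappa>) k (M \<kappa>)) / fact k) \<longlonglongrightarrow> 1 * (a powr (- 3 / 2)) ^ k * ?c ^ k / fact k"
      by (intro tendsto_divide tendsto_mult tendsto_power tendsto_const sep ratio block_prob_tendsto[OF reg assms(4) gcd1]) simp
    also have "1 * (a powr (- 3 / 2)) ^ k * ?c ^ k / fact k = rate ^ k / fact k"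
      unfolding rate_eq[symmetric] power_mult_distrib by simp
    finally have lim: "(\<lambda>\<kappa>. real (card (separated (N \<kappa>) (m \<kappa>) k)) / real (N \<kappa>) ^ k *
        (real (N \<kappa>) / (real (m \<kappa>) * sqrt (real (m \<kappa>)))) ^ k *
        (sqrt (real (m \<kappa>)) ^ k * block_prob (m \<kappa>) k (M \<kappa>)) / fact k) \<longlonglongrightarrow> rate ^ k / fact k" .
    \<comment> \<open>The exact moment formula needs \<open>k\<close> blocks to fit into the word.\<close>
    have "(\<lambda>\<kappa>. real k * (real (m \<kappa>) / real (N \<kappa>))) \<longlonglongrightarrow> 0"
      using tendsto_mult[OF tendsto_const mN, of "real k"] by simp
    then have "eventually (\<lambda>\<kappa>. real k * (real (m \<kappa>) / real (N \<kappa>)) < 1) sequentially"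
      by (rule order_tendstoD) simp
    then have "eventually (\<lambda>\<kappa>. real (card (separated (N \<kappa>) (m \<kappa>) k)) / real (N \<kappa>) ^ k *
        (real (N \<kappa>) / (real (m \<kappa>) * sqrt (real (m \<kappa>)))) ^ k *
        (sqrt (real (m \<kappa>)) ^ k * block_prob (m \<kappa>) k (M \<kappa>)) / fact k =
        measure_pmf.expectation (X \<kappa>) (\<lambda>x. real (x choose k))) sequentially"
      using ev
    proof eventually_elim
      case (elim \<kappa>)
      have pos: "real (m \<kappa>) > 0" "real (N \<kappa>) > 0" "sqrt (real (m \<kappa>)) > 0" using elim(2) by auto
      have "real k * real (m \<kappa>) < real (N \<kappa>)" using elim(1) pos by (simp add: field_simps)
      then have "real (k * m \<kappa>) < real (N \<kappa>)" by simp
      then have km: "k * m \<kappa> \<le> N \<kappa>" by (simp only: of_nat_less_iff less_imp_le)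
      have "measure_pmf.expectation (X \<kappa>) (\<lambda>x. real (x choose k)) =
          real (card (separated (N \<kappa>) (m \<kappa>) k)) / (fact k * real (m \<kappa>) ^ k) * block_prob (m \<kappa>) k (M \<kappa>)"
        unfolding X_def M_def N_def using elim(2) km by (intro expectation_binomial_num_fringe) (auto simp: N_def)
      then show ?case using pos by (simp add: power_mult_distrib power_divide field_simps)
    qed
    with lim show ?thesis by (rule Lim_transform_eventually)
  qed
  have "(\<lambda>\<kappa>. pmf (X \<kappa>) j) \<longlonglongrightarrow> pmf (poisson_pmf rate) j" for j
  proof (rule tendsto_poisson_of_factorial_moments[OF rate _ moments])
    show "eventually (\<lambda>\<kappa>. finite (set_pmf (X \<kappa>))) sequentially"
      using ev
    proof eventually_elim
      case (elim \<kappa>)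
      then show ?case
        using trees_with_finite_nonempty[of "n \<kappa>"] by (simp add: X_def random_tree_def set_pmf_of_set)
    qed
  qed
  then have "weak_conv_m (\<lambda>\<kappa>. distr (X \<kappa>) borel real) (distr (poisson_pmf rate) borel real)"
    by (rule weak_conv_m_of_pmf)
  moreover have "distr (X \<kappa>) borel real = distr (random_tree (n \<kappa>)) borel (\<lambda>T. real (num_fringe (m \<kappa>) T))" for \<kappa>
    unfolding X_def map_pmf_rep_eq by (subst distr_distr) (auto simp: comp_def)
  ultimately show ?thesis unfolding rate_def by simp
qed

end
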